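(* Let $\mathcal{S}$ be a nonclassical Kantor-Knuth generalized quadrangle of order $(q,q^2)$, and let $\Omega_2$ be the $\mathrm{Aut}(\mathcal{S})$-orbit of size $(q-1)q^2$ on the subquadrangles of order $q$ of $\mathcal{S}$. Then no elements of $\Omega_2$ are doubly subtended. In particular, each element of $\Omega_2$ contains $(q+1)q^2(q-1)$ Kantor-Knuth ovoids which are $1$-subtended.
   Context: Kantor-Knuth quadrangle: let $q$ be an odd prime power, $m$ a nonsquare in $\mathbb{F}_q$ and $\sigma\in\mathrm{Aut}(\mathbb{F}_q)$. For $t\in\mathbb{F}_q$ put $A_t=\begin{pmatrix} t&0\\0&-mt^\sigma\end{pmatrix}$ and $K_t=A_t+A_t^T$. Let $G=\{(\alpha,c,\beta):\alpha,\beta\in\mathbb{F}_q^2,\,c\in\mathbb{F}_q\}$ with product $(\alpha,c,\beta)(\alpha',c',\beta')=(\alpha+\alpha',\,c+c'+\beta\alpha'^T,\,\beta+\beta')$. Put $A(t)=\{(\alpha,\alpha A_t\alpha^T,\alpha K_t):\alpha\in\mathbb{F}_q^2\}$ for $t\in\mathbb{F}_q$, $A(\infty)=\{(0,0,\beta):\beta\in\mathbb{F}_q^2\}$, and $A^*(t)=A(t)\cdot\{(0,c,0):c\in\mathbb{F}_q\}$ for $t\in\mathbb{F}_q\cup\{\infty\}$. The following geometry is a generalized quadrangle of order $(q^2,q)$: its points are the elements $g\in G$, the cosets $A^*(t)g$, and a symbol $(\infty)$; its lines are the cosets $A(t)g$ and the symbols $[A(t)]$; $(\infty)$ is incident with all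 lines $[A(t)]$, the point $A^*(t)g$ is incident with $[A(t)]$ and with the lines $A(t)h\subset A^*(t)g$, and $g$ is incident with the lines $A(t)g$; $t$ ranges over $\mathbb{F}_q\cup\{\infty\}$. The Kantor-Knuth quadrangle of order $(q,q^2)$ is its point-line dual. It is nonclassical (not isomorphic to $\mathcal{Q}(5,q)$, the quadrangle of the elliptic quadric in $\mathbf{PG}(5,q)$) precisely when $\sigma\ne 1$. The line corresponding to $(\infty)$ is denoted $[\infty]$. In the nonclassical case $\mathrm{Aut}(\mathcal{S})$ fixes $[\infty]$, and $\mathcal{S}$ has exactly $q^3+q^2$ subquadrangles of order $q$ (i.e. of order $(q,q)$); all are isomorphic to $\mathcal{Q}(4,q)$ (the quadrangle of the nonsingular parabolic quadric in $\mathbf{PG}(4,q)$) and all contain $[\infty]$. $\mathrm{Aut}(\mathcal{S})$ has exactly two orbits on them: $\Omega_1$ of size $2q^2$, and $\Omega_2$ of size $(q-1)q^2$. For a subquadrangle $\mathcal{S}'$ of order $q$ of $\mathcal{S}$ and a point $x$ of $\mathcal{S}$ not in $\mathcal{S}'$, the set $\mathcal{O}_x$ of points of $\mathcal{S}'$ collinear with $x$ is an ovoid of $\mathcal{S}'$ (a point set meeting each line of $\mathcal{S}'$ exactly once), said to be subtended by $x$. A subtended ovoid is $\theta$-subtended if exactly $\theta$ points of $\mathcal{S}\setminus\mathcal{S}'$ subtend it; $\mathcal{S}'$ is doubly subtended if every subtended ovoid of $\mathcal{S}'$ is $2$-subtended. A Kantor-Knuth ovoid of $\mathcal{Q}(4,q)$,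 with quadric $X_0X_4+X_1X_3+X_2^2=0$, is an ovoid equivalent under $\mathrm{Aut}(\mathcal{Q}(4,q))$ to one of the form $\{(0,0,0,0,1)\}\cup\{(1,x,y,-nx^\tau,\,nx^{\tau+1}-y^2):x,y\in\mathbb{F}_q\}$ with $n$ a nonsquare in $\mathbb{F}_q$ and $\tau\in\mathrm{Aut}(\mathbb{F}_q)$. *)

theory Defs
  imports
    "HOL-Analysis.Cartesian_Space"
    "HOL-Algebra.Coset"
    "HOL-Computational_Algebra.Nth_Powers"
begin

section \<open>Generalized quadrangles\<close>

record ('p, 'l) geometry =
  Points :: "'p set"
  Lines :: "'l set"
  Inc :: "('p \<times> 'l) set"

definition generalized_quadrangle :: "nat \<Rightarrow> nat \<Rightarrow> ('p, 'l) geometry \<Rightarrow> bool" where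
  "generalized_quadrangle s t S \<longleftrightarrow>
     s \<ge> 1 \<and> t \<ge> 1 \<and> Points S \<noteq> {} \<and> Lines S \<noteq> {} \<and> Inc S \<subseteq> Points S \<times> Lines S \<and>
     (\<forall>x\<in>Points S. card {L \<in> Lines S. (x, L) \<in> Inc S} = t + 1) \<and>
     (\<forall>L\<in>Lines S. card {x \<in> Points S. (x, L) \<in> Inc S} = s + 1) \<and>
     (\<forall>x\<in>Points S. \<forall>y\<in>Points S. \<forall>L\<in>Lines S. \<forall>M\<in>Lines S.
        x \<noteq> y \<and> (x, L) \<in> Inc S \<and> (y, L) \<in> Inc S \<and> (x, M) \<in> Inc S \<and> (y, M) \<in> Inc S \<longrightarrow> L = M) \<and>
     (\<forall>x\<in>Points S. \<forall>L\<in>Lines S. (x, L) \<notin> Inc S \<longrightarrow>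
        (\<exists>!(y, M). y \<in> Points S \<and> M \<in> Lines S \<and>
           (x, M) \<in> Inc S \<and> (y, M) \<in> Inc S \<and> (y, L) \<in> Inc S))"

definition dual :: "('p, 'l) geometry \<Rightarrow> ('l, 'p) geometry" where
  "dual S = \<lparr>Points = Lines S, Lines = Points S, Inc = (Inc S)\<inverse>\<rparr>"

text \<open>The maps of an isomorphism are only constrained on the points and lines.\<close>

definition isomorphism ::
  "('p, 'l) geometry \<Rightarrow> ('r, 'm) geometry \<Rightarrow> ('p \<Rightarrow> 'r) \<Rightarrow> ('l \<Rightarrow> 'm) \<Rightarrow> bool" where
  "isomorphism S T f g \<longleftrightarrow>
     bij_betw f (Points S) (Points T) \<and> bij_betw g (Lines S) (Lines T) \<and>
     (\<forall>x\<in>Points S. \<forall>L\<in>Lines S. (f x, g L) \<in> Inc T \<longleftrightarrow> (x, L) \<in> Inc S)"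

definition isomorphic :: "('p, 'l) geometry \<Rightarrow> ('r, 'm) geometry \<Rightarrow> bool" where
  "isomorphic S T \<longleftrightarrow> (\<exists>f g. isomorphism S T f g)"

abbreviation automorphism ::
  "('p, 'l) geometry \<Rightarrow> ('p \<Rightarrow> 'p) \<Rightarrow> ('l \<Rightarrow> 'l) \<Rightarrow> bool" where
  "automorphism S \<equiv> isomorphism S S"

definition subquadrangles :: "nat \<Rightarrow> nat \<Rightarrow> ('p, 'l) geometry \<Rightarrow> ('p, 'l) geometry set" where
  "subquadrangles s t S =
     {S'. Points S' \<subseteq> Points S \<and> Lines S' \<subseteq> Lines S \<and>
          Inc S' = Inc S \<inter> (Points S' \<times> Lines S') \<and> generalized_quadrangle s t S'}"

definition image_geometry ::
  "('p \<Rightarrow> 'r) \<Rightarrow> ('l \<Rightarrow> 'm) \<Rightarrow> ('p, 'l) geometry \<Rightarrow> ('r, 'm) geometry" where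
  "image_geometry f g S =
     \<lparr>Points = f ` Points S, Lines = g ` Lines S, Inc = map_prod f g ` Inc S\<rparr>"

definition aut_orbit :: "('p, 'l) geometry \<Rightarrow> ('p, 'l) geometry \<Rightarrow> ('p, 'l) geometry set" where
  "aut_orbit S S' = {image_geometry f g S' | f g. automorphism S f g}"


section \<open>Ovoids and subtended ovoids\<close>

definition collinear_in :: "('p, 'l) geometry \<Rightarrow> 'p \<Rightarrow> 'p \<Rightarrow> bool" where
  "collinear_in S x y \<longleftrightarrow> (\<exists>L\<in>Lines S. (x, L) \<in> Inc S \<and> (y, L) \<in> Inc S)"

definition ovoid :: "('p, 'l) geometry \<Rightarrow> 'p set \<Rightarrow> bool" where
  "ovoid S \<O> \<longleftrightarrow> \<O> \<subseteq> Points S \<and> (\<forall>L\<in>Lines S. \<exists>!x. x \<in> \<O> \<and> (x, L) \<in> Inc S)"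

definition subtended_by :: "('p, 'l) geometry \<Rightarrow> ('p, 'l) geometry \<Rightarrow> 'p \<Rightarrow> 'p set" where
  "subtended_by S S' x = {y \<in> Points S'. collinear_in S x y}"

definition subtended_ovoids :: "('p, 'l) geometry \<Rightarrow> ('p, 'l) geometry \<Rightarrow> 'p set set" where
  "subtended_ovoids S S' = subtended_by S S' ` (Points S - Points S')"

definition theta_subtended ::
  "('p, 'l) geometry \<Rightarrow> ('p, 'l) geometry \<Rightarrow> nat \<Rightarrow> 'p set \<Rightarrow> bool" where
  "theta_subtended S S' \<theta> \<O> \<longleftrightarrow> \<O> \<in> subtended_ovoids S S' \<and>
     card {x \<in> Points S - Points S'. subtended_by S S' x = \<O>} = \<theta>"

definition doubly_subtended :: "('p, 'l) geometry \<Rightarrow> ('p, 'l) geometry \<Rightarrow> bool" where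
  "doubly_subtended S S' \<longleftrightarrow> (\<forall>\<O>\<in>subtended_ovoids S S'. theta_subtended S S' 2 \<O>)"


section \<open>Quadrics and the Kantor-Knuth ovoids\<close>

text \<open>Points and lines of a projective space are subspaces of vector space dimension one and two.\<close>

definition quadric_geometry ::
  "(('a::field)^'n \<Rightarrow> 'a) \<Rightarrow> (('a^'n) set, ('a^'n) set) geometry" where
  "quadric_geometry Q =
     (let sing = (\<lambda>d. {U. vec.subspace U \<and> vec.dim U = d \<and> (\<forall>v\<in>U. Q v = 0)})
      in \<lparr>Points = sing 1, Lines = sing 2, Inc = {(x, L) \<in> sing 1 \<times> sing 2. x \<subseteq> L}\<rparr>)"

text \<open>The elements of the index type \<open>5\<close> are \<open>0, 1, 2, 3, 4\<close>, and similarly for \<open>6\<close>.\<close>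

definition Q4 :: "((('a::field)^5) set, ('a^5) set) geometry" where
  "Q4 = quadric_geometry (\<lambda>v. v$0 * v$4 + v$1 * v$3 + (v$2)^2)"

text \<open>
  In odd characteristic, for a nonsquare \<open>n\<close> the binary form \<open>X\<^sub>0\<^sup>2 - n X\<^sub>1\<^sup>2\<close> is irreducible, so that
  this is the canonical equation of an elliptic quadric; over a finite field different choices of
  \<open>n\<close> give projectively equivalent quadrics.
\<close>

definition Q5_elliptic :: "'a::field \<Rightarrow> (('a^6) set, ('a^6) set) geometry" where
  "Q5_elliptic n = quadric_geometry (\<lambda>v. (v$0)^2 - n * (v$1)^2 + v$2 * v$3 + v$4 * v$5)"

definition classical :: "'a::field itself \<Rightarrow> ('p, 'l) geometry \<Rightarrow> bool" where
  "classical _ S \<longleftrightarrow> (\<exists>n::'a. \<not> is_square n \<and> isomorphic S (Q5_elliptic n))"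

definition field_automorphism :: "('a::field \<Rightarrow> 'a) \<Rightarrow> bool" where
  "field_automorphism \<sigma> \<longleftrightarrow> bij \<sigma> \<and> \<sigma> 1 = 1 \<and>
     (\<forall>x y. \<sigma> (x + y) = \<sigma> x + \<sigma> y) \<and> (\<forall>x y. \<sigma> (x * y) = \<sigma> x * \<sigma> y)"

definition homogeneous :: "'a::field \<Rightarrow> 'a \<Rightarrow> 'a \<Rightarrow> 'a \<Rightarrow> 'a \<Rightarrow> ('a^5) set" where
  "homogeneous x0 x1 x2 x3 x4 =
     vec.span {\<chi> i. if i = 0 then x0 else if i = 1 then x1 else if i = 2 then x2
                    else if i = 3 then x3 else x4}"

definition standard_KK_ovoid :: "'a::field \<Rightarrow> ('a \<Rightarrow> 'a) \<Rightarrow> ('a^5) set set" where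
  "standard_KK_ovoid n \<tau> =
     insert (homogeneous 0 0 0 0 1)
       {homogeneous 1 x y (- n * \<tau> x) (n * (\<tau> x * x) - y^2) | x y. True}"

definition KK_ovoid_Q4 :: "('a::field^5) set set \<Rightarrow> bool" where
  "KK_ovoid_Q4 \<O> \<longleftrightarrow> ovoid Q4 \<O> \<and>
     (\<exists>n \<tau> f g. \<not> is_square n \<and> field_automorphism \<tau> \<and> automorphism Q4 f g \<and>
        f ` \<O> = standard_KK_ovoid n \<tau>)"

text \<open>
  Kantor-Knuth ovoids of an abstract quadrangle isomorphic to \<open>Q(4,q)\<close>. As the notion is invariant
  under \<open>Aut(Q(4,q))\<close>, the choice of the isomorphism is irrelevant.
\<close>

definition KK_ovoid :: "'a::field itself \<Rightarrow> ('p, 'l) geometry \<Rightarrow> 'p set \<Rightarrow> bool" where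
  "KK_ovoid _ S \<O> \<longleftrightarrow> \<O> \<subseteq> Points S \<and>
     (\<exists>f g. isomorphism S (Q4 :: (('a^5) set, ('a^5) set) geometry) f g \<and> KK_ovoid_Q4 (f ` \<O>))"


section \<open>The Kantor-Knuth quadrangle\<close>

text \<open>Elements \<open>(\<alpha>, c, \<beta>)\<close> of the group \<open>G\<close>; vectors are row vectors.\<close>

type_synonym 'a kk_elem = "('a^2) \<times> 'a \<times> ('a^2)"

definition dotp :: "('a::field)^2 \<Rightarrow> 'a^2 \<Rightarrow> 'a" where
  "dotp u v = (\<Sum>i\<in>UNIV. u$i * v$i)"

definition kk_group :: "('a::field) kk_elem monoid" where
  "kk_group =
     \<lparr>carrier = UNIV,
      monoid.mult = (\<lambda>(\<alpha>, c, \<beta>) (\<alpha>', c', \<beta>'). (\<alpha> + \<alpha>', c + c' + dotp \<beta> \<alpha>', \<beta> + \<beta>')),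
      monoid.one = (0, 0, 0)\<rparr>"

definition A_mat :: "'a::field \<Rightarrow> ('a \<Rightarrow> 'a) \<Rightarrow> 'a \<Rightarrow> 'a^2^2" where
  "A_mat m \<sigma> t = vector [vector [t, 0], vector [0, - m * \<sigma> t]]"

definition K_mat :: "'a::field \<Rightarrow> ('a \<Rightarrow> 'a) \<Rightarrow> 'a \<Rightarrow> 'a^2^2" where
  "K_mat m \<sigma> t = A_mat m \<sigma> t + transpose (A_mat m \<sigma> t)"

text \<open>The parameter \<open>t\<close> ranges over the field extended by \<open>\<infinity>\<close>, which is rendered as \<^term>\<open>None\<close>.\<close>

definition A_sub :: "'a::field \<Rightarrow> ('a \<Rightarrow> 'a) \<Rightarrow> 'a option \<Rightarrow> 'a kk_elem set" where
  "A_sub m \<sigma> t = (case t of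
       None \<Rightarrow> {(0, 0, \<beta>) | \<beta>. True}
     | Some t \<Rightarrow> {(\<alpha>, dotp (\<alpha> v* A_mat m \<sigma> t) \<alpha>, \<alpha> v* K_mat m \<sigma> t) | \<alpha>. True})"

definition A_star :: "'a::field \<Rightarrow> ('a \<Rightarrow> 'a) \<Rightarrow> 'a option \<Rightarrow> 'a kk_elem set" where
  "A_star m \<sigma> t = A_sub m \<sigma> t <#>\<^bsub>kk_group\<^esub> {(0, c, 0) | c. True}"

datatype 'a egq_point = Elem "'a kk_elem" | Star_Coset "'a kk_elem set" | Infinity
datatype 'a egq_line = Coset "'a kk_elem set" | Symb "'a option"

definition flock_quadrangle ::
  "'a::field \<Rightarrow> ('a \<Rightarrow> 'a) \<Rightarrow> ('a egq_point, 'a egq_line) geometry" where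
  "flock_quadrangle m \<sigma> =
     \<lparr>Points = range Elem \<union>
        {Star_Coset (A_star m \<sigma> t #>\<^bsub>kk_group\<^esub> g) | t g. True} \<union> {Infinity},
      Lines = {Coset (A_sub m \<sigma> t #>\<^bsub>kk_group\<^esub> g) | t g. True} \<union> range Symb,
      Inc =
        {(Infinity, Symb t) | t. True} \<union>
        {(Star_Coset (A_star m \<sigma> t #>\<^bsub>kk_group\<^esub> g), Symb t) | t g. True} \<union>
        {(Star_Coset (A_star m \<sigma> t #>\<^bsub>kk_group\<^esub> g), Coset (A_sub m \<sigma> t #>\<^bsub>kk_group\<^esub> h)) | t g h.
           A_sub m \<sigma> t #>\<^bsub>kk_group\<^esub> h \<subseteq> A_star m \<sigma> t #>\<^bsub>kk_group\<^esub> g} \<union>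
        {(Elem g, Coset (A_sub m \<sigma> t #>\<^bsub>kk_group\<^esub> g)) | t g. True}\<rparr>"

definition kantor_knuth ::
  "'a::field \<Rightarrow> ('a \<Rightarrow> 'a) \<Rightarrow> ('a egq_line, 'a egq_point) geometry" where
  "kantor_knuth m \<sigma> = dual (flock_quadrangle m \<sigma>)"

end

theory Submission
  imports Defs
begin

text \<open>
  Work in the flock quadrangle, where \<open>\<S>\<close> is the dual. A subquadrangle \<open>\<S>'\<close> of order \<open>q\<close> with an orbit of
  size \<open>(q - 1) q\<^sup>2\<close> contains \<open>[\<infinity>]\<close>: otherwise its stabilizer in \<open>G\<close> acts semiregularly on its elements of
  \<open>G\<close>, which makes the orbit too large. If it contains \<open>[\<infinity>]\<close>, counting shows that its elements of \<open>G\<close> form a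
  product \<open>W \<times> F \<times> U\<close>, and the interaction with all \<open>K\<^sub>t\<close> forces this to be a translate of
  \<open>H\<^sub>k = {(\<alpha>, c, \<beta>). \<alpha>\<^sub>2 = k \<sigma>(\<alpha>\<^sub>1), \<beta>\<^sub>2 = - m k \<sigma>(\<beta>\<^sub>1)}\<close>, where \<open>k\<close> is a field element or \<open>\<infinity>\<close>. If \<open>\<sigma> = 1\<close>, all
  values of \<open>k\<close> are fused by the multiplication of \<open>GF(q\<^sup>2)\<close>, so the orbit is again too large. The quadrangles
  with \<open>k = 0, \<infinity>\<close> have subtended ovoids which are not 1-subtended, and there are only \<open>2 q\<^sup>2\<close> of them.

  For the remaining \<open>k\<close>, the line \<open>A(t)h\<close> with \<open>h = (0, c, u)\<close> meets \<open>A(\<infinity>)(\<alpha>, d, 0)\<close> iff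
  \<open>c = d + u \<alpha>\<^sup>T + \<alpha> A\<^sub>t \<alpha>\<^sup>T\<close>. As \<open>\<sigma> \<noteq> 1\<close>, the functions \<open>b\<close> and \<open>\<sigma>(b)\<close> are linearly independent, so
  \<open>(\<alpha>, d)\<close> is determined by the subtended ovoid. In coordinates of \<open>Q(4,q)\<close> the ovoid is the graph \<open>X = m \<phi>(T, B, X)\<^sup>\<sigma>\<close>,
  where \<open>\<phi>\<close> is a linear form which is isotropic for the dual quadratic form; a unipotent isometry
  turns \<open>\<phi>\<close> into a multiple of \<open>T\<close> and the ovoid into a standard Kantor-Knuth ovoid.
\<close>

section \<open>Isomorphisms of geometries\<close>

text \<open>Both claims reduce to one statement: a point outside is determined by the ovoid it
  subtends (\<open>singly_subtended\<close>). The subtended ovoids are then in bijection with the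
  outside points, of which there are (q+1)(q^3+1) - (q+1)(q^2+1) = (q+1)q^2(q-1). The twisted graphs
  come from K_t = diag(2t, -2m \<sigma>(t)): for one vector w with w_1 nonzero, the vectors w K_t
  trace the set u_2 = -m k \<sigma>(u_1) with k = w_2 / \<sigma>(w_1). Injectivity is also the
  invariant which separates the orbits, since automorphisms preserve it while they may change k. The
  delicate case is q = 3, where (q-1)q^2 = 2q^2 and sizes cannot tell the orbits apart; but a field
  with three elements has only the trivial automorphism. Because of the duality, the points of
  \<open>S\<close> have type \<open>egq_line\<close> (symbols and cosets of A(t)) and its lines have
  type \<open>egq_point\<close>. Lines carry q+1 points both in \<open>S\<close> and in a
  subquadrangle of order q, which makes the counting arguments rigid.\<close>

lemma isomorphism_id: "isomorphism S S id id"
  by (simp add: isomorphism_def)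

lemma isomorphism_comp:
  assumes "isomorphism S T f g" "isomorphism T U f' g'"
  shows "isomorphism S U (f' \<circ> f) (g' \<circ> g)"
proof -
  have "f x \<in> Points T" if "x \<in> Points S" for x
    using assms(1) that by (auto simp: isomorphism_def bij_betw_def)
  moreover have "g L \<in> Lines T" if "L \<in> Lines S" for L
    using assms(1) that by (auto simp: isomorphism_def bij_betw_def)
  ultimately show ?thesis
    using assms by (auto simp: isomorphism_def intro: bij_betw_trans)
qed

lemma isomorphism_inv:
  assumes "isomorphism S T f g"
  shows "isomorphism T S (inv_into (Points S) f) (inv_into (Lines S) g)"
proof -
  have b: "bij_betw f (Points S) (Points T)" "bij_betw g (Lines S) (Lines T)"
    using assms by (auto simp: isomorphism_def)
  have "(inv_into (Points S) f x, inv_into (Lines S) g L) \<in> Inc S \<longleftrightarrow> (x, L) \<in> Inc T"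
    if "x \<in> Points T" "L \<in> Lines T" for x L
  proof -
    have "inv_into (Points S) f x \<in> Points S" "inv_into (Lines S) g L \<in> Lines S"
      using that b by (metis bij_betw_imp_surj_on inv_into_into)+
    then show ?thesis
      using assms bij_betw_inv_into_right[OF b(1) that(1)] bij_betw_inv_into_right[OF b(2) that(2)]
      unfolding isomorphism_def by metis
  qed
  then show ?thesis
    using b by (auto simp: isomorphism_def bij_betw_inv_into)
qed

text \<open>The part of \<open>subquadrangles\<close> without the quadrangle axioms. Incidence is
  induced, so such a geometry is determined by its points and lines; most transport arguments need
  only this.\<close>

definition subgeometry :: "('p, 'l) geometry \<Rightarrow> ('p, 'l) geometry \<Rightarrow> bool" where
  "subgeometry S' S \<longleftrightarrow> Points S' \<subseteq> Points S \<and> Lines S' \<subseteq> Lines S \<and>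
     Inc S' = Inc S \<inter> (Points S' \<times> Lines S')"

lemma subquadrangles_iff:
  "S' \<in> subquadrangles s t S \<longleftrightarrow> subgeometry S' S \<and> generalized_quadrangle s t S'"
  by (auto simp: subquadrangles_def subgeometry_def)

lemma subgeometry_eqI:
  assumes "subgeometry S' S" "subgeometry S'' S" "Points S' = Points S''" "Lines S' = Lines S''"
  shows "S' = S''"
  using assms by (auto simp: subgeometry_def intro!: geometry.equality)

lemma subgeometry_image:
  assumes f: "automorphism S f g" and S': "subgeometry S' S"
  shows "subgeometry (image_geometry f g S') S"
    and "isomorphism S' (image_geometry f g S') f g"
proof -
  have b: "bij_betw f (Points S) (Points S)" "bij_betw g (Lines S) (Lines S)"
    and I: "\<And>x L. x \<in> Points S \<Longrightarrow> L \<in> Lines S \<Longrightarrow> (f x, g L) \<in> Inc S \<longleftrightarrow> (x, L) \<in> Inc S"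
    using f by (auto simp: isomorphism_def)
  have sub: "Points S' \<subseteq> Points S" "Lines S' \<subseteq> Lines S" "Inc S' = Inc S \<inter> (Points S' \<times> Lines S')"
    using S' by (auto simp: subgeometry_def)
  have inj: "inj_on f (Points S)" "inj_on g (Lines S)"
    using b by (auto simp: bij_betw_def)
  have fs: "f ` Points S' \<subseteq> Points S" "g ` Lines S' \<subseteq> Lines S"
    using b sub(1,2) unfolding bij_betw_def by blast+
  have inc: "(f x, g L) \<in> Inc (image_geometry f g S') \<longleftrightarrow> (x, L) \<in> Inc S'"
    if "x \<in> Points S'" "L \<in> Lines S'" for x L
  proof
    assume "(f x, g L) \<in> Inc (image_geometry f g S')"
    then obtain y M where y: "(y, M) \<in> Inc S'" "f x = f y" "g L = g M"
      by (auto simp: image_geometry_def)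
    then have "y \<in> Points S" "M \<in> Lines S" using sub by auto
    then have "x = y" "L = M"
      using that sub(1,2) inj y(2,3) by (auto dest: inj_onD)
    with y show "(x, L) \<in> Inc S'" by simp
  qed (auto simp: image_geometry_def)
  show "subgeometry (image_geometry f g S') S"
    unfolding subgeometry_def
  proof (intro conjI)
    show "Inc (image_geometry f g S') =
      Inc S \<inter> (Points (image_geometry f g S') \<times> Lines (image_geometry f g S'))"
    proof safe
      fix x L assume "(x, L) \<in> Inc S" "x \<in> Points (image_geometry f g S')"
        "L \<in> Lines (image_geometry f g S')"
      moreover from this obtain y M where y: "x = f y" "L = g M" "y \<in> Points S'" "M \<in> Lines S'"
        by (auto simp: image_geometry_def)
      ultimately have "(y, M) \<in> Inc S'"
        using I sub by auto
      then show "(x, L) \<in> Inc (image_geometry f g S')"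
        using inc y by auto
    next
      fix x L assume "(x, L) \<in> Inc (image_geometry f g S')"
      then obtain y M where y: "x = f y" "L = g M" "(y, M) \<in> Inc S'"
        by (auto simp: image_geometry_def)
      then show "(x, L) \<in> Inc S"
        using I sub by auto
      show "x \<in> Points (image_geometry f g S')" "L \<in> Lines (image_geometry f g S')"
        using y sub by (auto simp: image_geometry_def)
    qed
  qed (use fs in \<open>auto simp: image_geometry_def\<close>)
  show "isomorphism S' (image_geometry f g S') f g"
    unfolding isomorphism_def
    using inc inj sub
    by (auto simp: image_geometry_def bij_betw_def intro: inj_on_subset)
qed

lemma image_geometry_comp:
  "image_geometry f' g' (image_geometry f g S) = image_geometry (f' \<circ> f) (g' \<circ> g) S"
  by (simp add: image_geometry_def image_comp map_prod.comp)

text \<open>Automorphisms are constrained only on points and lines: an inverse composed with the map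
  is the identity there and arbitrary elsewhere. Image geometries must not see the
  difference.\<close>

lemma image_geometry_cong:
  assumes "subgeometry S' S" "\<And>x. x \<in> Points S' \<Longrightarrow> f x = f' x" "\<And>L. L \<in> Lines S' \<Longrightarrow> g L = g' L"
  shows "image_geometry f g S' = image_geometry f' g' S'"
proof -
  have "map_prod f g ` Inc S' = map_prod f' g' ` Inc S'"
  proof (rule image_cong[OF refl])
    fix p assume "p \<in> Inc S'"
    then show "map_prod f g p = map_prod f' g' p"
      using assms by (cases p) (auto simp: subgeometry_def)
  qed
  moreover have "f ` Points S' = f' ` Points S'" "g ` Lines S' = g' ` Lines S'"
    using assms by (auto intro!: image_cong)
  ultimately show ?thesis
    by (simp add: image_geometry_def)
qed

lemma image_geometry_id: "image_geometry id id S = S"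
  by (simp add: image_geometry_def map_prod.id)

text \<open>Inverting the automorphism carries \<open>S''\<close> back to \<open>S'\<close>. Hence
  every member of an orbit can serve as its representative, and the orbit size becomes a property of
  each member.\<close>

lemma aut_orbit_eq:
  assumes S': "subgeometry S' S" and S'': "S'' \<in> aut_orbit S S'"
  shows "aut_orbit S S'' = aut_orbit S S'"
proof -
  obtain f g where fg: "automorphism S f g" "S'' = image_geometry f g S'"
    using S'' by (auto simp: aut_orbit_def)
  define f' where "f' = inv_into (Points S) f"
  define g' where "g' = inv_into (Lines S) g"
  have fg': "automorphism S f' g'"
    unfolding f'_def g'_def by (rule isomorphism_inv[OF fg(1)])
  have inj: "inj_on f (Points S)" "inj_on g (Lines S)"
    using fg by (auto simp: isomorphism_def bij_betw_def)
  have "image_geometry f' g' S'' = image_geometry id id S'"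
    unfolding fg(2) image_geometry_comp
    by (rule image_geometry_cong[OF S'])
      (use S' inj in \<open>auto simp: f'_def g'_def subgeometry_def inv_into_f_f subset_iff\<close>)
  then have ret: "image_geometry f' g' S'' = S'"
    by (simp add: image_geometry_id)
  show ?thesis
  proof (intro equalityI subsetI)
    fix T assume "T \<in> aut_orbit S S''"
    then obtain a b where ab: "automorphism S a b" "T = image_geometry a b S''"
      by (auto simp: aut_orbit_def)
    then have "T = image_geometry (a \<circ> f) (b \<circ> g) S'"
      by (simp add: fg(2) image_geometry_comp)
    then show "T \<in> aut_orbit S S'"
      using isomorphism_comp[OF fg(1) ab(1)] unfolding aut_orbit_def by blast
  next
    fix T assume "T \<in> aut_orbit S S'"
    then obtain a b where ab: "automorphism S a b" "T = image_geometry a b S'"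
      by (auto simp: aut_orbit_def)
    then have "T = image_geometry (a \<circ> f') (b \<circ> g') S''"
      by (simp add: ret image_geometry_comp[symmetric])
    then show "T \<in> aut_orbit S S''"
      using isomorphism_comp[OF fg' ab(1)] unfolding aut_orbit_def by blast
  qed
qed

section \<open>Generalized quadrangles\<close>

text \<open>Splits the unique existence of a pair into existence and uniqueness, without the pair
  pattern under the quantifier; the projection axiom is used later in this form.\<close>

lemma generalized_quadrangle_iff:
  "generalized_quadrangle s t S \<longleftrightarrow>
     s \<ge> 1 \<and> t \<ge> 1 \<and> Points S \<noteq> {} \<and> Lines S \<noteq> {} \<and> Inc S \<subseteq> Points S \<times> Lines S \<and>
     (\<forall>x\<in>Points S. card {L \<in> Lines S. (x, L) \<in> Inc S} = t + 1) \<and>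
     (\<forall>L\<in>Lines S. card {x \<in> Points S. (x, L) \<in> Inc S} = s + 1) \<and>
     (\<forall>x\<in>Points S. \<forall>y\<in>Points S. \<forall>L\<in>Lines S. \<forall>M\<in>Lines S.
        x \<noteq> y \<and> (x, L) \<in> Inc S \<and> (y, L) \<in> Inc S \<and> (x, M) \<in> Inc S \<and> (y, M) \<in> Inc S \<longrightarrow> L = M) \<and>
     (\<forall>x\<in>Points S. \<forall>L\<in>Lines S. (x, L) \<notin> Inc S \<longrightarrow>
        (\<exists>y\<in>Points S. \<exists>M\<in>Lines S. (x, M) \<in> Inc S \<and> (y, M) \<in> Inc S \<and> (y, L) \<in> Inc S)) \<and>
     (\<forall>x\<in>Points S. \<forall>L\<in>Lines S. (x, L) \<notin> Inc S \<longrightarrow>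
        (\<forall>y\<in>Points S. \<forall>M\<in>Lines S. \<forall>y'\<in>Points S. \<forall>M'\<in>Lines S.
          (x, M) \<in> Inc S \<and> (y, M) \<in> Inc S \<and> (y, L) \<in> Inc S \<and>
          (x, M') \<in> Inc S \<and> (y', M') \<in> Inc S \<and> (y', L) \<in> Inc S \<longrightarrow> y = y' \<and> M = M'))"
proof -
  have *: "(\<exists>!(y, M). P y M) \<longleftrightarrow> (\<exists>y M. P y M) \<and> (\<forall>y M y' M'. P y M \<and> P y' M' \<longrightarrow> y = y' \<and> M = M')"
    for P :: "'p \<Rightarrow> 'l \<Rightarrow> bool"
    unfolding Ex1_def by (auto simp: split_paired_all) metis+
  show ?thesis
    unfolding generalized_quadrangle_def * by (rule iffI) (elim conjE, intro conjI; blast)+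
qed

lemma gq_line_unique:
  assumes "generalized_quadrangle s t S" "x \<in> Points S" "y \<in> Points S" "L \<in> Lines S" "M \<in> Lines S"
    "x \<noteq> y" "(x, L) \<in> Inc S" "(y, L) \<in> Inc S" "(x, M) \<in> Inc S" "(y, M) \<in> Inc S"
  shows "L = M"
proof -
  have "\<forall>x\<in>Points S. \<forall>y\<in>Points S. \<forall>L\<in>Lines S. \<forall>M\<in>Lines S.
        x \<noteq> y \<and> (x, L) \<in> Inc S \<and> (y, L) \<in> Inc S \<and> (x, M) \<in> Inc S \<and> (y, M) \<in> Inc S \<longrightarrow> L = M"
    using assms(1) unfolding generalized_quadrangle_iff by (elim conjE)
  then show ?thesis using assms by blast
qed

lemma gq_projection:
  assumes "generalized_quadrangle s t S" "x \<in> Points S" "L \<in> Lines S" "(x, L) \<notin> Inc S"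
  obtains y M where "y \<in> Points S" "M \<in> Lines S" "(x, M) \<in> Inc S" "(y, M) \<in> Inc S" "(y, L) \<in> Inc S"
proof -
  have "\<forall>x\<in>Points S. \<forall>L\<in>Lines S. (x, L) \<notin> Inc S \<longrightarrow>
        (\<exists>y\<in>Points S. \<exists>M\<in>Lines S. (x, M) \<in> Inc S \<and> (y, M) \<in> Inc S \<and> (y, L) \<in> Inc S)"
    using assms(1) unfolding generalized_quadrangle_iff by (elim conjE)
  then show ?thesis using assms that by meson
qed

lemma gq_projection_unique:
  assumes "generalized_quadrangle s t S" "x \<in> Points S" "L \<in> Lines S" "(x, L) \<notin> Inc S"
    "y \<in> Points S" "M \<in> Lines S" "(x, M) \<in> Inc S" "(y, M) \<in> Inc S" "(y, L) \<in> Inc S"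
    "y' \<in> Points S" "M' \<in> Lines S" "(x, M') \<in> Inc S" "(y', M') \<in> Inc S" "(y', L) \<in> Inc S"
  shows "y = y'" "M = M'"
proof -
  have "\<forall>x\<in>Points S. \<forall>L\<in>Lines S. (x, L) \<notin> Inc S \<longrightarrow>
        (\<forall>y\<in>Points S. \<forall>M\<in>Lines S. \<forall>y'\<in>Points S. \<forall>M'\<in>Lines S.
          (x, M) \<in> Inc S \<and> (y, M) \<in> Inc S \<and> (y, L) \<in> Inc S \<and>
          (x, M') \<in> Inc S \<and> (y', M') \<in> Inc S \<and> (y', L) \<in> Inc S \<longrightarrow> y = y' \<and> M = M')"
    using assms(1) unfolding generalized_quadrangle_iff by (elim conjE)
  then have "y = y' \<and> M = M'" using assms(2-) by blast
  then show "y = y'" "M = M'" by auto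
qed

lemma gq_card:
  assumes "generalized_quadrangle s t S"
  shows "x \<in> Points S \<Longrightarrow> card {L \<in> Lines S. (x, L) \<in> Inc S} = t + 1"
    and "L \<in> Lines S \<Longrightarrow> card {x \<in> Points S. (x, L) \<in> Inc S} = s + 1"
    and "Points S \<noteq> {}" "Lines S \<noteq> {}" "s \<ge> 1" "t \<ge> 1" "Inc S \<subseteq> Points S \<times> Lines S"
  using assms by (auto simp: generalized_quadrangle_iff)

lemma generalized_quadrangle_iso:
  assumes S: "generalized_quadrangle s t S" and f: "isomorphism S T f g"
    and T: "Inc T \<subseteq> Points T \<times> Lines T"
  shows "generalized_quadrangle s t T"
proof -
  have pt: "Points T = f ` Points S" "Lines T = g ` Lines S"
    and inj: "inj_on f (Points S)" "inj_on g (Lines S)"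
    and I: "\<And>x L. x \<in> Points S \<Longrightarrow> L \<in> Lines S \<Longrightarrow> (f x, g L) \<in> Inc T \<longleftrightarrow> (x, L) \<in> Inc S"
    using f by (auto simp: isomorphism_def bij_betw_def)
  note gq = gq_card[OF S]
  have 1: "card {L \<in> Lines T. (f x, L) \<in> Inc T} = t + 1" if "x \<in> Points S" for x
  proof -
    have "{L \<in> Lines T. (f x, L) \<in> Inc T} = g ` {L \<in> Lines S. (x, L) \<in> Inc S}"
      using I that by (auto simp: pt)
    moreover have "inj_on g {L \<in> Lines S. (x, L) \<in> Inc S}"
      using inj by (auto intro: inj_on_subset)
    ultimately show ?thesis
      using gq that by (simp add: card_image)
  qed
  have 2: "card {x \<in> Points T. (x, g L) \<in> Inc T} = s + 1" if "L \<in> Lines S" for L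
  proof -
    have "{x \<in> Points T. (x, g L) \<in> Inc T} = f ` {x \<in> Points S. (x, L) \<in> Inc S}"
      using I that by (auto simp: pt)
    moreover have "inj_on f {x \<in> Points S. (x, L) \<in> Inc S}"
      using inj by (auto intro: inj_on_subset)
    ultimately show ?thesis
      using gq that by (simp add: card_image)
  qed
  show ?thesis
    unfolding generalized_quadrangle_iff pt ball_simps bex_simps
  proof (intro conjI ballI impI)
    fix x L y M y' M'
    assume *: "x \<in> Points S" "L \<in> Lines S" "(f x, g L) \<notin> Inc T" "y \<in> Points S" "M \<in> Lines S"
      "y' \<in> Points S" "M' \<in> Lines S" "(f x, g M) \<in> Inc T \<and> (f y, g M) \<in> Inc T \<and> (f y, g L) \<in> Inc T \<and>
          (f x, g M') \<in> Inc T \<and> (f y', g M') \<in> Inc T \<and> (f y', g L) \<in> Inc T"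
    then have "y = y'" "M = M'"
      using gq_projection_unique[OF S, of x L y M y' M'] I by auto
    then show "f y = f y'" "g M = g M'" by auto
  next
    fix x L assume *: "x \<in> Points S" "L \<in> Lines S" "(f x, g L) \<notin> Inc T"
    then obtain y M where "y \<in> Points S" "M \<in> Lines S" "(x, M) \<in> Inc S" "(y, M) \<in> Inc S" "(y, L) \<in> Inc S"
      using gq_projection[OF S, of x L] I by metis
    then show "\<exists>y\<in>Points S. \<exists>M\<in>Lines S. (f x, g M) \<in> Inc T \<and> (f y, g M) \<in> Inc T \<and> (f y, g L) \<in> Inc T"
      using * I by blast
  next
    fix x y L M
    assume *: "x \<in> Points S" "y \<in> Points S" "L \<in> Lines S" "M \<in> Lines S"
      "f x \<noteq> f y \<and> (f x, g L) \<in> Inc T \<and> (f y, g L) \<in> Inc T \<and> (f x, g M) \<in> Inc T \<and> (f y, g M) \<in> Inc T"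
    then have "L = M"
      using gq_line_unique[OF S, of x y L M] I by auto
    then show "g L = g M" by simp
  qed (use gq T 1 2 pt in auto)
qed

lemma generalized_quadrangle_dual:
  assumes S: "generalized_quadrangle s t S"
  shows "generalized_quadrangle t s (dual S)"
proof -
  note gq = gq_card[OF S]
  have sel: "Points (dual S) = Lines S" "Lines (dual S) = Points S" "\<And>x L. (L, x) \<in> Inc (dual S) \<longleftrightarrow> (x, L) \<in> Inc S"
    by (auto simp: dual_def)
  show ?thesis
    unfolding generalized_quadrangle_iff sel
  proof (intro conjI ballI impI)
    fix L x M y M' y'
    assume "L \<in> Lines S" "x \<in> Points S" "(x, L) \<notin> Inc S" "M \<in> Lines S" "y \<in> Points S"
      "M' \<in> Lines S" "y' \<in> Points S" "(y, L) \<in> Inc S \<and> (y, M) \<in> Inc S \<and> (x, M) \<in> Inc S \<and>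
          (y', L) \<in> Inc S \<and> (y', M') \<in> Inc S \<and> (x, M') \<in> Inc S"
    then show "M = M'" "y = y'"
      using gq_projection_unique[OF S, of x L y M y' M'] gq_projection_unique[OF S, of x L y' M' y M] 
      by metis+
  next
    fix L x assume "L \<in> Lines S" "x \<in> Points S" "(x, L) \<notin> Inc S"
    then show "\<exists>y\<in>Lines S. \<exists>M\<in>Points S. (M, L) \<in> Inc S \<and> (M, y) \<in> Inc S \<and> (x, y) \<in> Inc S"
      using gq_projection[OF S, of x L] by metis
  next
    fix L M x y assume "L \<in> Lines S" "M \<in> Lines S" "x \<in> Points S" "y \<in> Points S"
      "L \<noteq> M \<and> (x, L) \<in> Inc S \<and> (x, M) \<in> Inc S \<and> (y, L) \<in> Inc S \<and> (y, M) \<in> Inc S"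
    then show "x = y"
      using gq_line_unique[OF S, of x y L M] by metis
  next
    show "Inc (dual S) \<subseteq> Lines S \<times> Points S"
      using gq by (auto simp: dual_def)
  qed (use gq in auto)
qed

text \<open>Fix a point x. It lies on t+1 lines, and any other line L is reached by exactly one
  chain x, M, y, L, with s(t+1) choices of (M, y) and then t of L. The set \<open>D\<close> consists
  of these chains.\<close>

lemma card_Lines_generalized_quadrangle:
  assumes S: "generalized_quadrangle s t S"
  shows "card (Lines S) = (t + 1) * (s * t + 1)"
proof -
  note gq = gq_card[OF S]
  obtain x where x: "x \<in> Points S" using gq by auto
  define A where "A = {L \<in> Lines S. (x, L) \<in> Inc S}"
  define B where "B M = {y \<in> Points S. (y, M) \<in> Inc S} - {x}" for M
  define C where "C y M = {L \<in> Lines S. (y, L) \<in> Inc S} - {M}" for y M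
  have fin: "finite A" "card A = t + 1"
    using gq x by (auto simp: A_def intro!: card_ge_0_finite)
  have B: "finite (B M)" "card (B M) = s" if "M \<in> A" for M
  proof -
    have c: "card {y \<in> Points S. (y, M) \<in> Inc S} = s + 1" using gq that by (auto simp: A_def)
    then have f: "finite {y \<in> Points S. (y, M) \<in> Inc S}" by (intro card_ge_0_finite) simp
    then show "finite (B M)" by (simp add: B_def)
    show "card (B M) = s"
      unfolding B_def using that x c f by (subst card_Diff_singleton) (auto simp: A_def)
  qed
  have C: "finite (C y M)" "card (C y M) = t" if "M \<in> A" "y \<in> B M" for M y
  proof -
    have c: "card {L \<in> Lines S. (y, L) \<in> Inc S} = t + 1" using gq that by (auto simp: B_def)
    then have f: "finite {L \<in> Lines S. (y, L) \<in> Inc S}" by (intro card_ge_0_finite) simp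
    then show "finite (C y M)" by (simp add: C_def)
    show "card (C y M) = t"
      unfolding C_def using that x c f by (subst card_Diff_singleton) (auto simp: A_def B_def)
  qed
  define D where "D = (SIGMA M:A. SIGMA y:B M. C y M)"
  have BC: "finite (SIGMA y:B M. C y M)" "card (SIGMA y:B M. C y M) = s * t" if "M \<in> A" for M
    using that B C by (auto simp: card_SigmaI)
  have D: "finite D" "card D = (t + 1) * (s * t)"
    unfolding D_def using BC fin by (auto simp: card_SigmaI)
  \<comment> \<open>The last line of a chain cannot return to x, as x and y already lie on
    M.\<close>
  have nx: "(x, L) \<notin> Inc S" if "M \<in> A" "y \<in> B M" "L \<in> C y M" for M y L
    using gq_line_unique[OF S, of x y L M] that x by (auto simp: A_def B_def C_def)
  have "inj_on (\<lambda>(M, y, L). L) D"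
  proof (rule inj_onI, clarsimp)
    fix M y L M' y' assume *: "(M, y, L) \<in> D" "(M', y', L) \<in> D"
    then have "M \<in> A" "y \<in> B M" "L \<in> C y M" "M' \<in> A" "y' \<in> B M'" "L \<in> C y' M'"
      by (auto simp: D_def)
    moreover from this have "(x, L) \<notin> Inc S" using nx by blast
    ultimately show "M = M' \<and> y = y'"
      using gq_projection_unique[OF S x, of L y M y' M'] unfolding A_def B_def C_def by blast
  qed
  moreover have "(\<lambda>(M, y, L). L) ` D = Lines S - A"
  proof safe
    fix M y L assume "(M, y, L) \<in> D"
    then have "M \<in> A" "y \<in> B M" "L \<in> C y M" by (auto simp: D_def)
    then have "(x, L) \<notin> Inc S" "L \<in> Lines S" using nx by (blast, simp add: C_def)
    then show "L \<in> Lines S" "L \<in> A \<Longrightarrow> False" by (simp_all add: A_def)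
  next
    fix L assume L: "L \<in> Lines S" "L \<notin> A"
    then have n: "(x, L) \<notin> Inc S" by (auto simp: A_def)
    then obtain y M where "y \<in> Points S" "M \<in> Lines S" "(x, M) \<in> Inc S" "(y, M) \<in> Inc S" "(y, L) \<in> Inc S"
      using gq_projection[OF S x, of L] L by metis
    moreover from this have "y \<noteq> x" "L \<noteq> M" using n by auto
    ultimately have "(M, y, L) \<in> D"
      using L by (auto simp: D_def A_def B_def C_def)
    then show "L \<in> (\<lambda>(M, y, L). L) ` D" by force
  qed
  ultimately have "card (Lines S - A) = (t + 1) * (s * t)" "finite (Lines S - A)"
    using D card_image finite_imageI by metis+
  moreover have "Lines S = A \<union> (Lines S - A)" by (auto simp: A_def)
  ultimately show ?thesis
    using fin by (metis Diff_disjoint add.commute card_Un_disjoint distrib_left mult.right_neutral)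
qed

lemma card_Points_generalized_quadrangle:
  assumes "generalized_quadrangle s t S"
  shows "card (Points S) = (s + 1) * (s * t + 1)"
  using card_Lines_generalized_quadrangle[OF generalized_quadrangle_dual[OF assms]]
  by (simp add: dual_def mult.commute)

lemma subquadrangle_image:
  assumes f: "automorphism S f g" and S': "S' \<in> subquadrangles s t S"
  shows "image_geometry f g S' \<in> subquadrangles s t S"
proof -
  have *: "subgeometry S' S" "generalized_quadrangle s t S'"
    using S' by (auto simp: subquadrangles_iff)
  have "Inc (image_geometry f g S') \<subseteq> Points (image_geometry f g S') \<times> Lines (image_geometry f g S')"
    using subgeometry_image(1)[OF f *(1)] by (auto simp: subgeometry_def)
  then show ?thesis
    using subgeometry_image[OF f *(1)] generalized_quadrangle_iso[OF *(2)]
    by (auto simp: subquadrangles_iff)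
qed

section \<open>Subtended ovoids\<close>

lemma collinear_in_automorphism:
  assumes f: "automorphism S f g" and "x \<in> Points S" "y \<in> Points S"
  shows "collinear_in S (f x) (f y) \<longleftrightarrow> collinear_in S x y"
proof -
  have "g ` Lines S = Lines S"
    using f by (auto simp: isomorphism_def bij_betw_def)
  then have "collinear_in S (f x) (f y) \<longleftrightarrow> (\<exists>L\<in>g ` Lines S. (f x, L) \<in> Inc S \<and> (f y, L) \<in> Inc S)"
    by (simp add: collinear_in_def)
  also have "\<dots> \<longleftrightarrow> collinear_in S x y"
    using f assms(2,3) by (auto simp: collinear_in_def isomorphism_def)
  finally show ?thesis .
qed

lemma subtended_by_image:
  assumes f: "automorphism S f g" and S': "subgeometry S' S" and x: "x \<in> Points S"
  shows "subtended_by S (image_geometry f g S') (f x) = f ` subtended_by S S' x"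
  using S' collinear_in_automorphism[OF f x]
  by (auto simp: subtended_by_def image_geometry_def subgeometry_def subset_iff)

lemma Points_diff_image:
  assumes f: "automorphism S f g" and S': "subgeometry S' S"
  shows "Points S - Points (image_geometry f g S') = f ` (Points S - Points S')"
proof -
  have "bij_betw f (Points S) (Points S)" "Points S' \<subseteq> Points S"
    using f S' by (auto simp: isomorphism_def subgeometry_def)
  then show ?thesis
    using inj_on_image_set_diff[of f "Points S" "Points S" "Points S'"]
    by (auto simp: image_geometry_def bij_betw_def)
qed

text \<open>Says that each subtended ovoid is 1-subtended. Phrased as injectivity it is easily moved
  by automorphisms and gives the number of subtended ovoids as the cardinality of an image.\<close>

definition singly_subtended :: "('p, 'l) geometry \<Rightarrow> ('p, 'l) geometry \<Rightarrow> bool" where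
  "singly_subtended S S' \<longleftrightarrow> inj_on (subtended_by S S') (Points S - Points S')"

lemma singly_subtended_image:
  assumes f: "automorphism S f g" and S': "subgeometry S' S"
  shows "singly_subtended S (image_geometry f g S') \<longleftrightarrow> singly_subtended S S'"
proof -
  have inj: "inj_on f (Points S)" using f by (auto simp: isomorphism_def bij_betw_def)
  have sub: "subtended_by S S' x \<subseteq> Points S" for x
    using S' by (auto simp: subtended_by_def subgeometry_def)
  have eq: "f ` subtended_by S S' x = f ` subtended_by S S' y \<longleftrightarrow>
      subtended_by S S' x = subtended_by S S' y" for x y
    using sub inj by (simp add: inj_on_image_eq_iff)
  show ?thesis
    unfolding singly_subtended_def Points_diff_image[OF f S'] inj_on_def
    using subtended_by_image[OF f S'] eq inj by (auto simp: inj_on_eq_iff)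
qed

lemma theta_subtended_1_iff:
  assumes "singly_subtended S S'"
  shows "theta_subtended S S' 1 \<O> \<longleftrightarrow> \<O> \<in> subtended_ovoids S S'"
proof -
  have "card {x \<in> Points S - Points S'. subtended_by S S' x = \<O>} = 1" if O: "\<O> \<in> subtended_ovoids S S'"
  proof -
    obtain x where x: "x \<in> Points S - Points S'" "\<O> = subtended_by S S' x"
      using O by (auto simp: subtended_ovoids_def)
    then have "{x \<in> Points S - Points S'. subtended_by S S' x = \<O>} = {x}"
      using assms by (auto simp: singly_subtended_def dest: inj_onD)
    then show ?thesis by simp
  qed
  then show ?thesis by (auto simp: theta_subtended_def)
qed

lemma KK_ovoid_iso:
  assumes "isomorphism S T f g" "\<O> \<subseteq> Points S" "KK_ovoid TYPE('a::field) T (f ` \<O>)"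
  shows "KK_ovoid TYPE('a) S \<O>"
proof -
  obtain f' g' where "isomorphism T (Q4 :: (('a^5) set, ('a^5) set) geometry) f' g'" "KK_ovoid_Q4 (f' ` f ` \<O>)"
    using assms(3) unfolding KK_ovoid_def by auto
  then show ?thesis
    using isomorphism_comp[OF assms(1)] assms(2) unfolding KK_ovoid_def by (metis image_comp)
qed

lemma ovoid_iso:
  assumes f: "isomorphism S T f g" and "ovoid S \<O>"
  shows "ovoid T (f ` \<O>)"
  unfolding ovoid_def
proof (intro conjI ballI)
  have pt: "Points T = f ` Points S" "Lines T = g ` Lines S"
    and inj: "inj_on f (Points S)"
    and I: "\<And>x L. x \<in> Points S \<Longrightarrow> L \<in> Lines S \<Longrightarrow> (f x, g L) \<in> Inc T \<longleftrightarrow> (x, L) \<in> Inc S"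
    using f by (auto simp: isomorphism_def bij_betw_def)
  have O: "\<O> \<subseteq> Points S" using assms by (auto simp: ovoid_def)
  then show "f ` \<O> \<subseteq> Points T" using pt by auto
  fix L assume "L \<in> Lines T"
  then obtain M where M: "M \<in> Lines S" "L = g M" using pt by auto
  then obtain x where x: "x \<in> \<O>" "(x, M) \<in> Inc S" "\<And>y. y \<in> \<O> \<Longrightarrow> (y, M) \<in> Inc S \<Longrightarrow> y = x"
    using assms unfolding ovoid_def by (metis (no_types, lifting))
  show "\<exists>!x. x \<in> f ` \<O> \<and> (x, L) \<in> Inc T"
  proof (rule ex1I[of _ "f x"])
    have "x \<in> Points S" using x(1) O by auto
    then show "f x \<in> f ` \<O> \<and> (f x, L) \<in> Inc T" using x(1,2) M I[of x M] by simp
    fix z assume z: "z \<in> f ` \<O> \<and> (z, L) \<in> Inc T"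
    then obtain y where y: "y \<in> \<O>" "z = f y" by auto
    then have "y \<in> Points S" using O by auto
    then have "(y, M) \<in> Inc S" using I[of y M] M y z by auto
    then show "z = f x" using x(3)[OF y(1)] y by simp
  qed
qed

section \<open>The quadric \<open>Q(4,q)\<close> in coordinates\<close>

lemma exhaust_5:
  fixes x :: 5
  shows "x = 0 \<or> x = 1 \<or> x = 2 \<or> x = 3 \<or> x = 4"
proof (induct x)
  case (of_int z)
  then have "z = 0 \<or> z = 1 \<or> z = 2 \<or> z = 3 \<or> z = 4" by fastforce
  then show ?case by auto
qed

lemma forall_5: "(\<forall>i::5. P i) \<longleftrightarrow> P 0 \<and> P 1 \<and> P 2 \<and> P 3 \<and> P 4"
  by (metis exhaust_5)

definition vec5 :: "'a::field \<Rightarrow> 'a \<Rightarrow> 'a \<Rightarrow> 'a \<Rightarrow> 'a \<Rightarrow> 'a^5" where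
  "vec5 x0 x1 x2 x3 x4 = (\<chi> i. if i = 0 then x0 else if i = 1 then x1 else if i = 2 then x2
                    else if i = 3 then x3 else x4)"

lemma vec5_nth [simp]:
  "vec5 x0 x1 x2 x3 x4 $ 0 = x0" "vec5 x0 x1 x2 x3 x4 $ 1 = x1" "vec5 x0 x1 x2 x3 x4 $ 2 = x2"
  "vec5 x0 x1 x2 x3 x4 $ 3 = x3" "vec5 x0 x1 x2 x3 x4 $ 4 = x4"
  by (simp_all add: vec5_def)

lemma homogeneous_eq: "homogeneous x0 x1 x2 x3 x4 = vec.span {vec5 x0 x1 x2 x3 x4}"
  by (simp add: homogeneous_def vec5_def)

lemma vec5_eq_iff: "(v :: 'a::field^5) = w \<longleftrightarrow> v$0 = w$0 \<and> v$1 = w$1 \<and> v$2 = w$2 \<and> v$3 = w$3 \<and> v$4 = w$4"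
  by (simp add: vec_eq_iff forall_5)

lemma span_1_iff: "v \<in> vec.span {a} \<longleftrightarrow> (\<exists>c. v = c *s a)" for a :: "'a::field^'n"
  by (auto simp: vec.span_singleton)

lemma span_2_iff: "v \<in> vec.span {a, b} \<longleftrightarrow> (\<exists>c d. v = c *s a + d *s b)" for a :: "'a::field^'n"
  unfolding vec.span_breakdown_eq[of v a] span_1_iff by (metis add.commute diff_add_cancel add_diff_cancel)

lemma dim_span_1: "a \<noteq> 0 \<Longrightarrow> vec.dim (vec.span {a}) = 1" for a :: "'a::field^'n"
  by (simp add: vec.dim_insert vec.span_empty)

lemma dim_span_2: "a \<noteq> 0 \<Longrightarrow> b \<notin> vec.span {a} \<Longrightarrow> vec.dim (vec.span {a, b}) = 2" for a :: "'a::field^'n"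
  by (subst insert_commute) (simp add: vec.dim_insert vec.span_empty)

section \<open>The quadratic form, its polar form and the singular subspaces\<close>

definition qform :: "'a::field^5 \<Rightarrow> 'a" where
  "qform v = v$0 * v$4 + v$1 * v$3 + (v$2)^2"

definition qpolar :: "'a::field^5 \<Rightarrow> 'a^5 \<Rightarrow> 'a" where
  "qpolar v w = qform (v + w) - qform v - qform w"

lemma qpolar_eq: "qpolar v w = v$0 * w$4 + v$4 * w$0 + v$1 * w$3 + v$3 * w$1 + 2 * v$2 * w$2"
  by (simp add: qpolar_def qform_def power2_eq_square algebra_simps)

lemma qform_scale: "qform (c *s v) = c^2 * qform v"
  by (simp add: qform_def power2_eq_square algebra_simps)

lemma qform_comb: "qform (c *s v + d *s w) = c^2 * qform v + d^2 * qform w + c * d * qpolar v w"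
  by (simp add: qpolar_eq qform_def power2_eq_square algebra_simps)

lemma Q4_sel:
  "Points Q4 = {U. vec.subspace U \<and> vec.dim U = 1 \<and> (\<forall>v\<in>U. qform v = 0)}"
  "Lines Q4 = {U. vec.subspace U \<and> vec.dim U = 2 \<and> (\<forall>v\<in>U. qform v = 0)}"
  "(U, V) \<in> Inc Q4 \<longleftrightarrow> U \<in> Points Q4 \<and> V \<in> Lines Q4 \<and> U \<subseteq> V"
  by (auto simp: Q4_def quadric_geometry_def qform_def Let_def)

lemma Points_Q4_iff: "U \<in> Points Q4 \<longleftrightarrow> (\<exists>v. v \<noteq> 0 \<and> qform v = 0 \<and> U = vec.span {v})"
proof
  assume U: "U \<in> Points Q4"
  then have s: "vec.subspace U" "vec.dim U = 1" "\<forall>v\<in>U. qform v = 0" by (auto simp: Q4_sel)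
  have "U \<noteq> {0}" using s(2) by auto
  then obtain v where v: "v \<in> U" "v \<noteq> 0" using vec.subspace_0[OF s(1)] by blast
  then have "vec.span {v} = U"
    using s dim_span_1[OF v(2)] by (intro vec.subspace_dim_equal vec.span_minimal) auto
  then show "\<exists>v. v \<noteq> 0 \<and> qform v = 0 \<and> U = vec.span {v}" using v s by blast
next
  assume "\<exists>v. v \<noteq> 0 \<and> qform v = 0 \<and> U = vec.span {v}"
  then show "U \<in> Points Q4" by (auto simp: Q4_sel dim_span_1 span_1_iff qform_scale)
qed

lemma Lines_Q4_iff:
  "U \<in> Lines Q4 \<longleftrightarrow> (\<exists>v w. v \<noteq> 0 \<and> w \<notin> vec.span {v} \<and> qform v = 0 \<and> qform w = 0 \<and> qpolar v w = 0 \<and> U = vec.span {v, w})"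
proof
  assume U: "U \<in> Lines Q4"
  then have s: "vec.subspace U" "vec.dim U = 2" "\<forall>v\<in>U. qform v = 0" by (auto simp: Q4_sel)
  have "U \<noteq> {0}" using s(2) by auto
  then obtain v where v: "v \<in> U" "v \<noteq> 0" using vec.subspace_0[OF s(1)] by blast
  have "\<not> U \<subseteq> vec.span {v}"
    using vec.dim_subset[of U "vec.span {v}"] dim_span_1[OF v(2)] s(2) by auto
  then obtain w where w: "w \<in> U" "w \<notin> vec.span {v}" by blast
  have "vec.span {v, w} = U"
    using s v w dim_span_2[OF v(2) w(2)] by (intro vec.subspace_dim_equal vec.span_minimal) auto
  moreover have "qpolar v w = 0" using s v w vec.subspace_add[OF s(1) v(1) w(1)] by (simp add: qpolar_def)
  ultimately show "\<exists>v w. v \<noteq> 0 \<and> w \<notin> vec.span {v} \<and> qform v = 0 \<and> qform w = 0 \<and> qpolar v w = 0 \<and> U = vec.span {v, w}"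
    using v w s by metis
next
  assume "\<exists>v w. v \<noteq> 0 \<and> w \<notin> vec.span {v} \<and> qform v = 0 \<and> qform w = 0 \<and> qpolar v w = 0 \<and> U = vec.span {v, w}"
  then show "U \<in> Lines Q4"
    using dim_span_2 by (auto simp: Q4_sel span_2_iff qform_comb simp del: vec.dim_span)
qed

lemma isometry_automorphism:
  fixes R :: "'a::field^5 \<Rightarrow> 'a^5"
  assumes add: "\<And>v w. R (v + w) = R v + R w" and scale: "\<And>c v. R (c *s v) = c *s R v"
    and bij: "bij R" and qform: "\<And>v. qform (R v) = qform v"
  shows "automorphism Q4 ((`) R) ((`) R)"
proof -
  have inj: "inj R" and surj: "surj R" using bij by (auto simp: bij_def)
  have qpolar: "qpolar (R v) (R w) = qpolar v w" for v w by (simp add: qpolar_def qform add[symmetric])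
  have sp1: "R ` vec.span {v} = vec.span {R v}" for v
  proof (intro equalityI subsetI)
    fix x assume "x \<in> vec.span {R v}"
    then obtain c where "x = R (c *s v)" by (auto simp: span_1_iff scale)
    then show "x \<in> R ` vec.span {v}" by (rule image_eqI) (auto simp: span_1_iff)
  qed (auto simp: span_1_iff scale)
  have sp2: "R ` vec.span {v, w} = vec.span {R v, R w}" for v w
  proof -
    have *: "R (c *s v + d *s w) = c *s R v + d *s R w" for c d by (simp add: add scale)
    show ?thesis
    proof (intro equalityI subsetI)
      fix x assume "x \<in> vec.span {R v, R w}"
      then obtain c d where "x = R (c *s v + d *s w)" by (auto simp: span_2_iff *)
      then show "x \<in> R ` vec.span {v, w}" by (rule image_eqI) (auto simp: span_2_iff)
    next
      fix x assume "x \<in> R ` vec.span {v, w}"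
      then obtain c d where "x = c *s R v + d *s R w" by (auto simp: span_2_iff *)
      then show "x \<in> vec.span {R v, R w}" unfolding span_2_iff by blast
    qed
  qed
  have R0: "R v = 0 \<longleftrightarrow> v = 0" for v using scale[of 0 0] inj by (metis injD vector_smult_lzero)
  have mem: "R w \<in> vec.span {R v} \<longleftrightarrow> w \<in> vec.span {v}" for v w
    unfolding sp1[symmetric] by (rule inj_image_mem_iff[OF inj])
  have P: "(`) R ` Points Q4 = Points Q4"
  proof (intro equalityI subsetI)
    fix U :: "('a^5) set" assume "U \<in> (`) R ` Points Q4"
    then obtain v where "v \<noteq> 0" "qform v = 0" "U = R ` vec.span {v}" by (auto simp: Points_Q4_iff)
    then show "U \<in> Points Q4" unfolding sp1 Points_Q4_iff by (metis qform R0)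
  next
    fix U :: "('a^5) set" assume "U \<in> Points Q4"
    then obtain v where v: "v \<noteq> 0" "qform v = 0" "U = vec.span {v}" by (auto simp: Points_Q4_iff)
    obtain w where w: "v = R w" using surj by (metis surjD)
    then have "vec.span {w} \<in> Points Q4" using v unfolding Points_Q4_iff by (metis qform R0)
    then show "U \<in> (`) R ` Points Q4" using v w sp1 by (metis imageI)
  qed
  have L: "(`) R ` Lines Q4 = Lines Q4"
  proof (intro equalityI subsetI)
    fix U :: "('a^5) set" assume "U \<in> (`) R ` Lines Q4"
    then obtain v w where "v \<noteq> 0" "w \<notin> vec.span {v}" "qform v = 0" "qform w = 0" "qpolar v w = 0" "U = R ` vec.span {v, w}"
      by (auto simp: Lines_Q4_iff)
    then show "U \<in> Lines Q4" unfolding sp2 Lines_Q4_iff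
      by (intro exI[of _ "R v"] exI[of _ "R w"]) (simp add: qform qpolar R0 mem)
  next
    fix U :: "('a^5) set" assume "U \<in> Lines Q4"
    then obtain v w where v: "v \<noteq> 0" "w \<notin> vec.span {v}" "qform v = 0" "qform w = 0" "qpolar v w = 0" "U = vec.span {v, w}"
      by (auto simp: Lines_Q4_iff)
    obtain v' w' where w: "v = R v'" "w = R w'" using surj by (metis surjD)
    then have "vec.span {v', w'} \<in> Lines Q4" using v unfolding Lines_Q4_iff
      by (intro exI[of _ v'] exI[of _ w']) (simp add: qform qpolar R0 mem)
    then show "U \<in> (`) R ` Lines Q4" using v w sp2 by (metis imageI)
  qed
  have inj': "inj_on ((`) R) X" for X using inj by (auto simp: inj_on_def inj_image_eq_iff)
  have "(R ` U, R ` V) \<in> Inc Q4 \<longleftrightarrow> (U, V) \<in> Inc Q4" if "U \<in> Points Q4" "V \<in> Lines Q4" for U V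
  proof -
    have "R ` U \<in> Points Q4" "R ` V \<in> Lines Q4" using that P L by blast+
    then show ?thesis using that by (simp add: Q4_sel(3) inj_image_subset_iff[OF inj])
  qed
  then show ?thesis using P L inj' by (simp add: isomorphism_def bij_betw_def)
qed

text \<open>
  Coordinates of the points and lines of \<open>Q(4,q)\<close> with respect to the flag formed by
  the point \<open>(0,0,0,0,1)\<close> and the line \<open>X\<^sub>0 = X\<^sub>1 = X\<^sub>2 = 0\<close>.
\<close>

datatype 'a qpoint = PInf | PS 'a | PA 'a 'a | PB 'a 'a 'a
datatype 'a qline = LInf | LA 'a | LS 'a 'a | LE 'a 'a 'a

text \<open>The clauses for \<open>LE\<close> are the coset maps of a Heisenberg group of triples
  (a, x, b): the invariants are (a, x - 2ba) at infinity and (b - ta, x - ta^2) for finite t. They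
  imitate the way in which \<open>linv\<close> attaches cosets to an element of G.\<close>

fun qinc :: "'a::field qpoint \<Rightarrow> 'a qline \<Rightarrow> bool" where
  "qinc PInf LInf = True"
| "qinc PInf (LA a) = True"
| "qinc PInf _ = False"
| "qinc (PS t) LInf = True"
| "qinc (PS t) (LS t' b) = (t = t')"
| "qinc (PS t) _ = False"
| "qinc (PA a z) (LA a') = (a = a')"
| "qinc (PA a z) (LE a' x b) = (a = a' \<and> z = x - 2 * b * a)"
| "qinc (PA a z) _ = False"
| "qinc (PB t b x) (LS t' b') = (t = t' \<and> b = b')"
| "qinc (PB t b x) (LE a x' b') = (b = b' - t * a \<and> x = x' - t * a^2)"
| "qinc (PB t b x) _ = False"

fun pvec :: "'a::field qpoint \<Rightarrow> 'a^5" where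
  "pvec PInf = vec5 0 0 0 0 1"
| "pvec (PS t) = vec5 0 0 0 1 (- t)"
| "pvec (PA a z) = vec5 0 1 (- a) (- (a^2)) (- z)"
| "pvec (PB t b x) = vec5 1 t b x (- (t * x + b^2))"

text \<open>Three linear equations instead of a span, so that incidence with a coordinate vector is
  settled by substitution; \<open>lset_span\<close> supplies generators.\<close>

fun lset :: "'a::field qline \<Rightarrow> ('a^5) set" where
  "lset LInf = {v. v$0 = 0 \<and> v$1 = 0 \<and> v$2 = 0}"
| "lset (LA a) = {v. v$0 = 0 \<and> v$2 = - a * v$1 \<and> v$3 = - (a^2) * v$1}"
| "lset (LS t b) = {v. v$1 = t * v$0 \<and> v$2 = b * v$0 \<and> v$4 = - t * v$3 - b^2 * v$0}"
| "lset (LE a x b) = {v. v$2 = - a * v$1 + b * v$0 \<and> v$3 = - (a^2) * v$1 + x * v$0 \<and>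
     v$4 = (2 * b * a - x) * v$1 - b^2 * v$0}"

lemma lset_span:
  "lset LInf = vec.span {vec5 0 0 0 1 0, vec5 0 0 0 0 1}"
  "lset (LA a) = vec.span {vec5 0 0 0 0 1, vec5 0 1 (- a) (- (a^2)) 0}"
  "lset (LS t b) = vec.span {vec5 0 0 0 1 (- t), vec5 1 t b 0 (- (b^2))}"
  "lset (LE a x b) = vec.span {vec5 0 1 (- a) (- (a^2)) (2 * b * a - x), vec5 1 0 b x (- (b^2))}"
proof -
  show "lset LInf = vec.span {vec5 0 0 0 1 0, vec5 0 0 0 0 1}"
  proof (intro equalityI subsetI)
    fix v assume "v \<in> lset LInf"
    then have "v = v$3 *s vec5 0 0 0 1 0 + v$4 *s vec5 0 0 0 0 1" by (simp add: vec5_eq_iff)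
    then show "v \<in> vec.span {vec5 0 0 0 1 0, vec5 0 0 0 0 1}" unfolding span_2_iff by blast
  qed (auto simp: span_2_iff)
  show "lset (LA a) = vec.span {vec5 0 0 0 0 1, vec5 0 1 (- a) (- (a^2)) 0}"
  proof (intro equalityI subsetI)
    fix v assume "v \<in> lset (LA a)"
    then have "v = v$4 *s vec5 0 0 0 0 1 + v$1 *s vec5 0 1 (- a) (- (a^2)) 0" by (simp add: vec5_eq_iff)
    then show "v \<in> vec.span {vec5 0 0 0 0 1, vec5 0 1 (- a) (- (a^2)) 0}" unfolding span_2_iff by blast
  qed (auto simp: span_2_iff)
  show "lset (LS t b) = vec.span {vec5 0 0 0 1 (- t), vec5 1 t b 0 (- (b^2))}"
  proof (intro equalityI subsetI)
    fix v assume "v \<in> lset (LS t b)"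
    then have "v = v$3 *s vec5 0 0 0 1 (- t) + v$0 *s vec5 1 t b 0 (- (b^2))" by (simp add: vec5_eq_iff)
    then show "v \<in> vec.span {vec5 0 0 0 1 (- t), vec5 1 t b 0 (- (b^2))}" unfolding span_2_iff by blast
  qed (auto simp: span_2_iff)
  show "lset (LE a x b) = vec.span {vec5 0 1 (- a) (- (a^2)) (2 * b * a - x), vec5 1 0 b x (- (b^2))}"
  proof (intro equalityI subsetI)
    fix v assume "v \<in> lset (LE a x b)"
    then have "v = v$1 *s vec5 0 1 (- a) (- (a^2)) (2 * b * a - x) + v$0 *s vec5 1 0 b x (- (b^2))"
      by (simp add: vec5_eq_iff)
    then show "v \<in> vec.span {vec5 0 1 (- a) (- (a^2)) (2 * b * a - x), vec5 1 0 b x (- (b^2))}"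
      unfolding span_2_iff by blast
  qed (auto simp: span_2_iff algebra_simps)
qed

lemma lset_in_Lines_Q4: "lset l \<in> Lines Q4"
  unfolding Lines_Q4_iff
proof (cases l)
  case LInf
  show "\<exists>v w. v \<noteq> 0 \<and> w \<notin> vec.span {v} \<and> qform v = 0 \<and> qform w = 0 \<and> qpolar v w = 0 \<and> lset l = vec.span {v, w}"
    unfolding LInf lset_span by (intro exI conjI, (rule refl)?) (auto simp: span_1_iff vec5_eq_iff qform_def qpolar_eq)
next
  case (LA a)
  show "\<exists>v w. v \<noteq> 0 \<and> w \<notin> vec.span {v} \<and> qform v = 0 \<and> qform w = 0 \<and> qpolar v w = 0 \<and> lset l = vec.span {v, w}"
    unfolding LA lset_span
    by (intro exI[of _ "vec5 0 0 0 0 1"] exI[of _ "vec5 0 1 (- a) (- (a^2)) 0"])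
      (auto simp: span_1_iff vec5_eq_iff qform_def qpolar_eq)
next
  case (LS t b)
  show "\<exists>v w. v \<noteq> 0 \<and> w \<notin> vec.span {v} \<and> qform v = 0 \<and> qform w = 0 \<and> qpolar v w = 0 \<and> lset l = vec.span {v, w}"
    unfolding LS lset_span
    by (intro exI[of _ "vec5 0 0 0 1 (- t)"] exI[of _ "vec5 1 t b 0 (- (b^2))"])
      (auto simp: span_1_iff vec5_eq_iff qform_def qpolar_eq)
next
  case (LE a x b)
  show "\<exists>v w. v \<noteq> 0 \<and> w \<notin> vec.span {v} \<and> qform v = 0 \<and> qform w = 0 \<and> qpolar v w = 0 \<and> lset l = vec.span {v, w}"
    unfolding LE lset_span
    by (intro exI[of _ "vec5 0 1 (- a) (- (a^2)) (2 * b * a - x)"] exI[of _ "vec5 1 0 b x (- (b^2))"])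
      (auto simp: span_1_iff vec5_eq_iff qform_def qpolar_eq)
qed

lemma pvec_singular: "pvec p \<noteq> 0" "qform (pvec p) = 0"
  by (cases p; simp add: qform_def vec5_eq_iff power2_eq_square algebra_simps)+

lemma ppoint_in_Points_Q4: "vec.span {pvec p} \<in> Points Q4"
  using pvec_singular[of p] unfolding Points_Q4_iff by blast

lemma pvec_in_lset_iff: "pvec p \<in> lset l \<longleftrightarrow> qinc p l"
  by (cases p; cases l) (auto simp: power2_eq_square algebra_simps)

lemma ppoint_inj: "vec.span {pvec p} = vec.span {pvec p'} \<longleftrightarrow> p = p'"
proof
  assume "vec.span {pvec p} = vec.span {pvec p'}"
  then have "pvec p \<in> vec.span {pvec p'}" using vec.span_base[of "pvec p" "{pvec p}"] by simp
  then obtain c where "pvec p = c *s pvec p'" by (auto simp: span_1_iff)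
  then show "p = p'" by (cases p; cases p') (auto simp: vec5_eq_iff)
qed simp

text \<open>Scale the first nonzero entry among v_0, v_1, v_3, v_4 to 1; once v_0 = v_1 = 0, the
  form itself forces v_2 = 0.\<close>

lemma singular_point:
  assumes "v \<noteq> 0" "qform v = 0"
  obtains p where "vec.span {v} = vec.span {pvec p}"
proof -
  have *: "\<exists>p c. c \<noteq> 0 \<and> v = c *s pvec p"
  proof (cases "v$0 = 0")
    case False
    then have "v = v$0 *s pvec (PB (v$1 / v$0) (v$2 / v$0) (v$3 / v$0))"
      using assms(2) by (simp add: vec5_eq_iff qform_def power2_eq_square field_simps) algebra
    then show ?thesis using False by blast
  next
    case 0: True
    show ?thesis
    proof (cases "v$1 = 0")
      case False
      then have "v = v$1 *s pvec (PA (- v$2 / v$1) (- v$4 / v$1))"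
        using assms(2) 0 by (simp add: vec5_eq_iff qform_def power2_eq_square field_simps) algebra
      then show ?thesis using False by blast
    next
      case 1: True
      then have 2: "v$2 = 0" using assms(2) 0 by (simp add: qform_def)
      show ?thesis
      proof (cases "v$3 = 0")
        case False
        then have "v = v$3 *s pvec (PS (- v$4 / v$3))"
          using 0 1 2 by (simp add: vec5_eq_iff)
        then show ?thesis using False by blast
      next
        case 3: True
        then have "v = v$4 *s pvec PInf" "v$4 \<noteq> 0"
          using 0 1 2 assms(1) by (simp_all add: vec5_eq_iff)
        then show ?thesis by blast
      qed
    qed
  qed
  then obtain p c where "c \<noteq> 0" "v = c *s pvec p" by blast
  then have "vec.span {v} = vec.span {pvec p}"
    by (auto simp: set_eq_iff span_1_iff) (metis nonzero_eq_divide_eq)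
  then show ?thesis by (rule that)
qed

text \<open>The type of the line is dictated by the position of v in the tangent hyperplane X_0 = 0
  and by the vanishing of entries of w. Requiring v_0 = 0 loses nothing, since every line meets that
  hyperplane.\<close>

lemma singular_pair_in_lset:
  assumes v: "v \<noteq> 0" "qform v = 0" "v$0 = 0" and w: "qform w = 0" "qpolar v w = 0"
  obtains l where "v \<in> lset l" "w \<in> lset l"
proof (cases "v$1 = 0")
  case False
  define a where "a = - v$2 / v$1"
  have v2: "v$2 = - a * v$1" using False by (simp add: a_def)
  have "v$1 * v$3 = v$1 * (- (a^2) * v$1)"
    using v(2,3) v2 by (simp add: qform_def power2_eq_square eq_neg_iff_add_eq_0 mult_ac)
  then have v3: "v$3 = - (a^2) * v$1" using mult_left_cancel[OF False] by blast
  have "v$1 * (w$3 - a^2 * w$1 - 2 * a * w$2) + v$4 * w$0 = 0"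
    using w(2) v(3) by (simp add: qpolar_eq v2 v3 algebra_simps)
  note Bvw = this
  show ?thesis
  proof (cases "w$0 = 0")
    case True
    then have w3: "w$3 = a^2 * w$1 + 2 * a * w$2" 
    proof -
      have "w$3 - a^2 * w$1 - 2 * a * w$2 = 0" using Bvw True False by simp
      then show ?thesis by (simp add: algebra_simps)
    qed
    have "(a * w$1 + w$2)^2 = 0"
      using w(1) True by (simp add: qform_def w3 power2_eq_square algebra_simps)
    then have "w$2 = - a * w$1" by (simp add: eq_neg_iff_add_eq_0 add.commute)
    then show ?thesis using that[of "LA a"] v(3) v2 v3 True w3 by (simp add: power2_eq_square algebra_simps)
  next
    case w0: False
    define b x where "b = (w$2 + a * w$1) / w$0" and "x = (w$3 + a^2 * w$1) / w$0"
    have w2: "w$2 = - a * w$1 + b * w$0" and w3: "w$3 = - (a^2) * w$1 + x * w$0"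
      using w0 by (simp_all add: b_def x_def)
    have "w$0 * w$4 = w$0 * ((2 * b * a - x) * w$1 - b^2 * w$0)"
    proof -
      have "w$0 * w$4 = - (w$1 * w$3) - (w$2)^2" using w(1) by (simp add: qform_def algebra_simps eq_neg_iff_add_eq_0)
      also have "\<dots> = w$0 * ((2 * b * a - x) * w$1 - b^2 * w$0)"
        unfolding w2 w3 by (simp add: power2_eq_square algebra_simps)
      finally show ?thesis .
    qed
    then have w4: "w$4 = (2 * b * a - x) * w$1 - b^2 * w$0" using mult_left_cancel[OF w0] by blast
    have "w$0 * v$4 = w$0 * ((2 * b * a - x) * v$1)"
    proof -
      have "w$0 * v$4 = - (v$1 * (w$3 - a^2 * w$1 - 2 * a * w$2))"
        using Bvw by (simp add: eq_neg_iff_add_eq_0 algebra_simps)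
      also have "\<dots> = w$0 * ((2 * b * a - x) * v$1)"
        unfolding w2 w3 by (simp add: power2_eq_square algebra_simps)
      finally show ?thesis .
    qed
    then have v4: "v$4 = (2 * b * a - x) * v$1" using mult_left_cancel[OF w0] by blast
    show ?thesis
    proof (rule that)
      show "v \<in> lset (LE a x b)" using v2 v3 v4 v(3) by simp
      show "w \<in> lset (LE a x b)" using w2 w3 w4 by simp
    qed
  qed
next
  case v1: True
  then have v2: "v$2 = 0" using v by (simp add: qform_def)
  show ?thesis
  proof (cases "v$3 = 0")
    case False
    define t where "t = - v$4 / v$3"
    have v4: "v$4 = - t * v$3" using False by (simp add: t_def)
    have "v$3 * w$1 = v$3 * (t * w$0)" using w(2) v(3) by (simp add: qpolar_eq v1 v2 v4 algebra_simps)
    then have w1: "w$1 = t * w$0" using mult_left_cancel[OF False] by blast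
    show ?thesis
    proof (cases "w$0 = 0")
      case True
      then have "w$1 = 0" "w$2 = 0" using w1 w(1) by (simp_all add: qform_def)
      then show ?thesis using that[of LInf] True v(3) v1 v2 by simp
    next
      case w0: False
      define b where "b = w$2 / w$0"
      have w2: "w$2 = b * w$0" using w0 by (simp add: b_def)
      have "w$0 * w$4 = w$0 * (- t * w$3 - b^2 * w$0)"
        using w(1) by (simp add: qform_def w1 w2 power2_eq_square algebra_simps eq_neg_iff_add_eq_0)
      then have "w$4 = - t * w$3 - b^2 * w$0" using mult_left_cancel[OF w0] by blast
      then show ?thesis using that[of "LS t b"] v(3) v1 v2 v4 w1 w2 by simp
    qed
  next
    case v3: True
    then have "v$4 \<noteq> 0" using v v1 v2 by (simp add: vec5_eq_iff)
    then have w0: "w$0 = 0" using w(2) v(3) v1 v2 v3 by (simp add: qpolar_eq)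
    show ?thesis
    proof (cases "w$1 = 0")
      case True
      then have "w$2 = 0" using w(1) w0 by (simp add: qform_def)
      then show ?thesis using that[of LInf] True w0 v(3) v1 v2 by simp
    next
      case w1: False
      define a where "a = - w$2 / w$1"
      have w2: "w$2 = - a * w$1" using w1 by (simp add: a_def)
      have "w$1 * w$3 = w$1 * (- (a^2) * w$1)"
        using w(1) w0 w2 by (simp add: qform_def power2_eq_square eq_neg_iff_add_eq_0 mult_ac)
      then have "w$3 = - (a^2) * w$1" using mult_left_cancel[OF w1] by blast
      then show ?thesis using that[of "LA a"] w0 w2 v(3) v1 v2 v3 by simp
    qed
  qed
qed

lemma Lines_Q4_lset:
  assumes "U \<in> Lines Q4"
  obtains l where "U = lset l"
proof -
  obtain v w where vw: "v \<noteq> 0" "w \<notin> vec.span {v}" "qform v = 0" "qform w = 0" "qpolar v w = 0" and U: "U = vec.span {v, w}"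
    using assms unfolding Lines_Q4_iff by blast
  have sub: "\<exists>l. v \<in> lset l \<and> w \<in> lset l"
  proof (cases "v$0 = 0")
    case True
    then show ?thesis using singular_pair_in_lset[OF vw(1,3) True vw(4,5)] by blast
  next
    case False
    \<comment> \<open>The combination of v and w which lies in the hyperplane X_0 = 0.\<close>
    define w' where "w' = w - (w$0 / v$0) *s v"
    have "w' = (- (w$0 / v$0)) *s v + 1 *s w" by (simp add: w'_def vec5_eq_iff)
    then have "qform w' = 0" by (simp only: qform_comb) (simp add: vw)
    moreover have "w' \<noteq> 0" using vw(2) by (auto simp: w'_def span_1_iff)
    moreover have "w'$0 = 0" using False by (simp add: w'_def)
    moreover have "qpolar w' v = qpolar v w - (w$0 / v$0) * 2 * qform v"
      by (simp add: w'_def qpolar_eq qform_def power2_eq_square algebra_simps)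
    then have "qpolar w' v = 0" using vw by simp
    ultimately obtain l where l: "w' \<in> lset l" "v \<in> lset l" using vw(3) singular_pair_in_lset by metis
    have "vec.subspace (lset l)" using lset_in_Lines_Q4[of l] by (simp add: Q4_sel)
    then have "w' + (w$0 / v$0) *s v \<in> lset l" using l by (intro vec.subspace_add vec.subspace_scale)
    then show ?thesis using l by (auto simp: w'_def)
  qed
  then obtain l where l: "v \<in> lset l" "w \<in> lset l" by blast
  have L: "vec.subspace (lset l)" "vec.dim (lset l) = 2" using lset_in_Lines_Q4[of l] by (simp_all add: Q4_sel)
  have "U = lset l"
    unfolding U using l L dim_span_2[OF vw(1,2)] by (intro vec.subspace_dim_equal vec.span_minimal) auto
  then show ?thesis by (rule that)
qed

text \<open>In each case two points of l are tested against l'; two points determine their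
  line.\<close>

lemma lset_inj:
  assumes "lset l = lset l'"
  shows "l = l'"
proof -
  have *: "qinc p l \<longleftrightarrow> qinc p l'" for p using assms pvec_in_lset_iff by metis
  show ?thesis
  proof (cases l)
    case LInf
    then show ?thesis using *[of PInf] *[of "PS 0"] by (cases l') auto
  next
    case (LA a)
    then show ?thesis using *[of PInf] *[of "PA a 0"] by (cases l') auto
  next
    case (LS t b)
    then show ?thesis using *[of "PS t"] *[of "PB t b 0"] by (cases l') auto
  next
    case (LE a x b)
    then show ?thesis using *[of "PA a (x - 2 * b * a)"] *[of "PB 0 b x"] by (cases l') auto
  qed
qed

definition qgeom :: "('a::field qpoint, 'a qline) geometry" where
  "qgeom = \<lparr>Points = UNIV, Lines = UNIV, Inc = {(p, l). qinc p l}\<rparr>"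

lemma isomorphism_qgeom_Q4:
  "isomorphism qgeom (Q4 :: (('a::field^5) set, ('a^5) set) geometry) (\<lambda>p. vec.span {pvec p}) lset"
  unfolding isomorphism_def
proof (intro conjI ballI)
  show "bij_betw (\<lambda>p :: 'a qpoint. vec.span {pvec p}) (Points qgeom) (Points Q4)"
    unfolding bij_betw_def
  proof
    show "(\<lambda>p :: 'a qpoint. vec.span {pvec p}) ` Points qgeom = Points Q4"
    proof (intro equalityI subsetI)
      fix U :: "('a^5) set" assume "U \<in> Points Q4"
      then obtain v where "v \<noteq> 0" "qform v = 0" "U = vec.span {v}" by (auto simp: Points_Q4_iff)
      moreover from this obtain p where "vec.span {v} = vec.span {pvec p}" using singular_point by blast
      ultimately show "U \<in> (\<lambda>p :: 'a qpoint. vec.span {pvec p}) ` Points qgeom" by (auto simp: qgeom_def)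
    qed (use ppoint_in_Points_Q4 in auto)
  qed (simp add: inj_on_def ppoint_inj)
  show "bij_betw lset (Lines qgeom) (Lines (Q4 :: (('a^5) set, ('a^5) set) geometry))"
    unfolding bij_betw_def
  proof
    show "lset ` Lines qgeom = Lines (Q4 :: (('a^5) set, ('a^5) set) geometry)"
    proof (intro equalityI subsetI)
      fix U :: "('a^5) set" assume "U \<in> Lines Q4"
      then obtain l where "U = lset l" by (rule Lines_Q4_lset)
      then show "U \<in> lset ` Lines qgeom" by (simp add: qgeom_def)
    qed (use lset_in_Lines_Q4 in auto)
  qed (simp add: inj_on_def lset_inj)
next
  fix p :: "'a qpoint" and l :: "'a qline"
  assume "p \<in> Points qgeom" "l \<in> Lines qgeom"
  have sub: "vec.subspace (lset l)" using lset_in_Lines_Q4[of l] by (simp add: Q4_sel)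
  have "vec.span {pvec p} \<subseteq> lset l \<longleftrightarrow> pvec p \<in> lset l"
    using vec.span_minimal[OF _ sub] vec.span_base by blast
  then show "(vec.span {pvec p}, lset l) \<in> Inc Q4 \<longleftrightarrow> (p, l) \<in> Inc qgeom"
    by (simp add: Q4_sel(3) qgeom_def pvec_in_lset_iff ppoint_in_Points_Q4 lset_in_Lines_Q4)
qed

declare split_paired_Ex [simp del] split_paired_All [simp del]

section \<open>Squares and automorphisms in finite fields of odd order\<close>

text \<open>Translation by 1 permutes the ring and so preserves the sum of all elements, while it
  adds 1 to each summand.\<close>

lemma of_nat_CARD_eq_0: "of_nat CARD('a) = (0 :: 'a :: {ring_1, finite})"
proof -
  have "(\<Sum>x\<in>UNIV. x :: 'a) = (\<Sum>x\<in>UNIV. x + 1)"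
    by (rule sum.reindex_bij_betw[symmetric]) (rule bij_betw_byWitness[where f' = "\<lambda>x. x - 1"], auto)
  then show ?thesis
    by (simp add: sum.distrib)
qed

lemma two_neq_zero_of_odd_CARD:
  assumes "odd CARD('a::{field,finite})"
  shows "(2::'a) \<noteq> 0"
proof
  assume 2: "(2::'a) = 0"
  obtain n where "CARD('a) = 2 * n + 1" using assms oddE by blast
  then have "of_nat CARD('a) = 2 * (of_nat n :: 'a) + 1"
    by simp
  then show False using 2 of_nat_CARD_eq_0[where 'a='a] by simp
qed

text \<open>A square has at most two roots, so at least half of the nonzero elements are squares.
  Multiplication by the nonsquare a maps the nonzero squares injectively into the nonsquares, hence
  onto them, which yields b = a z^2.\<close>

lemma nonsquare_mult_nonsquare:
  fixes a b :: "'a::{field,finite}"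
  assumes odd: "odd CARD('a)" and a: "\<not> is_square a" and b: "\<not> is_square b"
  shows "is_square (a * b)"
proof -
  define Sq where "Sq = {x::'a. x \<noteq> 0 \<and> is_square x}"
  define N where "N = {x::'a. \<not> is_square x}"
  have 2: "(2::'a) \<noteq> 0" by (rule two_neq_zero_of_odd_CARD[OF odd])
  have "card (UNIV - {0::'a}) \<le> 2 * card Sq"
  proof -
    have "UNIV - {0} = (\<Union>y\<in>Sq. {x::'a. x^2 = y})"
      by (auto simp: Sq_def is_nth_power_def)
    moreover have "card {x::'a. x^2 = y} \<le> 2" if y: "y \<in> Sq" for y
    proof -
      obtain z where "y = z^2" using y by (auto simp: Sq_def is_nth_power_def)
      then have "{x::'a. x^2 = y} \<subseteq> {z, -z}" by (auto simp: power2_eq_iff)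
      then have "card {x::'a. x^2 = y} \<le> card {z, -z}" by (intro card_mono) auto
      also have "\<dots> \<le> 2" by (simp add: card_insert_if)
      finally show ?thesis .
    qed
    ultimately have "card (UNIV - {0::'a}) \<le> (\<Sum>y\<in>Sq. 2)"
      by (metis (no_types, lifting) card_UN_le finite order_trans sum_mono)
    then show ?thesis by (simp add: mult.commute)
  qed
  moreover have "UNIV - {0::'a} = Sq \<union> N" "Sq \<inter> N = {}"
    by (auto simp: Sq_def N_def)
  then have "card (UNIV - {0::'a}) = card Sq + card N"
    by (simp add: card_Un_disjoint)
  ultimately have "card N \<le> card Sq" by simp
  moreover have a0: "a \<noteq> 0" using a by auto
  have "(\<lambda>x. a * x) ` Sq \<subseteq> N"
  proof safe
    fix x assume x: "x \<in> Sq"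
    then obtain z where z: "x = z^2" "z \<noteq> 0" by (auto simp: Sq_def is_nth_power_def)
    show "a * x \<in> N" unfolding N_def
    proof (safe, elim is_nth_powerE)
      fix y assume "a * x = y^2"
      then have "a = (y / z)^2" using z by (simp add: power_divide field_simps)
      then show False using a by auto
    qed
  qed
  moreover have "card ((\<lambda>x. a * x) ` Sq) = card Sq"
    using a0 by (intro card_image inj_onI) auto
  ultimately have "(\<lambda>x. a * x) ` Sq = N"
    by (intro card_seteq) auto
  moreover have "b \<in> N" using b by (simp add: N_def)
  ultimately obtain z where "b = a * z^2" by (auto simp: Sq_def is_nth_power_def)
  then have "a * b = (a * z)^2" by (simp add: power2_eq_square)
  then show ?thesis by auto
qed

lemma vec2_eq_iff: "(x :: 'a^2) = y \<longleftrightarrow> x$1 = y$1 \<and> x$2 = y$2"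
  by (simp add: vec_eq_iff forall_2)

lemma field_automorphism_simps:
  assumes "field_automorphism (\<sigma> :: 'a :: field \<Rightarrow> 'a)"
  shows "\<sigma> (x + y) = \<sigma> x + \<sigma> y" "\<sigma> (x * y) = \<sigma> x * \<sigma> y" "\<sigma> 1 = 1" "\<sigma> 0 = 0"
    "\<sigma> (- x) = - \<sigma> x" "\<sigma> (x - y) = \<sigma> x - \<sigma> y" "\<sigma> x = \<sigma> y \<longleftrightarrow> x = y" "\<sigma> x = 0 \<longleftrightarrow> x = 0"
    "\<sigma> (x ^ n) = \<sigma> x ^ n" "\<sigma> 2 = 2" "\<sigma> (inverse x) = inverse (\<sigma> x)" "\<sigma> (x / y) = \<sigma> x / \<sigma> y"
proof -
  have add: "\<sigma> (x + y) = \<sigma> x + \<sigma> y" and mult: "\<sigma> (x * y) = \<sigma> x * \<sigma> y" and one: "\<sigma> 1 = 1" for x y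
    using assms by (auto simp: field_automorphism_def)
  show zero: "\<sigma> 0 = 0" by (metis add add.right_neutral add_left_cancel)
  show neg: "\<sigma> (- x) = - \<sigma> x" for x using add[of x "- x"] zero by (simp add: eq_neg_iff_add_eq_0 add.commute)
  show "\<sigma> (x - y) = \<sigma> x - \<sigma> y" using add[of x "- y"] neg by simp
  show inj: "\<sigma> x = \<sigma> y \<longleftrightarrow> x = y" for x y
    using assms by (auto simp: field_automorphism_def bij_def inj_def)
  show zero_iff: "\<sigma> x = 0 \<longleftrightarrow> x = 0" for x using inj[of x 0] zero by simp
  show "\<sigma> (x ^ n) = \<sigma> x ^ n" by (induction n) (simp_all only: power_0 power_Suc one mult)
  show "\<sigma> 2 = 2" using add[of 1 1] one by simp
  show inv: "\<sigma> (inverse x) = inverse (\<sigma> x)" for x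
  proof (cases "x = 0")
    case False
    then have "\<sigma> x * \<sigma> (inverse x) = 1" using mult[of x "inverse x"] one by simp
    then show ?thesis using False zero_iff by (simp add: inverse_unique)
  qed (simp add: zero)
  show "\<sigma> (x / y) = \<sigma> x / \<sigma> y" by (simp add: divide_inverse mult inv)
qed (use assms in \<open>auto simp: field_automorphism_def\<close>)

lemma dotp_2: "dotp u v = u$1 * v$1 + u$2 * v$2"
  by (simp add: dotp_def sum_2)

section \<open>Coordinates of the Kantor-Knuth quadrangle\<close>

locale kk_data =
  fixes m :: "'a::{field, finite}" and \<sigma> :: "'a \<Rightarrow> 'a"
  assumes odd_CARD: "odd CARD('a)" and nonsquare_m: "\<not> is_square m" and aut: "field_automorphism \<sigma>"
begin

lemmas \<sigma>_simps [simp] = field_automorphism_simps[OF aut]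

lemma two_neq_0 [simp]: "(2::'a) \<noteq> 0"
  by (rule two_neq_zero_of_odd_CARD[OF odd_CARD])

lemma m_neq_0 [simp]: "m \<noteq> 0"
  using nonsquare_m by auto

lemma surj_\<sigma>: obtains y where "x = \<sigma> y"
  using aut by (auto simp: field_automorphism_def bij_def surj_def)

lemma is_square_\<sigma>_iff: "is_square (\<sigma> x) \<longleftrightarrow> is_square x"
proof
  assume "is_square (\<sigma> x)"
  then obtain y where "\<sigma> x = y^2" by (elim is_nth_powerE)
  moreover obtain z where "y = \<sigma> z" by (rule surj_\<sigma>)
  ultimately have "\<sigma> x = \<sigma> (z^2)" by simp
  then show "is_square x" by (simp only: \<sigma>_simps(7)) simp
qed (metis is_nth_powerE is_nth_power_nth_power \<sigma>_simps(9))

text \<open>An automorphism preserves squares and nonsquares, so \<sigma>(x) and x are of the same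
  kind.\<close>

lemma is_square_\<sigma>_mult: "is_square (\<sigma> x * x)"
proof (cases "is_square x")
  case True
  then obtain z where "x = z^2" by (elim is_nth_powerE)
  then have "\<sigma> x * x = (\<sigma> z * z)^2" by (simp add: power_mult_distrib)
  then show ?thesis by simp
next
  case False
  then show ?thesis using nonsquare_mult_nonsquare[OF odd_CARD] is_square_\<sigma>_iff by blast
qed

text \<open>The anisotropy argument behind two additive bijections: the map \<open>Lk\<close>, and
  the map which shows that the standard Kantor-Knuth set is an ovoid.\<close>

lemma nonsquare_\<sigma>_mult_eq_square:
  assumes "\<not> is_square n" "n * (\<sigma> x * x) = y^2"
  shows "x = 0"
proof (rule ccontr)
  assume x: "x \<noteq> 0"
  obtain z where z: "\<sigma> x * x = z^2" using is_square_\<sigma>_mult[of x] by (elim is_nth_powerE)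
  then have "z \<noteq> 0" using x by auto
  then have "n = (y / z)^2" using assms(2) z by (simp add: power_divide field_simps)
  then show False using assms(1) by simp
qed

abbreviation "A t \<equiv> A_mat m \<sigma> t"
abbreviation "K t \<equiv> K_mat m \<sigma> t"
abbreviation "F \<equiv> flock_quadrangle m \<sigma>"
abbreviation "S \<equiv> kantor_knuth m \<sigma>"

lemma vA [simp]: "(\<alpha> v* A t)$1 = t * \<alpha>$1" "(\<alpha> v* A t)$2 = - m * \<sigma> t * \<alpha>$2"
  by (simp_all add: vector_matrix_mult_def sum_2 A_mat_def mult.commute)

lemma vK [simp]: "(\<alpha> v* K t)$1 = 2 * t * \<alpha>$1" "(\<alpha> v* K t)$2 = - 2 * m * \<sigma> t * \<alpha>$2"
  by (simp_all add: vector_matrix_mult_def sum_2 K_mat_def A_mat_def transpose_def algebra_simps)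

text \<open>
  A coset of \<open>A(t)\<close> is a fibre of \<open>linv t\<close>, and a coset of \<open>A\<^sup>*(t)\<close> is a fibre of its first component.
\<close>

definition linv :: "'a option \<Rightarrow> 'a kk_elem \<Rightarrow> ('a^2) \<times> 'a" where
  "linv t g = (case g of (\<alpha>, c, \<beta>) \<Rightarrow> (case t of
       None \<Rightarrow> (\<alpha>, c - dotp \<beta> \<alpha>)
     | Some t \<Rightarrow> (\<beta> - \<alpha> v* K t, c - dotp (\<alpha> v* A t) \<alpha>)))"

definition fib :: "'a option \<Rightarrow> ('a^2) \<times> 'a \<Rightarrow> 'a kk_elem set" where
  "fib t p = {g. linv t g = p}"

definition sfib :: "'a option \<Rightarrow> 'a^2 \<Rightarrow> 'a kk_elem set" where
  "sfib t u = {g. fst (linv t g) = u}"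

lemma linv_simps [simp]:
  "linv None (\<alpha>, c, \<beta>) = (\<alpha>, c - dotp \<beta> \<alpha>)"
  "linv (Some t') (\<alpha>, c, \<beta>) = (\<beta> - \<alpha> v* K t', c - dotp (\<alpha> v* A t') \<alpha>)"
  by (simp_all add: linv_def)

lemma A_sub_coset: "A_sub m \<sigma> t #>\<^bsub>kk_group\<^esub> g = fib t (linv t g)"
proof -
  obtain \<alpha> c \<beta> where g: "g = (\<alpha>, c, \<beta>)" by (cases g)
  have sub: "\<exists>h\<in>A_sub m \<sigma> t. x = h \<otimes>\<^bsub>kk_group\<^esub> g" if "linv t x = linv t g" for x
  proof -
    obtain \<alpha>' c' \<beta>' where x: "x = (\<alpha>', c', \<beta>')" by (cases x)
    show ?thesis
    proof (cases t)
      case None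
      then have "x = (0, 0, \<beta>' - \<beta>) \<otimes>\<^bsub>kk_group\<^esub> g"
        using that by (auto simp: A_sub_def x g kk_group_def vec2_eq_iff dotp_2 algebra_simps)
      then show ?thesis
        unfolding None A_sub_def by auto
    next
      case (Some t')
      then have "x = (\<alpha>' - \<alpha>, dotp ((\<alpha>' - \<alpha>) v* A t') (\<alpha>' - \<alpha>), (\<alpha>' - \<alpha>) v* K t') \<otimes>\<^bsub>kk_group\<^esub> g"
        using that by (auto simp: A_sub_def x g kk_group_def vec2_eq_iff dotp_2 algebra_simps)
      then show ?thesis
        unfolding Some A_sub_def by auto
    qed
  qed
  have "linv t (h \<otimes>\<^bsub>kk_group\<^esub> g) = linv t g" if "h \<in> A_sub m \<sigma> t" for h
    using that by (cases t) (auto simp: A_sub_def g kk_group_def vec2_eq_iff dotp_2 algebra_simps)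
  with sub show ?thesis
    by (auto simp: r_coset_def fib_def)
qed

lemma A_star_coset: "A_star m \<sigma> t #>\<^bsub>kk_group\<^esub> g = sfib t (fst (linv t g))"
proof -
  obtain \<alpha> c \<beta> where g: "g = (\<alpha>, c, \<beta>)" by (cases g)
  \<comment> \<open>The elements (0, z, 0) are central, so a coset of A*(t) is a union of cosets of
    A(t) whose representatives differ only in the middle entry.\<close>
  have shift: "(a \<otimes>\<^bsub>kk_group\<^esub> (0, z, 0)) \<otimes>\<^bsub>kk_group\<^esub> g = a \<otimes>\<^bsub>kk_group\<^esub> (\<alpha>, c + z, \<beta>)" for a z
    by (cases a) (simp add: kk_group_def g dotp_2)
  have "A_star m \<sigma> t #>\<^bsub>kk_group\<^esub> g = (\<Union>a\<in>A_sub m \<sigma> t. \<Union>z. {(a \<otimes>\<^bsub>kk_group\<^esub> (0, z, 0)) \<otimes>\<^bsub>kk_group\<^esub> g})"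
    by (auto simp: A_star_def r_coset_def set_mult_def)
  also have "\<dots> = (\<Union>z. A_sub m \<sigma> t #>\<^bsub>kk_group\<^esub> (\<alpha>, c + z, \<beta>))"
    unfolding shift by (auto simp: r_coset_def)
  also have "\<dots> = sfib t (fst (linv t g))"
  proof safe
    fix \<alpha>' c' \<beta>' assume x: "(\<alpha>', c', \<beta>') \<in> sfib t (fst (linv t g))"
    have "(\<alpha>', c', \<beta>') \<in> fib t (linv t (\<alpha>, c + (snd (linv t (\<alpha>', c', \<beta>')) - snd (linv t g)), \<beta>))"
      using x by (cases t) (auto simp: fib_def sfib_def g)
    then show "(\<alpha>', c', \<beta>') \<in> (\<Union>z. A_sub m \<sigma> t #>\<^bsub>kk_group\<^esub> (\<alpha>, c + z, \<beta>))"
      unfolding A_sub_coset by blast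
  qed (cases t; auto simp: A_sub_coset fib_def sfib_def g)
  finally show ?thesis .
qed

lemma surj_linv: "surj (linv t)"
proof -
  have "\<exists>g. linv t g = (u, d)" for u d
  proof (cases t)
    case None
    then show ?thesis by (intro exI[of _ "(u, d, 0)"]) (simp add: dotp_2)
  next
    case (Some t')
    then show ?thesis by (intro exI[of _ "(0, d, u)"]) (simp add: dotp_2 vec2_eq_iff)
  qed
  then show ?thesis by (auto simp: surj_def) metis
qed

lemma obtain_linv: obtains g where "p = linv t g"
  using surj_linv by (metis surjD)

text \<open>As \<open>linv t\<close> is onto, cosets may be indexed by their invariants instead of
  by representatives.\<close>

lemma collect_linv: "{f t (linv t g) | t g. True} = {f t p | t p. True}"
proof (intro equalityI subsetI)
  fix x assume "x \<in> {f t p | t p. True}"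
  then obtain t p where x: "x = f t p" by auto
  obtain g where "p = linv t g" by (rule obtain_linv)
  with x show "x \<in> {f t (linv t g) | t g. True}" by blast
qed blast

lemma collect_fst_linv: "{f t (fst (linv t g)) | t g. True} = {f t u | t u. True}"
proof -
  have "{f t (fst (linv t g)) | t g. True} = {f t (fst p) | t (p :: ('a^2) \<times> 'a). True}"
    by (rule collect_linv[where f = "\<lambda>t p. f t (fst p)"])
  also have "\<dots> = {f t u | t u. True}" by (auto simp: split_paired_Ex)
  finally show ?thesis .
qed

text \<open>Multiply g on the left by the element of A(t) with parameter e = (1, 0). Its
  A*(t')-invariant changes by e if one of t, t' is infinite, and by e (K_t - K_t') otherwise. In
  this way t is recovered from a bare coset, which does not record it.\<close>

lemma linv_separate:
  assumes "t \<noteq> t'"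
  obtains h where "linv t h = linv t g" "fst (linv t' h) \<noteq> fst (linv t' g)"
proof -
  obtain \<alpha> c \<beta> where g: "g = (\<alpha>, c, \<beta>)" by (cases g)
  define e :: "'a^2" where "e = vector [1, 0]"
  have e: "e$1 = 1" "e$2 = 0" by (simp_all add: e_def)
  show ?thesis
  proof (cases t)
    case None
    then show ?thesis
      using that[of "(\<alpha>, c + \<alpha>$1, \<beta> + e)"] assms
      by (cases t') (auto simp: g e dotp_2 vec2_eq_iff algebra_simps)
  next
    case (Some s)
    then have "linv t (\<alpha> + e, c + s + 2 * s * \<alpha>$1, \<beta> + e v* K s) = linv t g"
      by (auto simp: g e dotp_2 vec2_eq_iff algebra_simps)
    moreover have "fst (linv t' (\<alpha> + e, c + s + 2 * s * \<alpha>$1, \<beta> + e v* K s)) \<noteq> fst (linv t' g)"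
      using assms Some by (cases t') (auto simp: g e vec2_eq_iff algebra_simps)
    ultimately show ?thesis by (rule that)
  qed
qed

lemma fib_eq_iff [simp]: "fib t p = fib t' p' \<longleftrightarrow> t = t' \<and> p = p'"
proof
  assume eq: "fib t p = fib t' p'"
  obtain g where g: "p = linv t g" by (rule obtain_linv)
  then have "linv t' g = p'" using eq by (auto simp: fib_def)
  moreover have "t = t'"
  proof (rule ccontr)
    assume "t \<noteq> t'"
    then obtain h where h: "linv t h = linv t g" "fst (linv t' h) \<noteq> fst (linv t' g)"
      by (rule linv_separate)
    then have "h \<in> fib t' p'" using eq g by (auto simp: fib_def)
    then show False using h \<open>linv t' g = p'\<close> by (auto simp: fib_def)
  qed
  ultimately show "t = t' \<and> p = p'" using g by simp
qed auto

lemma fib_subset_sfib_iff [simp]: "fib t p \<subseteq> sfib t' u \<longleftrightarrow> t = t' \<and> fst p = u"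
proof
  assume sub: "fib t p \<subseteq> sfib t' u"
  obtain g where g: "p = linv t g" by (rule obtain_linv)
  then have "fst (linv t' g) = u" using sub by (auto simp: fib_def sfib_def)
  moreover have "t = t'"
  proof (rule ccontr)
    assume "t \<noteq> t'"
    then obtain h where h: "linv t h = linv t g" "fst (linv t' h) \<noteq> fst (linv t' g)"
      by (rule linv_separate)
    then have "h \<in> sfib t' u" using sub g by (auto simp: fib_def)
    then show False using h \<open>fst (linv t' g) = u\<close> by (auto simp: sfib_def)
  qed
  ultimately show "t = t' \<and> fst p = u" using g by simp
qed (auto simp: fib_def sfib_def)

lemma sfib_eq_iff [simp]: "sfib t u = sfib t' u' \<longleftrightarrow> t = t' \<and> u = u'"
proof
  assume eq: "sfib t u = sfib t' u'"
  have "fib t (u, 0) \<subseteq> sfib t u" by simp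
  then have "fib t (u, 0) \<subseteq> sfib t' u'" by (simp only: eq)
  then show "t = t' \<and> u = u'" unfolding fib_subset_sfib_iff by simp
qed auto

lemma S_eq:
  "S = \<lparr>Points = {Coset (fib t (linv t g)) | t g. True} \<union> range Symb,
        Lines = range Elem \<union> {Star_Coset (sfib t (fst (linv t g))) | t g. True} \<union> {Infinity},
        Inc = ({(Infinity, Symb t) | t. True} \<union>
        {(Star_Coset (sfib t (fst (linv t g))), Symb t) | t g. True} \<union>
        {(Star_Coset (sfib t (fst (linv t g))), Coset (fib t (linv t h))) | t g h.
           fib t (linv t h) \<subseteq> sfib t (fst (linv t g))} \<union>
        {(Elem g, Coset (fib t (linv t g))) | t g. True})\<inverse>\<rparr>"
  unfolding kantor_knuth_def dual_def flock_quadrangle_def A_sub_coset A_star_coset by simp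

lemma Points_S: "Points S = range Symb \<union> {Coset (fib t p) | t p. True}"
  unfolding S_eq collect_linv[where f = "\<lambda>t p. Coset (fib t p)"] by auto

lemma Lines_S: "Lines S = range Elem \<union> {Star_Coset (sfib t u) | t u. True} \<union> {Infinity}"
  unfolding S_eq collect_fst_linv[where f = "\<lambda>t u. Star_Coset (sfib t u)"] by auto

lemma Points_S_cases [consumes 1, case_names Symb Coset]:
  assumes "x \<in> Points S"
  obtains t where "x = Symb t" | t p where "x = Coset (fib t p)"
  using assms by (auto simp: Points_S)

lemma Lines_S_cases [consumes 1, case_names Elem Star Infinity]:
  assumes "L \<in> Lines S"
  obtains g where "L = Elem g" | t u where "L = Star_Coset (sfib t u)" | "L = Infinity"
  using assms by (auto simp: Lines_S)

lemma in_S [simp]: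
  "Symb t \<in> Points S" "Coset (fib t p) \<in> Points S"
  "Elem g \<in> Lines S" "Star_Coset (sfib t u) \<in> Lines S" "Infinity \<in> Lines S"
  by (auto simp: Points_S Lines_S)

lemma Inc_S_eq:
  "(Inc S)\<inverse> = {(Infinity, Symb t) | t. True} \<union> {(Star_Coset (sfib t u), Symb t) | t u. True} \<union>
     {(Star_Coset (sfib t (fst p)), Coset (fib t p)) | t p. True} \<union>
     {(Elem g, Coset (fib t (linv t g))) | t g. True}"
proof -
  have "{(Star_Coset (sfib t (fst (linv t g))), Coset (fib t (linv t h))) | t g h.
           fib t (linv t h) \<subseteq> sfib t (fst (linv t g))} =
        {(Star_Coset (sfib t (fst (linv t h))), Coset (fib t (linv t h))) | t h. True}"
    unfolding fib_subset_sfib_iff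
  proof (intro equalityI subsetI; elim CollectE exE conjE)
    fix x t g h
    assume "x = (Star_Coset (sfib t (fst (linv t g))), Coset (fib t (linv t h)))"
      "fst (linv t h) = fst (linv t g)"
    then show "x \<in> {(Star_Coset (sfib t (fst (linv t h))), Coset (fib t (linv t h))) | t h. True}"
      by (intro CollectI exI[of _ t] exI[of _ h]) simp
  qed blast
  also have "\<dots> = {(Star_Coset (sfib t (fst p)), Coset (fib t p)) | t p. True}"
    by (rule collect_linv)
  finally show ?thesis
    unfolding S_eq collect_fst_linv[where f = "\<lambda>t u. (Star_Coset (sfib t u), Symb t)"] by simp
qed

lemma Inc_S_iff:
  "(x, L) \<in> Inc S \<longleftrightarrow> (\<exists>t. x = Symb t \<and> L = Infinity) \<or> (\<exists>t u. x = Symb t \<and> L = Star_Coset (sfib t u)) \<or>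
     (\<exists>t p. x = Coset (fib t p) \<and> L = Star_Coset (sfib t (fst p))) \<or>
     (\<exists>t g. x = Coset (fib t (linv t g)) \<and> L = Elem g)"
proof -
  have "(x, L) \<in> Inc S \<longleftrightarrow> (L, x) \<in> (Inc S)\<inverse>" by simp
  then show ?thesis unfolding Inc_S_eq by auto
qed

lemma Inc_S [simp]:
  "(Symb t, Infinity) \<in> Inc S"
  "(Symb t, Elem g) \<notin> Inc S"
  "(Symb t, Star_Coset (sfib t' u)) \<in> Inc S \<longleftrightarrow> t = t'"
  "(Coset (fib t p), Infinity) \<notin> Inc S"
  "(Coset (fib t p), Star_Coset (sfib t' u)) \<in> Inc S \<longleftrightarrow> t = t' \<and> fst p = u"
  "(Coset (fib t p), Elem g) \<in> Inc S \<longleftrightarrow> linv t g = p"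
  by (auto simp: Inc_S_iff)

section \<open>Automorphisms of the Kantor-Knuth quadrangle\<close>

definition point_map :: "('a option \<Rightarrow> 'a option) \<Rightarrow> ('a kk_elem \<Rightarrow> 'a kk_elem) \<Rightarrow> 'a egq_line \<Rightarrow> 'a egq_line" where
  "point_map \<pi> \<phi> x = (case x of Symb t \<Rightarrow> Symb (\<pi> t) | Coset C \<Rightarrow> Coset (\<phi> ` C))"

definition line_map :: "('a kk_elem \<Rightarrow> 'a kk_elem) \<Rightarrow> 'a egq_point \<Rightarrow> 'a egq_point" where
  "line_map \<phi> L = (case L of Elem g \<Rightarrow> Elem (\<phi> g) | Star_Coset C \<Rightarrow> Star_Coset (\<phi> ` C) | Infinity \<Rightarrow> Infinity)"

text \<open>
  A permutation \<open>\<phi>\<close> of \<open>G\<close> which maps each coset of \<open>A(t)\<close> or \<open>A\<^sup>*(t)\<close> to one of \<open>A(\<pi> t)\<close> or \<open>A\<^sup>*(\<pi> t)\<close>;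
  by finiteness no condition on the inverse is needed.
\<close>

definition compat :: "('a option \<Rightarrow> 'a option) \<Rightarrow> ('a kk_elem \<Rightarrow> 'a kk_elem) \<Rightarrow> bool" where
  "compat \<pi> \<phi> \<longleftrightarrow> bij \<pi> \<and> bij \<phi> \<and>
     (\<forall>t. \<exists>\<mu>. \<forall>g. linv (\<pi> t) (\<phi> g) = \<mu> (linv t g)) \<and>
     (\<forall>t. \<exists>\<nu>. \<forall>g. fst (linv (\<pi> t) (\<phi> g)) = \<nu> (fst (linv t g)))"

text \<open>The maps \<mu> and \<nu> induced on the invariants are onto because \<phi> is, and a
  surjection of a finite type to itself is injective.\<close>

lemma compatD:
  assumes "compat \<pi> \<phi>"
  shows "linv (\<pi> t) (\<phi> g) = linv (\<pi> t) (\<phi> h) \<longleftrightarrow> linv t g = linv t h" (is ?A)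
    and "fst (linv (\<pi> t) (\<phi> g)) = fst (linv (\<pi> t) (\<phi> h)) \<longleftrightarrow> fst (linv t g) = fst (linv t h)" (is ?B)
proof -
  have surj: "\<exists>g. linv (\<pi> t) (\<phi> g) = p" for p
  proof -
    obtain g where "p = linv (\<pi> t) g" by (rule obtain_linv)
    moreover obtain h where "g = \<phi> h" using assms unfolding compat_def bij_def surj_def by blast
    ultimately show ?thesis by auto
  qed
  obtain \<mu> where \<mu>: "\<And>g. linv (\<pi> t) (\<phi> g) = \<mu> (linv t g)" using assms unfolding compat_def by blast
  have "surj \<mu>" using surj \<mu> by (auto simp: surj_def) metis
  then have "inj \<mu>" by (rule finite_UNIV_surj_inj[OF finite])
  then show ?A using \<mu> by (auto simp: inj_eq)
  obtain \<nu> where \<nu>: "\<And>g. fst (linv (\<pi> t) (\<phi> g)) = \<nu> (fst (linv t g))" using assms unfolding compat_def by blast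
  have "surj \<nu>"
    unfolding surj_def
  proof
    fix u
    obtain g where "linv (\<pi> t) (\<phi> g) = (u, 0)" using surj by blast
    then have "u = \<nu> (fst (linv t g))" using \<nu>[of g] by simp
    then show "\<exists>x. u = \<nu> x" by blast
  qed
  then have "inj \<nu>" by (rule finite_UNIV_surj_inj[OF finite])
  then show ?B using \<nu> by (auto simp: inj_eq)
qed

lemma image_fib:
  assumes c: "compat \<pi> \<phi>"
  shows "\<phi> ` fib t (linv t g) = fib (\<pi> t) (linv (\<pi> t) (\<phi> g))"
    and "\<phi> ` sfib t (fst (linv t g)) = sfib (\<pi> t) (fst (linv (\<pi> t) (\<phi> g)))"
proof -
  have surj: "\<exists>x. h = \<phi> x" for h using c by (auto simp: compat_def bij_def surj_def)
  show "\<phi> ` fib t (linv t g) = fib (\<pi> t) (linv (\<pi> t) (\<phi> g))"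
  proof (intro equalityI subsetI)
    fix h assume h: "h \<in> fib (\<pi> t) (linv (\<pi> t) (\<phi> g))"
    obtain x where x: "h = \<phi> x" using surj by blast
    then have "linv t x = linv t g" using h compatD[OF c] by (simp add: fib_def)
    then show "h \<in> \<phi> ` fib t (linv t g)" using x by (auto simp: fib_def)
  qed (auto simp: fib_def compatD[OF c])
  show "\<phi> ` sfib t (fst (linv t g)) = sfib (\<pi> t) (fst (linv (\<pi> t) (\<phi> g)))"
  proof (intro equalityI subsetI)
    fix h assume h: "h \<in> sfib (\<pi> t) (fst (linv (\<pi> t) (\<phi> g)))"
    obtain x where x: "h = \<phi> x" using surj by blast
    then have "fst (linv t x) = fst (linv t g)" using h compatD[OF c] by (simp add: sfib_def)
    then show "h \<in> \<phi> ` sfib t (fst (linv t g))" using x by (auto simp: sfib_def)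
  qed (auto simp: sfib_def compatD[OF c])
qed

lemma maps_simps [simp]:
  "point_map \<pi> \<phi> (Symb t) = Symb (\<pi> t)"
  "line_map \<phi> (Elem g) = Elem (\<phi> g)" "line_map \<phi> Infinity = Infinity"
  by (simp_all add: point_map_def line_map_def)

lemma point_map_fib:
  "compat \<pi> \<phi> \<Longrightarrow> point_map \<pi> \<phi> (Coset (fib t (linv t g))) = Coset (fib (\<pi> t) (linv (\<pi> t) (\<phi> g)))"
  "compat \<pi> \<phi> \<Longrightarrow> line_map \<phi> (Star_Coset (sfib t (fst (linv t g)))) =
     Star_Coset (sfib (\<pi> t) (fst (linv (\<pi> t) (\<phi> g))))"
  by (simp_all add: point_map_def line_map_def image_fib)

lemma obtain_fst_linv: obtains g where "u = fst (linv t g)"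
  using obtain_linv[of "(u, 0)" t] by (metis fst_conv)

lemma automorphism_compat:
  assumes c: "compat \<pi> \<phi>"
  shows "automorphism S (point_map \<pi> \<phi>) (line_map \<phi>)"
proof -
  have bij: "inj \<pi>" "surj \<pi>" "inj \<phi>" "surj \<phi>" using c by (auto simp: compat_def bij_def)
  have inj: "inj_on (point_map \<pi> \<phi>) (Points S)"
    using bij by (auto simp: inj_on_def Points_S point_map_def inj_image_eq_iff)
  have linj: "inj_on (line_map \<phi>) (Lines S)"
    using bij by (auto simp: Lines_S line_map_def inj_image_eq_iff inj_eq intro!: inj_onI)
  have im: "point_map \<pi> \<phi> x \<in> Points S" if "x \<in> Points S" for x
    using that
  proof (cases rule: Points_S_cases)
    case (Coset t p)
    obtain g where "p = linv t g" by (rule obtain_linv)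
    then show ?thesis using Coset point_map_fib[OF c] by simp
  qed simp
  have lim: "line_map \<phi> L \<in> Lines S" if "L \<in> Lines S" for L
    using that
  proof (cases rule: Lines_S_cases)
    case (Star t u)
    obtain g where "u = fst (linv t g)" by (rule obtain_fst_linv)
    then show ?thesis using Star point_map_fib[OF c] by simp
  qed simp_all
  have surj: "x \<in> point_map \<pi> \<phi> ` Points S" if "x \<in> Points S" for x
    using that
  proof (cases rule: Points_S_cases)
    case (Symb t)
    obtain t' where "t = \<pi> t'" using bij by (auto simp: surj_def)
    then have "x = point_map \<pi> \<phi> (Symb t')" using Symb by simp
    then show ?thesis by (rule image_eqI) simp
  next
    case (Coset t p)
    obtain t' where t: "t = \<pi> t'" using bij by (auto simp: surj_def)
    obtain h where "p = linv t h" by (rule obtain_linv)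
    moreover obtain g where "h = \<phi> g" using bij unfolding surj_def by blast
    ultimately have "x = point_map \<pi> \<phi> (Coset (fib t' (linv t' g)))"
      using Coset t point_map_fib[OF c] by simp
    then show ?thesis by (rule image_eqI) simp
  qed
  have lsurj: "L \<in> line_map \<phi> ` Lines S" if "L \<in> Lines S" for L
    using that
  proof (cases rule: Lines_S_cases)
    case (Elem h)
    obtain g where "h = \<phi> g" using bij unfolding surj_def by blast
    then have "L = line_map \<phi> (Elem g)" using Elem by simp
    then show ?thesis by (rule image_eqI) simp
  next
    case (Star t u)
    obtain t' where t: "t = \<pi> t'" using bij by (auto simp: surj_def)
    obtain h where "u = fst (linv t h)" by (rule obtain_fst_linv)
    moreover obtain g where "h = \<phi> g" using bij unfolding surj_def by blast
    ultimately have "L = line_map \<phi> (Star_Coset (sfib t' (fst (linv t' g))))"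
      using Star t point_map_fib[OF c] by simp
    then show ?thesis by (rule image_eqI) simp
  next
    case Infinity
    then have "L = line_map \<phi> Infinity" by simp
    then show ?thesis by (rule image_eqI) simp
  qed
  have "(point_map \<pi> \<phi> x, line_map \<phi> L) \<in> Inc S \<longleftrightarrow> (x, L) \<in> Inc S"
    if x: "x \<in> Points S" and L: "L \<in> Lines S" for x L
    using x
  proof (cases rule: Points_S_cases)
    case (Symb t)
    show ?thesis using L
    proof (cases rule: Lines_S_cases)
      case (Star t' u)
      obtain g where "u = fst (linv t' g)" by (rule obtain_fst_linv)
      then show ?thesis using Star Symb point_map_fib[OF c] bij by (simp add: inj_eq)
    qed (simp_all add: Symb)
  next
    case (Coset t p)
    obtain g where g: "p = linv t g" by (rule obtain_linv)
    note x = Coset[unfolded g]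
    show ?thesis using L
    proof (cases rule: Lines_S_cases)
      case (Elem h)
      then show ?thesis using x point_map_fib[OF c] compatD[OF c] by simp
    next
      case (Star t' u)
      obtain h where h: "u = fst (linv t' h)" by (rule obtain_fst_linv)
      show ?thesis unfolding x Star h point_map_fib[OF c] Inc_S
        using bij compatD(2)[OF c, of t' g h] by (cases "t = t'") (simp_all add: inj_eq)
    next
      case Infinity
      then show ?thesis using x point_map_fib[OF c] by simp
    qed
  qed
  then show ?thesis
    unfolding isomorphism_def bij_betw_def using inj linj im lim surj lsurj by blast
qed

text \<open>Everything incident with elements of E, together with [\<infinity>] and all symbols.
  With subquadrangles encoded in this way, equality and the action of automorphisms are reduced to
  sets of group elements.\<close>

definition geom :: "'a kk_elem set \<Rightarrow> ('a egq_line, 'a egq_point) geometry" where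
  "geom E = (let P = range Symb \<union> {Coset (fib t (linv t g)) | t g. g \<in> E};
                 B = insert Infinity (Elem ` E \<union> {Star_Coset (sfib t (fst (linv t g))) | t g. g \<in> E})
             in \<lparr>Points = P, Lines = B, Inc = Inc S \<inter> P \<times> B\<rparr>)"

lemma geom_sel:
  "Points (geom E) = range Symb \<union> {Coset (fib t (linv t g)) | t g. g \<in> E}"
  "Lines (geom E) = insert Infinity (Elem ` E \<union> {Star_Coset (sfib t (fst (linv t g))) | t g. g \<in> E})"
  by (simp_all add: geom_def Let_def)

lemma subgeometry_geom: "subgeometry (geom E) S"
  unfolding subgeometry_def geom_sel by (auto simp: geom_def Let_def)

lemma geom_eq_iff: "geom E = geom E' \<longleftrightarrow> E = E'"
proof
  assume "geom E = geom E'"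
  then have "{g. Elem g \<in> Lines (geom E)} = {g. Elem g \<in> Lines (geom E')}" by simp
  then show "E = E'" by (auto simp: geom_sel)
qed simp

lemma image_geom:
  assumes c: "compat \<pi> \<phi>"
  shows "image_geometry (point_map \<pi> \<phi>) (line_map \<phi>) (geom E) = geom (\<phi> ` E)"
proof (rule subgeometry_eqI[OF subgeometry_image(1)[OF automorphism_compat[OF c] subgeometry_geom] subgeometry_geom])
  have surj: "\<exists>t'. t = \<pi> t'" for t using c by (auto simp: compat_def bij_def surj_def)
  then have 1: "range (\<lambda>t. Symb (\<pi> t)) = range Symb"
    by (auto simp: image_iff)
  have 2: "point_map \<pi> \<phi> ` {Coset (fib t (linv t g)) | t g. g \<in> E} =
      {Coset (fib t (linv t g)) | t g. g \<in> \<phi> ` E}"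
  proof (intro equalityI subsetI)
    fix x assume "x \<in> {Coset (fib t (linv t g)) | t g. g \<in> \<phi> ` E}"
    then obtain t g where x: "x = Coset (fib t (linv t (\<phi> g)))" "g \<in> E" by auto
    obtain t' where "t = \<pi> t'" using surj by blast
    then have "x = point_map \<pi> \<phi> (Coset (fib t' (linv t' g)))" using x point_map_fib[OF c] by simp
    then show "x \<in> point_map \<pi> \<phi> ` {Coset (fib t (linv t g)) | t g. g \<in> E}" using x by blast
  next
    fix x assume "x \<in> point_map \<pi> \<phi> ` {Coset (fib t (linv t g)) | t g. g \<in> E}"
    then obtain t g where "x = point_map \<pi> \<phi> (Coset (fib t (linv t g)))" "g \<in> E" by blast
    then show "x \<in> {Coset (fib t (linv t g)) | t g. g \<in> \<phi> ` E}"
      unfolding point_map_fib[OF c] by blast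
  qed
  have 3: "line_map \<phi> ` {Star_Coset (sfib t (fst (linv t g))) | t g. g \<in> E} =
      {Star_Coset (sfib t (fst (linv t g))) | t g. g \<in> \<phi> ` E}"
  proof (intro equalityI subsetI)
    fix x assume "x \<in> {Star_Coset (sfib t (fst (linv t g))) | t g. g \<in> \<phi> ` E}"
    then obtain t g where x: "x = Star_Coset (sfib t (fst (linv t (\<phi> g))))" "g \<in> E" by auto
    obtain t' where "t = \<pi> t'" using surj by blast
    then have "x = line_map \<phi> (Star_Coset (sfib t' (fst (linv t' g))))" using x point_map_fib[OF c] by simp
    then show "x \<in> line_map \<phi> ` {Star_Coset (sfib t (fst (linv t g))) | t g. g \<in> E}" using x by blast
  next
    fix x assume "x \<in> line_map \<phi> ` {Star_Coset (sfib t (fst (linv t g))) | t g. g \<in> E}"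
    then obtain t g where "x = line_map \<phi> (Star_Coset (sfib t (fst (linv t g))))" "g \<in> E" by blast
    then show "x \<in> {Star_Coset (sfib t (fst (linv t g))) | t g. g \<in> \<phi> ` E}"
      unfolding point_map_fib[OF c] by blast
  qed
  show "Points (image_geometry (point_map \<pi> \<phi>) (line_map \<phi>) (geom E)) = Points (geom (\<phi> ` E))"
    unfolding geom_sel 2[symmetric] 1[symmetric] by (auto simp: image_geometry_def geom_sel image_Un image_image)
  show "Lines (image_geometry (point_map \<pi> \<phi>) (line_map \<phi>) (geom E)) = Lines (geom (\<phi> ` E))"
    unfolding geom_sel 3[symmetric] by (auto simp: image_geometry_def geom_sel image_Un image_image)
qed

section \<open>Right multiplications and automorphisms of G as automorphisms of the
  quadrangle\<close>

definition transl :: "'a kk_elem \<Rightarrow> 'a kk_elem \<Rightarrow> 'a kk_elem" where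
  "transl g0 g = g \<otimes>\<^bsub>kk_group\<^esub> g0"

lemma transl_simp [simp]:
  "transl (\<alpha>0, c0, \<beta>0) (\<alpha>, c, \<beta>) = (\<alpha> + \<alpha>0, c + c0 + dotp \<beta> \<alpha>0, \<beta> + \<beta>0)"
  by (simp add: transl_def kk_group_def)

text \<open>Right multiplication permutes the right cosets of every subgroup, so it acts trivially
  on t; the formulas below make the induced maps on the invariants explicit.\<close>

lemma compat_transl: "compat id (transl g0)"
proof -
  obtain \<alpha>0 c0 \<beta>0 where g0: "g0 = (\<alpha>0, c0, \<beta>0)" by (cases g0)
  have "inj (transl g0)"
    by (auto simp: inj_def g0 split_paired_All)
  then have "bij (transl g0)"
    by (simp add: bij_def finite_UNIV_inj_surj)
  moreover have "\<exists>\<mu>. \<forall>g. linv t (transl g0 g) = \<mu> (linv t g)" for t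
  proof (cases t)
    case None
    have "linv t (transl g0 g) = (\<lambda>(u, d). (u + \<alpha>0, d + c0 - dotp \<beta>0 (u + \<alpha>0))) (linv t g)" for g
      by (cases g) (simp add: None g0 dotp_2 algebra_simps)
    then show ?thesis by blast
  next
    case (Some s)
    have "linv t (transl g0 g) = (\<lambda>(u, d). (u + \<beta>0 - \<alpha>0 v* K s, d + c0 + dotp u \<alpha>0 - dotp (\<alpha>0 v* A s) \<alpha>0)) (linv t g)" for g
      by (cases g) (simp add: Some g0 dotp_2 algebra_simps vec2_eq_iff)
    then show ?thesis by blast
  qed
  moreover have "\<exists>\<nu>. \<forall>g. fst (linv t (transl g0 g)) = \<nu> (fst (linv t g))" for t
  proof (cases t)
    case None
    have "fst (linv t (transl g0 g)) = (\<lambda>u. u + \<alpha>0) (fst (linv t g))" for g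
      by (cases g) (simp add: None g0)
    then show ?thesis by (intro exI[of _ "\<lambda>u. u + \<alpha>0"]) simp
  next
    case (Some s)
    have "fst (linv t (transl g0 g)) = (\<lambda>u. u + \<beta>0 - \<alpha>0 v* K s) (fst (linv t g))" for g
      by (cases g) (simp add: Some g0 algebra_simps vec2_eq_iff)
    then show ?thesis by (intro exI[of _ "\<lambda>u. u + \<beta>0 - \<alpha>0 v* K s"]) simp
  qed
  ultimately show ?thesis by (simp add: compat_def)
qed

text \<open>As t \<mapsto> A_t is additive, this automorphism of G fixes A(\<infinity>) elementwise
  and maps A(t) onto A(t + s).\<close>

definition shift :: "'a \<Rightarrow> 'a kk_elem \<Rightarrow> 'a kk_elem" where
  "shift s g = (case g of (\<alpha>, c, \<beta>) \<Rightarrow> (\<alpha>, c + dotp (\<alpha> v* A s) \<alpha>, \<beta> + \<alpha> v* K s))"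

lemma compat_shift: "compat (map_option (\<lambda>t. t + s)) (shift s)"
proof -
  have "inj (shift s)"
    by (auto simp: inj_def shift_def split_paired_All)
  then have "bij (shift s)"
    by (simp add: bij_def finite_UNIV_inj_surj)
  moreover have "inj (map_option (\<lambda>t. t + s))"
    by (intro option.inj_map injI) simp
  then have "bij (map_option (\<lambda>t. t + s))"
    by (simp add: bij_def finite_UNIV_inj_surj)
  moreover have 0: "linv (Some (t + s)) (shift s g) = linv (Some t) g" for t g
    by (cases g) (simp add: shift_def dotp_2 algebra_simps vec2_eq_iff)
  moreover have 1: "linv None (shift s g) = (\<lambda>(u, d). (u, d - dotp (u v* A s) u)) (linv None g)" for g
    by (cases g) (simp add: shift_def dotp_2 algebra_simps vec2_eq_iff)
  have "\<exists>\<mu>. \<forall>g. linv (map_option (\<lambda>t. t + s) t) (shift s g) = \<mu> (linv t g)" for t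
  proof (cases t)
    case None
    then show ?thesis using 1 by auto
  next
    case (Some a)
    then show ?thesis using 0 by auto
  qed
  moreover have 2: "fst (linv None (shift s g)) = fst (linv None g)" for g
    by (cases g) (simp add: shift_def)
  have "\<exists>\<nu>. \<forall>g. fst (linv (map_option (\<lambda>t. t + s) t) (shift s g)) = \<nu> (fst (linv t g))" for t
  proof (cases t)
    case None
    then show ?thesis using 2 by auto
  next
    case (Some a)
    then show ?thesis using 0 by auto
  qed
  ultimately show ?thesis by (simp add: compat_def)
qed

lemma four_neq_0 [simp]: "(4::'a) \<noteq> 0"
proof -
  have "(4::'a) = 2 * 2" by simp
  then show ?thesis using two_neq_0 by (metis mult_eq_0_iff)
qed

definition swap_t :: "'a option \<Rightarrow> 'a option" where
  "swap_t t = (case t of None \<Rightarrow> Some 0 | Some t \<Rightarrow> if t = 0 then None else Some (inverse t))"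

text \<open>An automorphism of G which exchanges the roles of \<alpha> and \<beta>; replacing c by
  \<beta>\<alpha>^T - c makes up for the reversed cocycle. The scalings by 2 and m are chosen such
  that A(t) goes to A(1/t) for nonzero t.\<close>

definition swap :: "'a kk_elem \<Rightarrow> 'a kk_elem" where
  "swap g = (case g of (\<alpha>, c, \<beta>) \<Rightarrow>
     (vector [\<beta>$1 / 2, \<beta>$2 / (2 * m)], dotp \<beta> \<alpha> - c, vector [2 * \<alpha>$1, 2 * m * \<alpha>$2]))"

lemma compat_swap: "compat swap_t swap"
proof -
  have "inj swap"
    by (auto simp: inj_def swap_def split_paired_All vec2_eq_iff dotp_2)
  then have "bij swap"
    by (simp add: bij_def finite_UNIV_inj_surj)
  moreover have "inj swap_t"
    by (auto simp: inj_def swap_t_def split: option.splits if_splits)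
  then have "bij swap_t"
    by (simp add: bij_def finite_UNIV_inj_surj)
  moreover have *: "linv None (swap g) = (\<lambda>(u, d). (vector [u$1 / 2, u$2 / (2 * m)], - d)) (linv (Some 0) g)"
    "linv (Some 0) (swap g) = (\<lambda>(u, d). (vector [2 * u$1, 2 * m * u$2], - d)) (linv None g)" for g
    by (cases g; simp add: swap_def dotp_2 vec2_eq_iff)+
  have fst_inv: "fst (linv (Some (inverse t)) (swap g)) =
      (\<lambda>u. vector [- u$1 / t, u$2 / \<sigma> t]) (fst (linv (Some t) g))" if "t \<noteq> 0" for t g
    using that by (cases g) (simp add: swap_def vec2_eq_iff field_simps)
  \<comment> \<open>After substituting \<beta> = u + \<alpha>K_t all terms in \<alpha> cancel; the
    quadratic form in u is what completing the square leaves.\<close>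
  have snd_inv: "snd (linv (Some (inverse t)) (swap g)) =
      (\<lambda>(u, d). - d - (u$1)^2 / (4 * t) + (u$2)^2 / (4 * m * \<sigma> t)) (linv (Some t) g)" if "t \<noteq> 0" for t g
    using that by (cases g) (simp add: swap_def dotp_2 power2_eq_square field_simps)
  have "\<exists>\<mu>. \<forall>g. linv (swap_t t) (swap g) = \<mu> (linv t g)" for t
  proof (cases t)
    case None
    then show ?thesis using * by (auto simp: swap_t_def)
  next
    case (Some a)
    show ?thesis
    proof (cases "a = 0")
      case True
      then show ?thesis using * Some by (auto simp: swap_t_def)
    next
      case False
      then have "linv (swap_t t) (swap g) = (\<lambda>p. ((\<lambda>u. vector [- u$1 / a, u$2 / \<sigma> a]) (fst p),
         (\<lambda>(u, d). - d - (u$1)^2 / (4 * a) + (u$2)^2 / (4 * m * \<sigma> a)) p)) (linv t g)" for g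
        using fst_inv[OF False, of g] snd_inv[OF False, of g] Some
        by (simp add: swap_t_def prod_eq_iff)
      then show ?thesis
        by (intro exI[of _ "\<lambda>p. ((\<lambda>u. vector [- u$1 / a, u$2 / \<sigma> a]) (fst p),
          (\<lambda>(u, d). - d - (u$1)^2 / (4 * a) + (u$2)^2 / (4 * m * \<sigma> a)) p)"]) simp
    qed
  qed
  moreover have "\<exists>\<nu>. \<forall>g. fst (linv (swap_t t) (swap g)) = \<nu> (fst (linv t g))" for t
  proof (cases t)
    case None
    have "fst (linv (Some 0) (swap g)) = (\<lambda>u. vector [2 * u$1, 2 * m * u$2]) (fst (linv None g))" for g
      using *(2)[of g] by (simp add: case_prod_beta)
    then show ?thesis using None by (auto simp: swap_t_def)
  next
    case (Some a)
    have "fst (linv None (swap g)) = (\<lambda>u. vector [u$1 / 2, u$2 / (2 * m)]) (fst (linv (Some 0) g))" for g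
      using *(1)[of g] by (simp add: case_prod_beta)
    then show ?thesis using Some fst_inv by (cases "a = 0") (auto simp: swap_t_def)
  qed
  ultimately show ?thesis by (simp add: compat_def)
qed

text \<open>Multiplication of \<alpha>_1 + \<alpha>_2 sqrt(m) by u + v sqrt(m) in GF(q^2), and on
  \<beta> the contragredient map times the norm u^2 - m v^2. For \<sigma> = 1 the form
  \<alpha>A_t\<alpha>^T is t times the norm of \<alpha>, so every A(t) is preserved.\<close>

definition rot :: "'a \<Rightarrow> 'a \<Rightarrow> 'a kk_elem \<Rightarrow> 'a kk_elem" where
  "rot u v g = (case g of (\<alpha>, c, \<beta>) \<Rightarrow> (vector [u * \<alpha>$1 + m * v * \<alpha>$2, v * \<alpha>$1 + u * \<alpha>$2],
     (u^2 - m * v^2) * c, vector [u * \<beta>$1 - v * \<beta>$2, u * \<beta>$2 - m * v * \<beta>$1]))"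

lemma norm_neq_0:
  assumes "u \<noteq> 0 \<or> v \<noteq> 0"
  shows "u^2 - m * v^2 \<noteq> 0"
proof
  assume eq: "u^2 - m * v^2 = 0"
  then have "v \<noteq> 0" using assms by auto
  then have "m = (u / v)^2" using eq by (simp add: power_divide field_simps)
  then show False using nonsquare_m by simp
qed

lemma compat_rot:
  assumes "\<sigma> = id" "u \<noteq> 0 \<or> v \<noteq> 0"
  shows "compat id (rot u v)"
proof -
  have id: "\<sigma> x = x" for x using assms(1) by simp
  note N = norm_neq_0[OF assms(2)]
  \<comment> \<open>Cramer's rule; the determinant of the system is the norm.\<close>
  have sol: "x = x' \<and> y = y'"
    if "u * x + m * v * y = u * x' + m * v * y'" "v * x + u * y = v * x' + u * y'" for x y x' y'
  proof -
    have "(u^2 - m * v^2) * (x - x') = u * (u * x + m * v * y - (u * x' + m * v * y')) - m * v * (v * x + u * y - (v * x' + u * y'))"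
      by (simp add: power2_eq_square algebra_simps)
    moreover have "(u^2 - m * v^2) * (y - y') = u * (v * x + u * y - (v * x' + u * y')) - v * (u * x + m * v * y - (u * x' + m * v * y'))"
      by (simp add: power2_eq_square algebra_simps)
    ultimately show ?thesis using that N by simp
  qed
  have "inj (rot u v)"
  proof (rule injI)
    fix g h assume eq: "rot u v g = rot u v h"
    obtain \<alpha> c \<beta> \<alpha>' c' \<beta>' where gh: "g = (\<alpha>, c, \<beta>)" "h = (\<alpha>', c', \<beta>')" by (cases g, cases h)
    have h: "u * \<alpha>$1 + m * v * \<alpha>$2 = u * \<alpha>'$1 + m * v * \<alpha>'$2" "v * \<alpha>$1 + u * \<alpha>$2 = v * \<alpha>'$1 + u * \<alpha>'$2"
      "u * \<beta>$1 - v * \<beta>$2 = u * \<beta>'$1 - v * \<beta>'$2" "u * \<beta>$2 - m * v * \<beta>$1 = u * \<beta>'$2 - m * v * \<beta>'$1"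
      using eq by (simp_all add: gh rot_def vec2_eq_iff)
    have "\<alpha>$1 = \<alpha>'$1 \<and> \<alpha>$2 = \<alpha>'$2"
      using h by (intro sol)
    \<comment> \<open>In the coordinates (-\<beta>_2, \<beta>_1) the map on \<beta> has the matrix
      of the map on \<alpha>.\<close>
    moreover have "- (\<beta>$2) = - (\<beta>'$2) \<and> \<beta>$1 = \<beta>'$1"
      using h by (intro sol) (simp_all add: algebra_simps)
    ultimately show "g = h" using eq N by (simp add: gh rot_def vec2_eq_iff)
  qed
  then have "bij (rot u v)"
    by (simp add: bij_def finite_UNIV_inj_surj)
  moreover have 1: "linv None (rot u v g) =
      (\<lambda>(x, d). (vector [u * x$1 + m * v * x$2, v * x$1 + u * x$2], (u^2 - m * v^2) * d)) (linv None g)" for g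
    by (cases g) (simp add: rot_def dotp_2 power2_eq_square algebra_simps)
  have 2: "linv (Some t) (rot u v g) =
      (\<lambda>(x, d). (vector [u * x$1 - v * x$2, u * x$2 - m * v * x$1], (u^2 - m * v^2) * d)) (linv (Some t) g)" for t g
    by (cases g) (simp add: rot_def dotp_2 power2_eq_square algebra_simps vec2_eq_iff id)
  have "\<exists>\<mu>. \<forall>g. linv t (rot u v g) = \<mu> (linv t g)" for t
    using 1 2 by (cases t) blast+
  moreover have "\<exists>\<nu>. \<forall>g. fst (linv t (rot u v g)) = \<nu> (fst (linv t g))" for t
  proof (cases t)
    case None
    have "fst (linv None (rot u v g)) = (\<lambda>x. vector [u * x$1 + m * v * x$2, v * x$1 + u * x$2]) (fst (linv None g))" for g
      using 1[of g] by (simp add: case_prod_beta)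
    then show ?thesis
      using None by (intro exI[of _ "\<lambda>x. vector [u * x$1 + m * v * x$2, v * x$1 + u * x$2]"]) simp
  next
    case (Some s)
    have "fst (linv (Some s) (rot u v g)) = (\<lambda>x. vector [u * x$1 - v * x$2, u * x$2 - m * v * x$1]) (fst (linv (Some s) g))" for g
      using 2[of s g] by (simp add: case_prod_beta)
    then show ?thesis
      using Some by (intro exI[of _ "\<lambda>x. vector [u * x$1 - v * x$2, u * x$2 - m * v * x$1]"]) simp
  qed
  ultimately show ?thesis by (simp add: compat_def)
qed

lemma CARD_ge_3: "CARD('a) \<ge> 3"
proof -
  have "card {0::'a, 1} \<le> CARD('a)" by (intro card_mono) auto
  then have "CARD('a) \<ge> 2" by simp
  then show ?thesis using odd_CARD by (cases "CARD('a) = 2") auto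
qed

lemma CARD_option: "CARD('a option) = CARD('a) + 1"
  by (simp add: UNIV_option_conv card_image)

lemma CARD_vec2: "CARD('a^2) = CARD('a) * CARD('a)"
  by (simp add: power2_eq_square)

section \<open>Classification of the subquadrangles of order \<open>q\<close>\<close>

text \<open>Graph of a \<sigma>-semilinear map of slope k, with \<open>None\<close> for the second
  axis. Each nonzero vector lies in exactly one of these sets.\<close>

definition inW :: "'a option \<Rightarrow> 'a^2 \<Rightarrow> bool" where
  "inW \<kappa> \<alpha> \<longleftrightarrow> (case \<kappa> of None \<Rightarrow> \<alpha>$1 = 0 | Some k \<Rightarrow> \<alpha>$2 = k * \<sigma> (\<alpha>$1))"

text \<open>Forced by \<open>inW\<close>: for a nonzero \<alpha> in the graph of slope k, the
  vectors \<alpha>K_t run through exactly this set. The factor -m comes from the second entry of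
  K_t.\<close>

definition inU :: "'a option \<Rightarrow> 'a^2 \<Rightarrow> bool" where
  "inU \<kappa> \<beta> \<longleftrightarrow> (case \<kappa> of None \<Rightarrow> \<beta>$1 = 0 | Some k \<Rightarrow> \<beta>$2 = - m * k * \<sigma> (\<beta>$1))"

definition H :: "'a option \<Rightarrow> 'a kk_elem set" where
  "H \<kappa> = {(\<alpha>, c, \<beta>). inW \<kappa> \<alpha> \<and> inU \<kappa> \<beta>}"

lemma card_graph2: "card {\<alpha> :: 'a^2. \<alpha>$2 = f (\<alpha>$1)} = CARD('a)"
proof -
  have "{\<alpha> :: 'a^2. \<alpha>$2 = f (\<alpha>$1)} = range (\<lambda>x. vector [x, f x])"
    by (auto simp: image_iff vec2_eq_iff)
  moreover have "inj (\<lambda>x. vector [x, f x] :: 'a^2)"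
    by (auto simp: inj_def vec2_eq_iff)
  ultimately show ?thesis by (simp add: card_image)
qed

lemma card_axis2: "card {\<alpha> :: 'a^2. \<alpha>$1 = 0} = CARD('a)"
proof -
  have "{\<alpha> :: 'a^2. \<alpha>$1 = 0} = range (\<lambda>x. vector [0, x])"
    by (auto simp: image_iff vec2_eq_iff)
  moreover have "inj (\<lambda>x. vector [0, x] :: 'a^2)"
    by (auto simp: inj_def vec2_eq_iff)
  ultimately show ?thesis by (simp add: card_image)
qed

lemma card_inW: "card {\<alpha>. inW \<kappa> \<alpha>} = CARD('a)" and card_inU: "card {\<beta>. inU \<kappa> \<beta>} = CARD('a)"
  using card_graph2[of "\<lambda>x. the \<kappa> * \<sigma> x"] card_graph2[of "\<lambda>x. - m * the \<kappa> * \<sigma> x"] card_axis2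
  by (cases \<kappa>; simp add: inW_def inU_def)+

text \<open>The additive structure of the two coordinate sets is forced by their interaction with all \<open>K\<^sub>t\<close>.\<close>

lemma inW_inU_if_closed:
  assumes card: "card W = CARD('a)" "card U = CARD('a)" and zero: "0 \<in> W" "0 \<in> U"
    and closed: "\<And>w u t. w \<in> W \<Longrightarrow> u \<in> U \<Longrightarrow> u - w v* K t \<in> U"
  obtains \<kappa> where "W = {\<alpha>. inW \<kappa> \<alpha>}" "U = {\<beta>. inU \<kappa> \<beta>}"
proof -
  have "card (W - {0}) = CARD('a) - 1" using card zero by (simp add: card_Diff_singleton)
  then have "W - {0} \<noteq> {}" using CARD_ge_3 by (metis card.empty diff_is_0_eq not_numeral_le_zero numeral_le_one_iff order_trans semiring_norm(70))
  then obtain w where w: "w \<in> W" "w \<noteq> 0" by auto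
  have mem: "w' v* K s \<in> U" if "w' \<in> W" for w' s
  proof -
    have "w' v* K s = 0 - w' v* K (- s)" by (simp add: vec2_eq_iff)
    then show ?thesis using closed[OF that zero(2), of "- s"] by simp
  qed
  have "inj (\<lambda>s. w v* K s)"
    using w(2) by (auto simp: inj_def vec2_eq_iff)
  then have "card (range (\<lambda>s. w v* K s)) = CARD('a)" by (simp add: card_image)
  moreover have "range (\<lambda>s. w v* K s) \<subseteq> U" using mem[OF w(1)] by auto
  \<comment> \<open>A single nonzero w already yields q vectors w K_s, so they exhaust U, and the
    slope \<kappa> can be read off from w alone.\<close>
  ultimately have U: "U = range (\<lambda>s. w v* K s)"
    using card by (intro card_seteq[symmetric]) auto
  define \<kappa> where "\<kappa> = (if w$1 = 0 then None else Some (w$2 / \<sigma> (w$1)))"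
  have subU: "U \<subseteq> {\<beta>. inU \<kappa> \<beta>}"
    unfolding U by (auto simp: inU_def \<kappa>_def)
  have subW: "W \<subseteq> {\<alpha>. inW \<kappa> \<alpha>}"
  proof
    fix w' assume "w' \<in> W"
    then have "inU \<kappa> (w' v* K 1)" using mem subU by blast
    then show "w' \<in> {\<alpha>. inW \<kappa> \<alpha>}"
      by (auto simp: inU_def inW_def split: option.splits)
  qed
  show ?thesis
  proof (rule that)
    show "W = {\<alpha>. inW \<kappa> \<alpha>}" using subW card card_inW by (intro card_seteq) auto
    show "U = {\<beta>. inU \<kappa> \<beta>}" using subU card card_inU by (intro card_seteq) auto
  qed
qed

section \<open>Points and lines of a fixed subquadrangle of order q\<close>

context
  fixes S'
  assumes S': "S' \<in> subquadrangles CARD('a) CARD('a) S"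
begin

lemma sub_S': "subgeometry S' S" and gq_S': "generalized_quadrangle CARD('a) CARD('a) S'"
  using S' by (auto simp: subquadrangles_iff)

lemma Inc_S': "(x, L) \<in> Inc S' \<longleftrightarrow> (x, L) \<in> Inc S \<and> x \<in> Points S' \<and> L \<in> Lines S'"
  using sub_S' by (auto simp: subgeometry_def)

lemma mem_S': "x \<in> Points S' \<Longrightarrow> x \<in> Points S" "L \<in> Lines S' \<Longrightarrow> L \<in> Lines S"
  using sub_S' by (auto simp: subgeometry_def)

definition E where "E = {g. Elem g \<in> Lines S'}"
text \<open>The lines of \<open>S'\<close> through \<open>Symb t\<close> other than [\<infinity>],
  recorded by the invariants of their cosets.\<close>

definition St where "St t = {u. Star_Coset (sfib t u) \<in> Lines S'}"

text \<open>A line has q+1 points in \<open>S\<close> as well as in \<open>S'\<close>, so a line of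
  \<open>S'\<close> has all of its points in \<open>S'\<close>.\<close>

lemma Coset_in_S': "g \<in> E \<Longrightarrow> Coset (fib t (linv t g)) \<in> Points S'"
proof -
  assume g: "g \<in> E"
  let ?A = "{x \<in> Points S'. (x, Elem g) \<in> Inc S'}"
  let ?B = "range (\<lambda>t. Coset (fib t (linv t g)))"
  have "?A \<subseteq> ?B"
  proof
    fix x assume x: "x \<in> ?A"
    then have "x \<in> Points S" using mem_S' by blast
    then show "x \<in> ?B"
      using x by (cases rule: Points_S_cases) (auto simp: Inc_S')
  qed
  moreover have "card ?A = CARD('a) + 1" using gq_card(2)[OF gq_S'] g by (simp add: E_def)
  moreover have "card ?B \<le> CARD('a) + 1" using card_image_le[of UNIV "\<lambda>t. Coset (fib t (linv t g))"] CARD_option by simp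
  ultimately have "?A = ?B" by (intro card_seteq) auto
  then show ?thesis by blast
qed

lemma Star_points_S':
  assumes u: "u \<in> St t"
  shows "Symb t \<in> Points S'" and "Coset (fib t (u, d)) \<in> Points S'"
proof -
  let ?L = "Star_Coset (sfib t u)"
  let ?A = "{x \<in> Points S'. (x, ?L) \<in> Inc S'}"
  let ?B = "insert (Symb t) (range (\<lambda>d. Coset (fib t (u, d))))"
  have "?A \<subseteq> ?B"
  proof
    fix x assume x: "x \<in> ?A"
    then have "x \<in> Points S" using mem_S' by blast
    then show "x \<in> ?B"
      using x by (cases rule: Points_S_cases) (auto simp: Inc_S')
  qed
  moreover have "card ?A = CARD('a) + 1" using gq_card(2)[OF gq_S'] u by (simp add: St_def)
  moreover have "card ?B \<le> CARD('a) + 1"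
    using card_image_le[of UNIV "\<lambda>d. Coset (fib t (u, d))"] by (simp add: card_insert_if)
  ultimately have "?A = ?B" by (intro card_seteq) auto
  then show "Symb t \<in> Points S'" "Coset (fib t (u, d)) \<in> Points S'" by blast+
qed

text \<open>Of the q+1 > 1 lines of \<open>S'\<close> through this point, only one can fail to be an
  element of G, namely the coset of A*(t).\<close>

lemma Coset_S'_E:
  assumes x: "Coset (fib t p) \<in> Points S'"
  obtains g where "g \<in> E" "p = linv t g"
proof -
  let ?A = "{L \<in> Lines S'. (Coset (fib t p), L) \<in> Inc S'}"
  have "card ?A = CARD('a) + 1" using gq_card(1)[OF gq_S' x] .
  then have "\<not> ?A \<subseteq> {Star_Coset (sfib t (fst p))}"
    using card_mono[of "{Star_Coset (sfib t (fst p))}" ?A] CARD_ge_3 by auto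
  then obtain L where L: "L \<in> Lines S'" "(Coset (fib t p), L) \<in> Inc S'" "L \<noteq> Star_Coset (sfib t (fst p))"
    by auto
  from mem_S'(2)[OF L(1)] show ?thesis
  proof (cases rule: Lines_S_cases)
    case (Elem g)
    then show ?thesis using L that[of g] by (auto simp: Inc_S' E_def)
  qed (use L in \<open>auto simp: Inc_S'\<close>)
qed

lemma card_Lines_S':
  "card (Lines S') = card E + (\<Sum>t\<in>UNIV. card (St t)) + (if Infinity \<in> Lines S' then 1 else 0)"
proof -
  define T where "T = (\<lambda>(t, u). Star_Coset (sfib t u) :: 'a egq_point) ` (SIGMA t:UNIV. St t)"
  have "inj_on (\<lambda>(t, u). Star_Coset (sfib t u)) (SIGMA t:UNIV. St t)"
    by (auto simp: inj_on_def)
  then have T: "card T = (\<Sum>t\<in>UNIV. card (St t))"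
    unfolding T_def by (subst card_image) (simp_all add: card_SigmaI)
  have El: "card (Elem ` E) = card E" by (intro card_image inj_onI) auto
  have "Lines S' = Elem ` E \<union> T \<union> (Lines S' \<inter> {Infinity})"
  proof (intro equalityI subsetI)
    fix L assume L: "L \<in> Lines S'"
    from mem_S'(2)[OF L] show "L \<in> Elem ` E \<union> T \<union> (Lines S' \<inter> {Infinity})"
      by (cases rule: Lines_S_cases) (use L in \<open>force simp: E_def T_def St_def\<close>)+
  qed (auto simp: E_def T_def St_def)
  moreover have "card (Elem ` E \<union> T) = card E + card T"
    using El by (subst card_Un_disjoint) (auto simp: T_def)
  moreover have "(Elem ` E \<union> T) \<inter> (Lines S' \<inter> {Infinity}) = {}" by (auto simp: T_def)
  then have "card (Elem ` E \<union> T \<union> (Lines S' \<inter> {Infinity})) = card (Elem ` E \<union> T) + card (Lines S' \<inter> {Infinity})"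
    by (intro card_Un_disjoint) (auto simp: T_def)
  moreover have "card (Lines S' \<inter> {Infinity}) = (if Infinity \<in> Lines S' then 1 else 0)" by auto
  ultimately show ?thesis using T by simp
qed

lemma card_E: "card E + (\<Sum>t\<in>UNIV. card (St t)) + (if Infinity \<in> Lines S' then 1 else 0) = (CARD('a) + 1) * (CARD('a) * CARD('a) + 1)"
  using card_Lines_S' card_Lines_generalized_quadrangle[OF gq_S'] by simp

lemma classification:
  assumes inf: "Infinity \<in> Lines S'"
  obtains \<kappa> g0 where "S' = geom (transl g0 ` H \<kappa>)"
proof -
  have symb: "Symb t \<in> Points S'" for t
  proof -
    let ?A = "{x \<in> Points S'. (x, Infinity) \<in> Inc S'}"
    have "?A \<subseteq> range Symb"
    proof
      fix x assume x: "x \<in> ?A"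
      then have "x \<in> Points S" using mem_S' by blast
      then show "x \<in> range Symb" using x by (cases rule: Points_S_cases) (auto simp: Inc_S')
    qed
    moreover have "card ?A = CARD('a) + 1" using gq_card(2)[OF gq_S' inf] .
    moreover have "card (range Symb :: 'a egq_line set) \<le> CARD('a) + 1" using card_image_le[of "UNIV :: 'a option set" Symb] CARD_option by simp
    ultimately have "?A = range Symb" by (intro card_seteq) auto
    then show ?thesis by blast
  qed
  have cSt: "card (St t) = CARD('a)" for t
  proof -
    have "{L \<in> Lines S'. (Symb t, L) \<in> Inc S'} = insert Infinity ((\<lambda>u. Star_Coset (sfib t u)) ` St t)"
    proof (intro equalityI subsetI)
      fix L assume L: "L \<in> {L \<in> Lines S'. (Symb t, L) \<in> Inc S'}"
      then have "L \<in> Lines S" using mem_S' by blast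
      then show "L \<in> insert Infinity ((\<lambda>u. Star_Coset (sfib t u)) ` St t)"
        using L by (cases rule: Lines_S_cases) (auto simp: Inc_S' St_def)
    qed (use symb inf in \<open>auto simp: Inc_S' St_def\<close>)
    moreover have "card ((\<lambda>u. Star_Coset (sfib t u)) ` St t) = card (St t)"
      by (intro card_image inj_onI) auto
    moreover have "Infinity \<notin> (\<lambda>u. Star_Coset (sfib t u)) ` St t" by auto
    ultimately have "card {L \<in> Lines S'. (Symb t, L) \<in> Inc S'} = card (St t) + 1"
      by simp
    then show ?thesis using gq_card(1)[OF gq_S' symb[of t]] by simp
  qed
  \<comment> \<open>Projecting the point onto [\<infinity>] inside \<open>S'\<close> gives
    \<open>Symb t\<close>, and the joining line is the coset of A*(t) through g.\<close>
  have ESt: "fst (linv t g) \<in> St t" if g: "g \<in> E" for t g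
  proof -
    have "(Coset (fib t (linv t g)), Infinity) \<notin> Inc S'" by (simp add: Inc_S')
    then obtain y M where y: "y \<in> Points S'" "M \<in> Lines S'" "(Coset (fib t (linv t g)), M) \<in> Inc S'"
        "(y, M) \<in> Inc S'" "(y, Infinity) \<in> Inc S'"
      using gq_projection[OF gq_S' Coset_in_S'[OF g] inf] by metis
    from mem_S'(1)[OF y(1)] obtain t' where t': "y = Symb t'"
      by (cases rule: Points_S_cases) (use y in \<open>auto simp: Inc_S'\<close>)
    from mem_S'(2)[OF y(2)] show ?thesis
      by (cases rule: Lines_S_cases) (use y t' in \<open>auto simp: Inc_S' St_def\<close>)
  qed
  \<comment> \<open>From (q+1)(q^2+1) lines take away q for each of the q+1 symbols and
    [\<infinity>] itself; q^3 remain.\<close>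
  have cE: "card E = CARD('a) * (CARD('a) * CARD('a))"
    using card_E inf CARD_option by (simp add: cSt algebra_simps)
  \<comment> \<open>The star invariants at \<infinity> and 0 are \<alpha> and \<beta>. Each takes at
    most q values on E, so with c free the product has exactly q^3 elements and equals E.\<close>
  define A' B' where "A' = St None" and "B' = St (Some 0)"
  have "E \<subseteq> A' \<times> UNIV \<times> B'"
  proof
    fix g assume g: "g \<in> E"
    obtain \<alpha> c \<beta> where "g = (\<alpha>, c, \<beta>)" by (cases g)
    moreover have "\<alpha> v* K 0 = 0" by (simp add: vec2_eq_iff)
    ultimately show "g \<in> A' \<times> UNIV \<times> B'"
      using ESt[OF g, of None] ESt[OF g, of "Some 0"] by (simp add: A'_def B'_def)
  qed
  moreover have "card (A' \<times> (UNIV :: 'a set) \<times> B') = CARD('a) * (CARD('a) * CARD('a))"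
    by (simp add: card_cartesian_product A'_def B'_def cSt)
  ultimately have E: "E = A' \<times> UNIV \<times> B'" using cE by (intro card_seteq) auto
  have "A' \<noteq> {}" "B' \<noteq> {}" using cSt CARD_ge_3 by (auto simp: A'_def B'_def dest: arg_cong[of _ _ card] simp del: card_eq_0_iff)
  then obtain \<alpha>0 \<beta>0 where ab: "\<alpha>0 \<in> A'" "\<beta>0 \<in> B'" by auto
  \<comment> \<open>For every \<alpha> in A' the set B' - \<alpha>K_t lies in the q-element set
    \<open>St (Some t)\<close>, which B' - \<alpha>0 K_t already fills. Comparing the two shows that
    B' is invariant under subtracting (\<alpha> - \<alpha>0)K_t.\<close>
  have closed: "\<beta> - (\<alpha> - \<alpha>0) v* K t \<in> B'" if ab': "\<alpha> \<in> A'" "\<beta> \<in> B'" for \<alpha> \<beta> t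
  proof -
    have mem: "\<beta> - \<alpha> v* K t \<in> St (Some t)" if "\<alpha> \<in> A'" "\<beta> \<in> B'" for \<alpha> \<beta>
      using ESt[of "(\<alpha>, 0, \<beta>)" "Some t"] that E by simp
    have "(\<lambda>\<beta>. \<beta> - \<alpha>0 v* K t) ` B' \<subseteq> St (Some t)" using mem ab by auto
    moreover have "card ((\<lambda>\<beta>. \<beta> - \<alpha>0 v* K t) ` B') = CARD('a)"
      by (subst card_image) (auto simp: inj_on_def B'_def cSt)
    ultimately have "(\<lambda>\<beta>. \<beta> - \<alpha>0 v* K t) ` B' = St (Some t)"
      by (intro card_seteq) (auto simp: cSt)
    then obtain \<beta>' where "\<beta>' \<in> B'" "\<beta> - \<alpha> v* K t = \<beta>' - \<alpha>0 v* K t" using mem[OF ab'] by blast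
    moreover from this have "\<beta>' = \<beta> - (\<alpha> - \<alpha>0) v* K t"
      by (simp add: vec2_eq_iff algebra_simps)
    ultimately show ?thesis by simp
  qed
  define W U where "W = (\<lambda>\<alpha>. \<alpha> - \<alpha>0) ` A'" and "U = (\<lambda>\<beta>. \<beta> - \<beta>0) ` B'"
  have "card W = CARD('a)" "card U = CARD('a)"
    unfolding W_def U_def by (subst card_image; simp add: inj_on_def A'_def B'_def cSt)+
  moreover have "0 \<in> W" "0 \<in> U" using ab by (auto simp: W_def U_def)
  moreover have "u - w v* K t \<in> U" if wu: "w \<in> W" "u \<in> U" for w u t
  proof -
    obtain \<alpha> \<beta> where "\<alpha> \<in> A'" "\<beta> \<in> B'" "w = \<alpha> - \<alpha>0" "u = \<beta> - \<beta>0" using wu by (auto simp: W_def U_def)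
    then show ?thesis using closed[of \<alpha> \<beta> t] unfolding U_def
      by (intro image_eqI[of _ _ "\<beta> - (\<alpha> - \<alpha>0) v* K t"]) (auto simp: algebra_simps)
  qed
  ultimately obtain \<kappa> where \<kappa>: "W = {\<alpha>. inW \<kappa> \<alpha>}" "U = {\<beta>. inU \<kappa> \<beta>}"
    by (rule inW_inU_if_closed)
  have A'_iff: "\<alpha> \<in> A' \<longleftrightarrow> inW \<kappa> (\<alpha> - \<alpha>0)" for \<alpha>
  proof -
    have "\<alpha> - \<alpha>0 \<in> W \<longleftrightarrow> \<alpha> \<in> A'" by (auto simp: W_def)
    then show ?thesis using \<kappa>(1) by simp
  qed
  have B'_iff: "\<beta> \<in> B' \<longleftrightarrow> inU \<kappa> (\<beta> - \<beta>0)" for \<beta>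
  proof -
    have "\<beta> - \<beta>0 \<in> U \<longleftrightarrow> \<beta> \<in> B'" by (auto simp: U_def)
    then show ?thesis using \<kappa>(2) by simp
  qed
  have E': "E = transl (\<alpha>0, 0, \<beta>0) ` H \<kappa>"
  proof (intro equalityI subsetI)
    fix g assume g: "g \<in> E"
    obtain \<alpha> c \<beta> where gg: "g = (\<alpha>, c, \<beta>)" by (cases g)
    show "g \<in> transl (\<alpha>0, 0, \<beta>0) ` H \<kappa>"
      by (rule image_eqI[of _ _ "(\<alpha> - \<alpha>0, c - dotp (\<beta> - \<beta>0) \<alpha>0, \<beta> - \<beta>0)"])
        (use g in \<open>auto simp: gg E A'_iff B'_iff H_def\<close>)
  next
    fix g assume "g \<in> transl (\<alpha>0, 0, \<beta>0) ` H \<kappa>"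
    then obtain \<alpha> c \<beta> where "g = transl (\<alpha>0, 0, \<beta>0) (\<alpha>, c, \<beta>)" "inW \<kappa> \<alpha>" "inU \<kappa> \<beta>" by (auto simp: H_def)
    then show "g \<in> E" by (simp add: E A'_iff B'_iff)
  qed
  have S'_eq: "S' = geom E"
  proof (rule subgeometry_eqI[OF sub_S' subgeometry_geom])
    show "Points S' = Points (geom E)"
    proof (intro equalityI subsetI)
      fix x assume x: "x \<in> Points S'"
      from mem_S'(1)[OF this] show "x \<in> Points (geom E)"
      proof (cases rule: Points_S_cases)
        case (Coset t p)
        then obtain g where "g \<in> E" "p = linv t g" using Coset_S'_E x by blast
        then show ?thesis using Coset by (auto simp: geom_sel)
      qed (simp add: geom_sel)
    qed (auto simp: geom_sel symb Coset_in_S')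
    show "Lines S' = Lines (geom E)"
    proof (intro equalityI subsetI)
      fix L assume L: "L \<in> Lines S'"
      from mem_S'(2)[OF this] show "L \<in> Lines (geom E)"
      proof (cases rule: Lines_S_cases)
        case (Elem g)
        then show ?thesis using L by (auto simp: geom_sel E_def)
      next
        case (Star t u)
        then have "u \<in> St t" using L by (simp add: St_def)
        then have "Coset (fib t (u, 0)) \<in> Points S'" by (rule Star_points_S')
        then obtain g where g: "g \<in> E" "(u, 0) = linv t g" by (rule Coset_S'_E)
        then have "u = fst (linv t g)" by (metis fst_conv)
        then show ?thesis using Star g(1) unfolding geom_sel by blast
      qed (simp add: geom_sel)
    next
      fix L assume "L \<in> Lines (geom E)"
      then show "L \<in> Lines S'" using ESt inf unfolding geom_sel by (auto simp: E_def St_def)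
    qed
  qed
  have "S' = geom (transl (\<alpha>0, 0, \<beta>0) ` H \<kappa>)"
    unfolding E'[symmetric] by (rule S'_eq)
  then show ?thesis by (rule that)
qed

text \<open>
  If \<open>[\<infinity>]\<close> is not a line of \<open>S'\<close>, the stabilizer of \<open>S'\<close> in \<open>G\<close> acts semiregularly on the elements of \<open>G\<close> in
  \<open>S'\<close>, whose number is \<open>q + 1\<close> times a positive number which is at most \<open>q\<^sup>2 + 1\<close>.
\<close>

lemma large_orbit_if_not_Infinity:
  assumes inf: "Infinity \<notin> Lines S'" and fin: "finite (aut_orbit S S')"
  shows "(CARD('a) - 1) * (CARD('a))^2 < card (aut_orbit S S')"
proof -
  let ?q = "CARD('a)"
  define J where "J = {t. Symb t \<in> Points S'}"
  \<comment> \<open>With [\<infinity>] missing, all q+1 lines of \<open>S'\<close> through a symbol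
    are cosets of A*(t).\<close>
  have cSt: "card (St t) = (if t \<in> J then ?q + 1 else 0)" for t
  proof (cases "t \<in> J")
    case True
    have "{L \<in> Lines S'. (Symb t, L) \<in> Inc S'} = (\<lambda>u. Star_Coset (sfib t u)) ` St t"
    proof (intro equalityI subsetI)
      fix L assume L: "L \<in> {L \<in> Lines S'. (Symb t, L) \<in> Inc S'}"
      then have "L \<in> Lines S" using mem_S' by blast
      then show "L \<in> (\<lambda>u. Star_Coset (sfib t u)) ` St t"
        using L inf by (cases rule: Lines_S_cases) (auto simp: Inc_S' St_def)
    qed (use True in \<open>auto simp: Inc_S' St_def J_def\<close>)
    moreover have "card ((\<lambda>u. Star_Coset (sfib t u)) ` St t) = card (St t)"
      by (intro card_image inj_onI) auto
    ultimately have "card {L \<in> Lines S'. (Symb t, L) \<in> Inc S'} = card (St t)"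
      by simp
    then show ?thesis using gq_card(1)[OF gq_S', of "Symb t"] True by (simp add: J_def)
  next
    case False
    then have "St t = {}" using Star_points_S'(1) by (auto simp: J_def)
    then show ?thesis using False by simp
  qed
  have J: "card J \<le> ?q + 1" using card_mono[of UNIV J] CARD_option by simp
  \<comment> \<open>Makes the cofactor q^2 + 1 - |J| of |E| positive, so that a divisor of it is
    bounded by it.\<close>
  have q2: "?q + 1 < ?q * ?q + 1" using CARD_ge_3 by (simp add: less_eq_iff_succ_less)
  have "card E + card J * (?q + 1) = (?q + 1) * (?q * ?q + 1)"
    using card_E inf by (simp add: cSt sum.If_cases)
  then have cE: "card E = (?q + 1) * (?q * ?q + 1 - card J)"
    by (metis diff_add_inverse2 diff_mult_distrib2 mult.commute)
  define P where "P = {x. transl x ` E = E}"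
  have tt: "transl y (transl x g) = transl (x \<otimes>\<^bsub>kk_group\<^esub> y) g" for x y g
    by (cases x, cases y, cases g) (simp add: kk_group_def dotp_2 algebra_simps)
  have timg: "transl y ` transl x ` A = transl (x \<otimes>\<^bsub>kk_group\<^esub> y) ` A" for x y A
    by (simp add: image_image tt)
  define iv :: "'a kk_elem \<Rightarrow> 'a kk_elem" where "iv = (\<lambda>(\<alpha>, c, \<beta>). (- \<alpha>, dotp \<beta> \<alpha> - c, - \<beta>))"
  have iv: "x \<otimes>\<^bsub>kk_group\<^esub> iv x = \<one>\<^bsub>kk_group\<^esub>" "iv x \<otimes>\<^bsub>kk_group\<^esub> x = \<one>\<^bsub>kk_group\<^esub>" for x
    by (cases x; simp add: iv_def kk_group_def dotp_2)+
  have grp: "group (kk_group :: 'a kk_elem monoid)"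
  proof (rule groupI)
    fix x y z :: "'a kk_elem"
    show "x \<otimes>\<^bsub>kk_group\<^esub> y \<otimes>\<^bsub>kk_group\<^esub> z = x \<otimes>\<^bsub>kk_group\<^esub> (y \<otimes>\<^bsub>kk_group\<^esub> z)"
      by (cases x, cases y, cases z) (simp add: kk_group_def dotp_2 algebra_simps)
    show "\<one>\<^bsub>kk_group\<^esub> \<otimes>\<^bsub>kk_group\<^esub> x = x" by (cases x) (simp add: kk_group_def dotp_2)
    show "\<exists>y\<in>carrier kk_group. y \<otimes>\<^bsub>kk_group\<^esub> x = \<one>\<^bsub>kk_group\<^esub>"
      using iv(2)[of x] by (intro bexI[of _ "iv x"]) (simp_all add: kk_group_def)
  qed (simp_all add: kk_group_def)
  interpret group "kk_group :: 'a kk_elem monoid" by (rule grp)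
  have carr: "x \<in> carrier (kk_group :: 'a kk_elem monoid)" for x by (simp add: kk_group_def)
  have inv_eq: "inv\<^bsub>kk_group\<^esub> x = iv x" for x using iv carr by (intro inv_equality) auto
  have t1: "transl \<one>\<^bsub>kk_group\<^esub> g = g" for g by (cases g) (simp add: kk_group_def dotp_2)
  have subP: "subgroup P kk_group"
  proof (rule subgroupI)
    have "\<one>\<^bsub>kk_group\<^esub> \<in> P" by (simp add: P_def t1)
    then show "P \<noteq> {}" by blast
    fix x y assume x: "x \<in> P"
    then have "transl (iv x) ` E = transl (iv x) ` transl x ` E" by (simp add: P_def)
    also have "\<dots> = E" unfolding timg iv by (simp add: t1)
    finally show "inv\<^bsub>kk_group\<^esub> x \<in> P" by (simp add: P_def inv_eq)
    assume "y \<in> P"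
    then have "transl y ` transl x ` E = E" using x by (simp add: P_def)
    then show "x \<otimes>\<^bsub>kk_group\<^esub> y \<in> P" by (simp add: timg P_def)
  qed (simp add: carr subset_iff)
  have order: "order (kk_group :: 'a kk_elem monoid) = ?q ^ 5"
    by (simp add: order_def kk_group_def CARD_vec2 card_cartesian_product[of UNIV UNIV, simplified] eval_nat_numeral)
  have dvd1: "card P dvd ?q ^ 5"
    using lagrange[OF subP] order by (metis dvd_triv_right)
  have dvd2: "card P dvd card E"
  proof (rule equiv_imp_dvd_card)
    let ?r = "{(g, h). g \<in> E \<and> h \<in> E \<and> (\<exists>x\<in>P. h = transl x g)}"
    have memE: "transl x g \<in> E" if "x \<in> P" "g \<in> E" for x g
      using that by (auto simp: P_def)
    show "finite E" by simp
    show "equiv E ?r"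
    proof (rule equivI)
      show "refl_on E ?r"
        using subgroup.one_closed[OF subP] t1 by (auto simp: refl_on_def) metis
      show "sym ?r"
      proof (rule symI)
        fix g h assume "(g, h) \<in> ?r"
        then obtain x where x: "x \<in> P" "g \<in> E" "h \<in> E" "h = transl x g" by blast
        then have "g = transl (iv x) h" by (simp add: tt iv t1)
        moreover have "iv x \<in> P"
          using subgroup.m_inv_closed[OF subP x(1)] by (simp add: inv_eq)
        ultimately show "(h, g) \<in> ?r" using x by blast
      qed
      show "Relation.trans ?r"
      proof (rule transI)
        fix g h k assume "(g, h) \<in> ?r" "(h, k) \<in> ?r"
        then obtain x y where x: "x \<in> P" "y \<in> P" "g \<in> E" "k \<in> E" "h = transl x g" "k = transl y h" by blast
        then have "k = transl (x \<otimes>\<^bsub>kk_group\<^esub> y) g" by (simp only: tt)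
        then show "(g, k) \<in> ?r" using x subgroup.m_closed[OF subP x(1,2)] by blast
      qed
    qed auto
    fix X assume "X \<in> E // ?r"
    then obtain g where g: "g \<in> E" "X = ?r `` {g}" by (auto simp: quotient_def)
    then have "X = (\<lambda>x. transl x g) ` P" using memE[OF _ g(1)] by blast
    moreover have "inj_on (\<lambda>x. transl x g) P"
      by (cases g) (auto simp: inj_on_def)
    ultimately show "card P dvd card X" by (simp add: card_image)
  qed
  \<comment> \<open>|P| divides q^5, so it is coprime to q+1 and must divide the other factor of
    |E|.\<close>
  have "coprime ?q (?q + 1)" by simp
  then have "coprime (?q ^ 5) (?q + 1)" by (simp only: coprime_power_left_iff) simp
  then have "coprime (card P) (?q + 1)" by (rule coprime_divisors[OF dvd1 dvd_refl])
  then have "card P dvd ?q * ?q + 1 - card J"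
    using dvd2 unfolding cE by (metis coprime_dvd_mult_right_iff)
  moreover have "0 < ?q * ?q + 1 - card J" using J q2 by linarith
  ultimately have cP: "card P \<le> ?q * ?q + 1"
    by (meson diff_le_self le_trans dvd_imp_le)
  \<comment> \<open>The subquadrangles are followed only through their sets of group elements;
    distinct translates of E belong to distinct members of the orbit.\<close>
  define Orb where "Orb = (\<lambda>x. transl x ` E) ` UNIV"
  have "Orb \<subseteq> (\<lambda>T. {g. Elem g \<in> Lines T}) ` aut_orbit S S'"
  proof
    fix X assume "X \<in> Orb"
    then obtain x where x: "X = transl x ` E" by (auto simp: Orb_def)
    let ?T = "image_geometry (point_map id (transl x)) (line_map (transl x)) S'"
    have "?T \<in> aut_orbit S S'"
      using automorphism_compat[OF compat_transl[of x]] by (auto simp: aut_orbit_def)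
    moreover have "X = {g. Elem g \<in> Lines ?T}"
    proof (intro equalityI subsetI)
      fix g assume "g \<in> X"
      then obtain h where "h \<in> E" "g = transl x h" using x by auto
      then have "Elem g = line_map (transl x) (Elem h)" "Elem h \<in> Lines S'" by (simp_all add: E_def)
      then have "Elem g \<in> line_map (transl x) ` Lines S'" by (rule image_eqI)
      then show "g \<in> {g. Elem g \<in> Lines ?T}" by (simp add: image_geometry_def)
    next
      fix g assume "g \<in> {g. Elem g \<in> Lines ?T}"
      then obtain L where L: "L \<in> Lines S'" "Elem g = line_map (transl x) L" by (auto simp: image_geometry_def)
      then obtain h where "L = Elem h" "g = transl x h" by (cases L) (auto simp: line_map_def)
      then show "g \<in> X" using L x by (auto simp: E_def)
    qed
    ultimately show "X \<in> (\<lambda>T. {g. Elem g \<in> Lines T}) ` aut_orbit S S'" by blast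
  qed
  then have cO: "card Orb \<le> card (aut_orbit S S')"
    using fin by (meson card_image_le card_mono finite_imageI le_trans)
  have "UNIV = (\<Union>X\<in>Orb. {x. transl x ` E = X})" by (auto simp: Orb_def)
  then have "?q ^ 5 = card (\<Union>X\<in>Orb. {x. transl x ` E = X})"
    using order by (simp add: order_def kk_group_def)
  also have "\<dots> \<le> (\<Sum>X\<in>Orb. card {x. transl x ` E = X})" by (intro card_UN_le) simp
  also have "\<dots> \<le> (\<Sum>X\<in>Orb. card P)"
  proof (rule sum_mono)
    fix X assume "X \<in> Orb"
    then obtain y where y: "X = transl y ` E" by (auto simp: Orb_def)
    have "(\<lambda>x. x \<otimes>\<^bsub>kk_group\<^esub> iv y) ` {x. transl x ` E = X} \<subseteq> P"
    proof (rule image_subsetI)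
      fix x assume "x \<in> {x. transl x ` E = X}"
      then have "transl (iv y) ` transl x ` E = E" by (simp add: y timg iv t1)
      then show "x \<otimes>\<^bsub>kk_group\<^esub> iv y \<in> P" by (simp add: P_def timg)
    qed
    moreover have "inj (\<lambda>x. x \<otimes>\<^bsub>kk_group\<^esub> iv y)"
      using carr by (intro injI) (simp add: right_cancel)
    ultimately show "card {x. transl x ` E = X} \<le> card P"
      by (meson card_inj_on_le finite inj_on_subset subset_UNIV)
  qed
  also have "\<dots> = card Orb * card P" by simp
  also have "\<dots> \<le> card (aut_orbit S S') * (?q * ?q + 1)"
    using cO cP by (intro mult_le_mono)
  finally have big: "?q ^ 5 \<le> card (aut_orbit S S') * (?q * ?q + 1)" .
  show ?thesis
  proof (rule ccontr)
    assume "\<not> ?thesis"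
    then have "card (aut_orbit S S') \<le> (?q - 1) * ?q^2" by simp
    \<comment> \<open>The right-hand side is q^5 - q^4 + q^3 - q^2, which is less than q^5.\<close>
    then have "?q ^ 5 \<le> (?q - 1) * ?q^2 * (?q * ?q + 1)" using big by (meson le_trans mult_le_mono1)
    moreover obtain n where n: "?q = Suc n" using CARD_ge_3 by (cases ?q) auto
    ultimately show False by (simp add: eval_nat_numeral algebra_simps)
  qed
qed

end

section \<open>Subtended ovoids of the Kantor-Knuth quadrangle\<close>

lemma card_Points_S: "card (Points S) = (CARD('a) + 1) * (CARD('a) ^ 3 + 1)"
proof -
  let ?C = "(\<lambda>(t, p). Coset (fib t p)) ` (UNIV :: ('a option \<times> ('a^2) \<times> 'a) set)"
  have "card ?C = (CARD('a) + 1) * (CARD('a) * CARD('a) * CARD('a))"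
    by (subst card_image) (auto simp: inj_on_def CARD_vec2 power2_eq_square card_cartesian_product[of UNIV UNIV, simplified])
  moreover have "card (range Symb :: 'a egq_line set) = CARD('a) + 1"
    by (subst card_image) (simp_all add: inj_on_def)
  moreover have "Points S = range Symb \<union> ?C" by (auto simp: Points_S)
  moreover have "card (range Symb \<union> ?C) = card (range Symb :: 'a egq_line set) + card ?C"
    by (rule card_Un_disjoint) auto
  ultimately show ?thesis by (simp add: eval_nat_numeral algebra_simps)
qed

lemma card_Points_diff:
  assumes "S' \<in> subquadrangles CARD('a) CARD('a) S"
  shows "card (Points S - Points S') = (CARD('a) + 1) * CARD('a)^2 * (CARD('a) - 1)"
proof -
  have "Points S' \<subseteq> Points S" using sub_S'[OF assms] by (auto simp: subgeometry_def)
  moreover have "card (Points S') = (CARD('a) + 1) * (CARD('a) * CARD('a) + 1)"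
    by (rule card_Points_generalized_quadrangle[OF gq_S'[OF assms]])
  moreover have "finite (Points S)"
    using card_Points_S by (intro card_ge_0_finite) simp
  ultimately have "card (Points S - Points S') =
      (CARD('a) + 1) * (CARD('a) ^ 3 + 1) - (CARD('a) + 1) * (CARD('a) * CARD('a) + 1)"
    using card_Points_S by (simp add: card_Diff_subset finite_subset)
  moreover obtain n where "CARD('a) = Suc n" using CARD_ge_3 by (cases "CARD('a)") auto
  ultimately show ?thesis by (simp add: eval_nat_numeral algebra_simps)
qed

section \<open>Collinearity in \<open>S\<close> and the shape of subtended ovoids\<close>

lemma collinear_Symb: "collinear_in S (Coset (fib t p)) (Symb t') \<longleftrightarrow> t = t'"
proof
  assume "t = t'"
  then have "(Coset (fib t p), Star_Coset (sfib t (fst p))) \<in> Inc S"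
    "(Symb t', Star_Coset (sfib t (fst p))) \<in> Inc S" by simp_all
  then show "collinear_in S (Coset (fib t p)) (Symb t')" unfolding collinear_in_def by (meson in_S)
next
  assume "collinear_in S (Coset (fib t p)) (Symb t')"
  then obtain L where L: "L \<in> Lines S" "(Coset (fib t p), L) \<in> Inc S" "(Symb t', L) \<in> Inc S"
    by (auto simp: collinear_in_def)
  from L(1) show "t = t'"
    by (cases rule: Lines_S_cases) (use L in auto)
qed

lemma collinear_Coset_Coset:
  assumes "collinear_in S (Coset (fib t p)) (Coset (fib t p'))"
  shows "fst p = fst p'"
proof -
  obtain L where L: "L \<in> Lines S" "(Coset (fib t p), L) \<in> Inc S" "(Coset (fib t p'), L) \<in> Inc S"
    using assms by (auto simp: collinear_in_def)
  from L(1) show ?thesis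
    by (cases rule: Lines_S_cases) (use L in auto)
qed

text \<open>A common line must be an element of G, and the first components force it to be
  (\<alpha>, c', u + \<alpha>K_t). The two conditions on c' agree precisely under the stated
  equation, where \<alpha>K_t\<alpha>^T = 2 \<alpha>A_t\<alpha>^T has been used.\<close>

lemma collinear_None_Some:
  "collinear_in S (Coset (fib None (\<alpha>, d))) (Coset (fib (Some t) (u, c))) \<longleftrightarrow>
     c = d + dotp u \<alpha> + dotp (\<alpha> v* A t) \<alpha>" (is "?l \<longleftrightarrow> ?r")
proof
  assume ?l
  then obtain L where L: "L \<in> Lines S" "(Coset (fib None (\<alpha>, d)), L) \<in> Inc S"
      "(Coset (fib (Some t) (u, c)), L) \<in> Inc S"
    by (auto simp: collinear_in_def)
  from L(1) show ?r
  proof (cases rule: Lines_S_cases)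
    case (Elem g)
    obtain \<alpha>' c' \<beta> where g: "g = (\<alpha>', c', \<beta>)" by (cases g)
    have "linv None g = (\<alpha>, d)" "linv (Some t) g = (u, c)"
      using L Elem by auto
    then have duc: "d = c' - dotp \<beta> \<alpha>" "u = \<beta> - \<alpha> v* K t" "c = c' - dotp (\<alpha> v* A t) \<alpha>"
      by (auto simp: g)
    show ?thesis unfolding duc by (simp add: dotp_2 algebra_simps)
  qed (use L in auto)
next
  assume r: ?r
  define g where "g = (\<alpha>, d + dotp (u + \<alpha> v* K t) \<alpha>, u + \<alpha> v* K t)"
  have "linv None g = (\<alpha>, d)" "linv (Some t) g = (u, c)"
    by (simp_all add: g_def r dotp_2 vec2_eq_iff algebra_simps)
  then have "(Coset (fib None (\<alpha>, d)), Elem g) \<in> Inc S" "(Coset (fib (Some t) (u, c)), Elem g) \<in> Inc S"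
    by simp_all
  then show ?l unfolding collinear_in_def by (meson in_S)
qed

lemma zero_H: "inW \<kappa> 0" "inU \<kappa> 0"
  by (simp_all add: inW_def inU_def split: option.split)

lemma Coset_in_geom_H:
  "Coset (fib t p) \<in> Points (geom (H \<kappa>)) \<longleftrightarrow> (case t of None \<Rightarrow> inW \<kappa> (fst p) | Some _ \<Rightarrow> inU \<kappa> (fst p))"
proof
  assume "Coset (fib t p) \<in> Points (geom (H \<kappa>))"
  then obtain g where g: "g \<in> H \<kappa>" "p = linv t g" by (auto simp: geom_sel)
  then show "case t of None \<Rightarrow> inW \<kappa> (fst p) | Some _ \<Rightarrow> inU \<kappa> (fst p)"
    by (auto simp: H_def inW_def inU_def algebra_simps split: option.splits)
next
  obtain u c where p: "p = (u, c)" by (cases p)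
  assume *: "case t of None \<Rightarrow> inW \<kappa> (fst p) | Some _ \<Rightarrow> inU \<kappa> (fst p)"
  have "\<exists>g\<in>H \<kappa>. p = linv t g"
  proof (cases t)
    case None
    then have "(u, c, 0) \<in> H \<kappa>" "p = linv t (u, c, 0)"
      using * zero_H by (simp_all add: H_def p dotp_2)
    then show ?thesis by blast
  next
    case (Some s)
    then have "(0, c, u) \<in> H \<kappa>" "p = linv t (0, c, u)"
      using * zero_H by (simp_all add: H_def p dotp_2 vec2_eq_iff)
    then show ?thesis by blast
  qed
  then show "Coset (fib t p) \<in> Points (geom (H \<kappa>))" by (auto simp: geom_sel)
qed

lemma Symb_in_geom: "Symb t \<in> Points (geom X)"
  by (simp add: geom_sel)

text \<open>As \<alpha> is not in W, no coset of A(\<infinity>) in the subquadrangle is collinear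
  with the given one; each pair of a finite t and some u in U contributes exactly one value of
  c.\<close>

lemma subtended_None:
  assumes "\<not> inW \<kappa> \<alpha>"
  shows "subtended_by S (geom (H \<kappa>)) (Coset (fib None (\<alpha>, d))) =
    insert (Symb None) {Coset (fib (Some t) (u, d + dotp u \<alpha> + dotp (\<alpha> v* A t) \<alpha>)) | t u. inU \<kappa> u}"
    (is "?l = ?r")
proof (intro equalityI subsetI)
  fix y assume y: "y \<in> ?l"
  then have "y \<in> Points S" using subgeometry_geom by (auto simp: subtended_by_def subgeometry_def)
  then show "y \<in> ?r"
  proof (cases rule: Points_S_cases)
    case (Symb t)
    then show ?thesis using y by (auto simp: subtended_by_def collinear_Symb)
  next
    case (Coset t p)
    show ?thesis
    proof (cases t)
      case None
      then have "fst p = \<alpha>" using y Coset collinear_Coset_Coset[of None "(\<alpha>, d)" p]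
        by (auto simp: subtended_by_def)
      then show ?thesis using y assms Coset None by (auto simp: subtended_by_def Coset_in_geom_H)
    next
      case (Some s)
      obtain u c where "p = (u, c)" by (cases p)
      then show ?thesis using y Coset Some
        by (auto simp: subtended_by_def Coset_in_geom_H collinear_None_Some)
    qed
  qed
qed (auto simp: subtended_by_def Symb_in_geom collinear_Symb Coset_in_geom_H collinear_None_Some)

text \<open>For k = 0 or \<infinity> there is a vector \<alpha> outside W which is orthogonal to U.
  The quadratic term is even in \<alpha>, so \<alpha> and -\<alpha> subtend the same ovoid.\<close>

lemma not_singly_subtended_H:
  assumes "\<kappa> = None \<or> \<kappa> = Some 0"
  shows "\<not> singly_subtended S (geom (H \<kappa>))"
proof -
  define \<alpha> :: "'a^2" where "\<alpha> = (if \<kappa> = None then vector [1, 0] else vector [0, 1])"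
  have n: "\<not> inW \<kappa> \<alpha>" "\<not> inW \<kappa> (- \<alpha>)"
    using assms by (auto simp: inW_def \<alpha>_def)
  let ?x = "Coset (fib None (\<alpha>, 0))" and ?y = "Coset (fib None (- \<alpha>, 0))"
  have "dotp u (- \<alpha>) = dotp u \<alpha>" "dotp (- \<alpha> v* A t) (- \<alpha>) = dotp (\<alpha> v* A t) \<alpha>" if "inU \<kappa> u" for u t
    using assms that by (auto simp: inU_def \<alpha>_def dotp_2)
  then have "subtended_by S (geom (H \<kappa>)) ?x = subtended_by S (geom (H \<kappa>)) ?y"
    unfolding subtended_None[OF n(1)] subtended_None[OF n(2)]
    by (intro arg_cong[of _ _ "insert (Symb None)"] Collect_cong) (metis (no_types, lifting))
  moreover have "?x \<in> Points S - Points (geom (H \<kappa>))" "?y \<in> Points S - Points (geom (H \<kappa>))"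
    using n by (auto simp: Coset_in_geom_H)
  moreover have "\<alpha> \<noteq> - \<alpha>"
  proof
    assume "\<alpha> = - \<alpha>"
    then have "\<alpha>$1 + \<alpha>$1 = 0" "\<alpha>$2 + \<alpha>$2 = 0" by (simp_all add: vec2_eq_iff eq_neg_iff_add_eq_0)
    then have "2 * \<alpha>$1 = 0" "2 * \<alpha>$2 = 0" by (simp_all only: mult_2)
    then show False by (auto simp: \<alpha>_def split: if_splits)
  qed
  then have "?x \<noteq> ?y" by simp
  ultimately show ?thesis unfolding singly_subtended_def by (meson inj_onD)
qed

lemma card_H: "card (H \<kappa>) = CARD('a) * (CARD('a) * CARD('a))"
proof -
  have "H \<kappa> = {\<alpha>. inW \<kappa> \<alpha>} \<times> UNIV \<times> {\<beta>. inU \<kappa> \<beta>}" by (auto simp: H_def)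
  then show ?thesis by (simp add: card_cartesian_product card_inW card_inU)
qed

text \<open>All sets \<open>H \<kappa>\<close> have q^3 elements, so an inclusion suffices.\<close>

lemma image_H_eq:
  assumes "compat \<pi> \<phi>" "\<phi> ` H \<kappa> \<subseteq> H \<kappa>'"
  shows "\<phi> ` H \<kappa> = H \<kappa>'"
proof -
  have "inj \<phi>" using assms by (simp add: compat_def bij_def)
  then have "card (\<phi> ` H \<kappa>) = card (H \<kappa>)" by (intro card_image) (auto intro: inj_on_subset)
  then show ?thesis using assms(2) by (intro card_seteq) (simp_all add: card_H)
qed

lemma shift_H: "shift s ` H (Some k) = H (Some k)"
  by (rule image_H_eq[OF compat_shift]) (auto simp: H_def inW_def inU_def shift_def algebra_simps)

lemma swap_H: "swap ` H (Some k) = H (Some (- k))"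
  by (rule image_H_eq[OF compat_swap]) (auto simp: H_def inW_def inU_def swap_def)

lemma compat_comp:
  assumes "compat \<pi> \<phi>" "compat \<pi>' \<phi>'"
  shows "compat (\<pi>' \<circ> \<pi>) (\<phi>' \<circ> \<phi>)"
proof -
  have "\<exists>\<mu>. \<forall>g. linv (\<pi>' (\<pi> t)) (\<phi>' (\<phi> g)) = \<mu> (linv t g)" for t
  proof -
    obtain \<mu> where "\<And>g. linv (\<pi> t) (\<phi> g) = \<mu> (linv t g)" using assms(1) unfolding compat_def by blast
    moreover obtain \<mu>' where "\<And>g. linv (\<pi>' (\<pi> t)) (\<phi>' g) = \<mu>' (linv (\<pi> t) g)"
      using assms(2) unfolding compat_def by blast
    ultimately show ?thesis by (intro exI[of _ "\<mu>' \<circ> \<mu>"]) simp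
  qed
  moreover have "\<exists>\<nu>. \<forall>g. fst (linv (\<pi>' (\<pi> t)) (\<phi>' (\<phi> g))) = \<nu> (fst (linv t g))" for t
  proof -
    obtain \<nu> where "\<And>g. fst (linv (\<pi> t) (\<phi> g)) = \<nu> (fst (linv t g))" using assms(1) unfolding compat_def by blast
    moreover obtain \<nu>' where "\<And>g. fst (linv (\<pi>' (\<pi> t)) (\<phi>' g)) = \<nu>' (fst (linv (\<pi> t) g))"
      using assms(2) unfolding compat_def by blast
    ultimately show ?thesis by (intro exI[of _ "\<nu>' \<circ> \<nu>"]) simp
  qed
  moreover have "bij (\<pi>' \<circ> \<pi>)" "bij (\<phi>' \<circ> \<phi>)"
    using assms unfolding compat_def by (auto intro: bij_comp)
  ultimately show ?thesis unfolding compat_def by simp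
qed

lemma compat_id: "compat id id"
proof -
  have "linv t (id g) = id (linv t g)" "fst (linv t (id g)) = id (fst (linv t g))" for t g by simp_all
  then show ?thesis unfolding compat_def by (metis bij_id id_apply)
qed

text \<open>Reduces every parameter t to \<infinity>: a shift takes t to 0 and the swap takes 0 to
  \<infinity>, while k changes at most its sign.\<close>

lemma obtain_compat_None:
  assumes "k \<noteq> 0"
  obtains \<pi> \<phi> k' where "compat \<pi> \<phi>" "\<pi> t = None" "\<phi> ` H (Some k) = H (Some k')" "k' \<noteq> 0"
proof (cases t)
  case None
  then show ?thesis using that[of id id k] compat_id assms by simp
next
  case (Some s)
  show ?thesis
  proof (rule that)
    show "compat (swap_t \<circ> map_option (\<lambda>t. t + - s)) (swap \<circ> shift (- s))"
      by (rule compat_comp[OF compat_shift compat_swap])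
    show "(swap_t \<circ> map_option (\<lambda>t. t + - s)) t = None" by (simp add: Some swap_t_def)
    show "(swap \<circ> shift (- s)) ` H (Some k) = H (Some (- k))"
      by (simp only: image_comp[symmetric] shift_H swap_H)
  qed (use assms in simp)
qed

text \<open>The points over t = 0 suffice, as the quadratic term vanishes there. Taking b = 0 yields
  d = d'; eliminating \<alpha>_1 - \<alpha>'_1 by means of b = 1 leaves \<sigma>(b) = b for all b,
  unless \<alpha>_2 = \<alpha>'_2.\<close>

lemma subtended_None_inj:
  assumes k: "k \<noteq> 0" and \<sigma>: "\<sigma> \<noteq> id" and n: "\<not> inW (Some k) \<alpha>" "\<not> inW (Some k) \<alpha>'"
    and eq: "subtended_by S (geom (H (Some k))) (Coset (fib None (\<alpha>, d))) =
      subtended_by S (geom (H (Some k))) (Coset (fib None (\<alpha>', d')))"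
  shows "(\<alpha>, d) = (\<alpha>', d')"
proof -
  define u :: "'a \<Rightarrow> 'a^2" where "u b = vector [b, - m * k * \<sigma> b]" for b
  have u: "inU (Some k) (u b)" for b by (simp add: inU_def u_def)
  have *: "d + dotp (u b) \<alpha> = d' + dotp (u b) \<alpha>'" for b
  proof -
    have "Coset (fib (Some 0) (u b, d + dotp (u b) \<alpha> + dotp (\<alpha> v* A 0) \<alpha>)) \<in>
        subtended_by S (geom (H (Some k))) (Coset (fib None (\<alpha>', d')))"
      using u unfolding eq[symmetric] subtended_None[OF n(1)] by blast
    then show ?thesis
      unfolding subtended_None[OF n(2)] by (simp add: dotp_2)
  qed
  have d: "d = d'" using *[of 0] by (simp add: u_def dotp_2)
  have lin: "b * (\<alpha>$1 - \<alpha>'$1) = m * k * \<sigma> b * (\<alpha>$2 - \<alpha>'$2)" for b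
    using *[of b] d by (simp add: u_def dotp_2 algebra_simps)
  have "\<alpha>$2 = \<alpha>'$2"
  proof (rule ccontr)
    assume n2: "\<alpha>$2 \<noteq> \<alpha>'$2"
    have "\<sigma> b = b" for b
    proof -
      have "m * k * \<sigma> b * (\<alpha>$2 - \<alpha>'$2) = b * (m * k * (\<alpha>$2 - \<alpha>'$2))"
        using lin[of b] lin[of 1] by (metis \<sigma>_simps(3) mult.right_neutral mult_1)
      then have "(m * k * (\<alpha>$2 - \<alpha>'$2)) * \<sigma> b = (m * k * (\<alpha>$2 - \<alpha>'$2)) * b" by (simp add: mult_ac)
      then have "m * k * (\<alpha>$2 - \<alpha>'$2) = 0 \<or> \<sigma> b = b" by (simp only: mult_cancel_left)
      then show ?thesis using n2 k by simp
    qed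
    then show False using \<sigma> by auto
  qed
  moreover from this have "\<alpha>$1 = \<alpha>'$1" using lin[of 1] by simp
  ultimately show ?thesis using d by (simp add: vec2_eq_iff)
qed

lemma singly_subtended_H:
  assumes k: "k \<noteq> 0" and \<sigma>: "\<sigma> \<noteq> id"
  shows "singly_subtended S (geom (H (Some k)))"
  unfolding singly_subtended_def
proof (rule inj_onI)
  let ?T = "geom (H (Some k))"
  fix x y assume x: "x \<in> Points S - Points ?T" and y: "y \<in> Points S - Points ?T"
    and eq: "subtended_by S ?T x = subtended_by S ?T y"
  have "\<exists>t p. z = Coset (fib t p)" if "z \<in> Points S - Points ?T" for z
  proof -
    have "z \<in> Points S" using that by simp
    then show ?thesis using that by (cases rule: Points_S_cases) (auto simp: Symb_in_geom)
  qed
  then obtain t p t' p' where tp: "x = Coset (fib t p)" "y = Coset (fib t' p')" using x y by meson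
  \<comment> \<open>A subtended ovoid contains exactly one symbol, that of the subtending point, so
    t can be read off from the ovoid.\<close>
  have "Symb t \<in> subtended_by S ?T x" by (simp add: subtended_by_def Symb_in_geom tp collinear_Symb)
  then have t': "t' = t" unfolding eq by (simp add: subtended_by_def tp collinear_Symb)
  obtain \<pi> \<phi> k' where c: "compat \<pi> \<phi>" "\<pi> t = None" "\<phi> ` H (Some k) = H (Some k')" "k' \<noteq> 0"
    by (rule obtain_compat_None[OF k])
  let ?f = "point_map \<pi> \<phi>" and ?T' = "geom (H (Some k'))"
  have im: "image_geometry ?f (line_map \<phi>) ?T = ?T'" using image_geom[OF c(1)] c(3) by simp
  note aut = automorphism_compat[OF c(1)]
  have eq': "subtended_by S ?T' (?f x) = subtended_by S ?T' (?f y)"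
    using subtended_by_image[OF aut subgeometry_geom] eq x y im by (metis DiffD1)
  have out: "?f x \<in> Points S - Points ?T'" "?f y \<in> Points S - Points ?T'"
    using Points_diff_image[OF aut subgeometry_geom] x y im by (metis imageI)+
  have None: "\<exists>p'. ?f (Coset (fib t p)) = Coset (fib None p')" for p
  proof -
    obtain g where "p = linv t g" by (rule obtain_linv)
    then show ?thesis using point_map_fib(1)[OF c(1), of t g] c(2) by auto
  qed
  obtain \<alpha> d \<alpha>' d' where fx: "?f x = Coset (fib None (\<alpha>, d))" "?f y = Coset (fib None (\<alpha>', d'))"
    using None[of p] None[of p'] tp t' by (metis surj_pair)
  have "(\<alpha>, d) = (\<alpha>', d')"
    using out eq' unfolding fx by (intro subtended_None_inj[OF c(4) \<sigma>]) (auto simp: Coset_in_geom_H)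
  then have "?f x = ?f y" using fx by simp
  moreover have "inj_on ?f (Points S)" using aut by (auto simp: isomorphism_def bij_betw_def)
  ultimately show "x = y" using x y by (auto dest: inj_onD)
qed

section \<open>The subtended ovoids are Kantor-Knuth ovoids\<close>

text \<open>Only lines \<open>LE a x b\<close> need work: they require a unique solution t of x = t
  a^2 - n \<sigma>(t). The right-hand side is additive in t, and a kernel element s satisfies n
  \<sigma>(s) s = (s a)^2, hence vanishes.\<close>

lemma ovoid_qgeom:
  assumes n: "\<not> is_square n"
  shows "ovoid qgeom (insert PInf {PB t b (- n * \<sigma> t) | t b. True})"
  unfolding ovoid_def
proof (intro conjI ballI)
  fix l
  let ?O = "insert PInf {PB t b (- n * \<sigma> t) | t b. True}"
  have "\<exists>!p. p \<in> ?O \<and> qinc p l"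
  proof (cases l)
    case (LE a x b)
    have inj: "inj (\<lambda>t. t * a^2 - n * \<sigma> t)"
    proof (rule injI)
      fix t t' assume "t * a^2 - n * \<sigma> t = t' * a^2 - n * \<sigma> t'"
      then have eq: "n * \<sigma> (t - t') = (t - t') * a^2" by (simp add: algebra_simps)
      have "n * (\<sigma> (t - t') * (t - t')) = (n * \<sigma> (t - t')) * (t - t')" by (simp only: mult.assoc)
      also have "\<dots> = ((t - t') * a)^2" unfolding eq by (simp only: power2_eq_square mult_ac)
      finally have "n * (\<sigma> (t - t') * (t - t')) = ((t - t') * a)^2" .
      then show "t = t'" using nonsquare_\<sigma>_mult_eq_square[OF n] by (metis eq_iff_diff_eq_0)
    qed
    then have "surj (\<lambda>t. t * a^2 - n * \<sigma> t)" by (rule finite_UNIV_inj_surj[OF finite])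
    then obtain t where t: "x = t * a^2 - n * \<sigma> t" by (rule surjE)
    have u: "t' = t" if "x = t' * a^2 - n * \<sigma> t'" for t'
      using injD[OF inj, of t' t] that t by simp
    show ?thesis
    proof (rule ex1I[of _ "PB t (b - t * a) (- n * \<sigma> t)"])
      show "PB t (b - t * a) (- n * \<sigma> t) \<in> ?O \<and> qinc (PB t (b - t * a) (- n * \<sigma> t)) l"
        using t by (simp add: LE)
    next
      fix p assume p: "p \<in> ?O \<and> qinc p l"
      then obtain t' b' where p': "p = PB t' b' (- n * \<sigma> t')" by (auto simp: LE)
      then have "b' = b - t' * a" "- n * \<sigma> t' = x - t' * a^2" using p by (simp_all add: LE)
      moreover from this have "t' = t" by (intro u) (simp add: algebra_simps)
      ultimately show "p = PB t (b - t * a) (- n * \<sigma> t)" using p' by simp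
    qed
  next
    case (LS t b)
    show ?thesis by (rule ex1I[of _ "PB t b (- n * \<sigma> t)"]) (auto simp: LS)
  qed auto
  then show "\<exists>!p. p \<in> ?O \<and> (p, l) \<in> Inc qgeom" by (simp add: qgeom_def)
qed (simp add: qgeom_def)

lemma image_standard_KK_ovoid:
  "(\<lambda>p. vec.span {pvec p}) ` insert PInf {PB t b (- n * \<sigma> t) | t b. True} = standard_KK_ovoid n \<sigma>"
proof -
  have *: "vec.span {pvec (PB t b (- n * \<sigma> t))} = homogeneous 1 t b (- n * \<sigma> t) (n * (\<sigma> t * t) - b^2)" for t b
    by (simp add: homogeneous_eq algebra_simps)
  have "(\<lambda>p. vec.span {pvec p}) ` {PB t b (- n * \<sigma> t) | t b. True} =
      {vec.span {pvec (PB t b (- n * \<sigma> t))} | t b. True}"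
    by blast
  then have "(\<lambda>p. vec.span {pvec p}) ` {PB t b (- n * \<sigma> t) | t b. True} =
      {homogeneous 1 t b (- n * \<sigma> t) (n * (\<sigma> t * t) - b^2) | t b. True}"
    by (simp only: *)
  moreover have "vec.span {pvec (PInf :: 'a qpoint)} = homogeneous 0 0 0 0 1" by (simp add: homogeneous_eq)
  ultimately show ?thesis by (simp add: standard_KK_ovoid_def)
qed

lemma KK_ovoid_Q4_standard:
  assumes "\<not> is_square n"
  shows "KK_ovoid_Q4 (standard_KK_ovoid n \<sigma>)"
  unfolding KK_ovoid_Q4_def
proof
  show "ovoid Q4 (standard_KK_ovoid n \<sigma>)"
    using ovoid_iso[OF isomorphism_qgeom_Q4 ovoid_qgeom[OF assms]] unfolding image_standard_KK_ovoid .
  show "\<exists>n' \<tau> f g. \<not> is_square n' \<and> field_automorphism \<tau> \<and> automorphism Q4 f g \<and>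
      f ` standard_KK_ovoid n \<sigma> = standard_KK_ovoid n' \<tau>"
    using assms aut isomorphism_id[of Q4]
    by (intro exI[of _ n] exI[of _ \<sigma>] exI[of _ id] exI[of _ id]) simp
qed

text \<open>
  Coordinates of the subquadrangle \<open>geom (H (Some k))\<close>: in them the group \<open>H (Some k)\<close>
  becomes a Heisenberg group which does not depend on \<open>k\<close>.
\<close>

definition Lk :: "'a \<Rightarrow> 'a \<Rightarrow> 'a" where
  "Lk k x = x - m * k^2 * \<sigma> x"

definition wv :: "'a \<Rightarrow> 'a \<Rightarrow> 'a^2" where
  "wv k a = vector [a, k * \<sigma> a]"

text \<open>With the factor 2, subtracting \<open>wv k a v* K t\<close> becomes b \<mapsto> b - ta.
  Moreover the product of \<open>uv k b\<close> and \<open>wv k a\<close> is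
  \<open>Lk k (2 * b * a)\<close>, and the form A_t takes the value \<open>Lk k (t * a^2)\<close> at
  \<open>wv k a\<close>. Writing the middle entry as \<open>Lk k x\<close> therefore removes k, m
  and \<sigma> from the incidence formulas.\<close>

definition uv :: "'a \<Rightarrow> 'a \<Rightarrow> 'a^2" where
  "uv k b = vector [2 * b, - m * k * \<sigma> (2 * b)]"

lemma wv_uv_nth [simp]:
  "wv k a $ 1 = a" "wv k a $ 2 = k * \<sigma> a" "uv k b $ 1 = 2 * b" "uv k b $ 2 = - m * k * \<sigma> (2 * b)"
  by (simp_all add: wv_def uv_def)

text \<open>A kernel element x satisfies x = m k^2 \<sigma>(x), so that m \<sigma>(x) x = (x/k)^2,
  which is impossible for nonzero x.\<close>

lemma bij_Lk:
  assumes "k \<noteq> 0"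
  shows "bij (Lk k)"
proof -
  have "inj (Lk k)"
  proof (rule injI)
    fix x y assume "Lk k x = Lk k y"
    then have eq: "x - y = m * k^2 * \<sigma> (x - y)" by (simp add: Lk_def algebra_simps)
    have "m * (\<sigma> (x - y) * (x - y)) = ((x - y) / k)^2"
    proof -
      have "((x - y) / k)^2 = (x - y) * (x - y) / k^2" by (simp add: power2_eq_square)
      also have "\<dots> = (m * k^2 * \<sigma> (x - y)) * (x - y) / k^2" using eq by metis
      also have "\<dots> = m * (\<sigma> (x - y) * (x - y))" using assms by simp
      finally show ?thesis by simp
    qed
    then show "x = y" using nonsquare_\<sigma>_mult_eq_square[OF nonsquare_m] by (metis eq_iff_diff_eq_0)
  qed
  then show ?thesis by (simp add: bij_def finite_UNIV_inj_surj)
qed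

definition jp :: "'a \<Rightarrow> 'a qpoint \<Rightarrow> 'a egq_line" where
  "jp k p = (case p of PInf \<Rightarrow> Symb None | PS t \<Rightarrow> Symb (Some t)
     | PA a z \<Rightarrow> Coset (fib None (wv k a, Lk k z))
     | PB t b x \<Rightarrow> Coset (fib (Some t) (uv k b, Lk k x)))"

definition jl :: "'a \<Rightarrow> 'a qline \<Rightarrow> 'a egq_point" where
  "jl k l = (case l of LInf \<Rightarrow> Infinity
     | LA a \<Rightarrow> Star_Coset (sfib None (wv k a))
     | LS t b \<Rightarrow> Star_Coset (sfib (Some t) (uv k b))
     | LE a x b \<Rightarrow> Elem (wv k a, Lk k x, uv k b))"

lemma inW_wv: "inW (Some k) \<alpha> \<longleftrightarrow> (\<exists>a. \<alpha> = wv k a)"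
  by (auto simp: inW_def vec2_eq_iff)

lemma inU_uv: "inU (Some k) \<beta> \<longleftrightarrow> (\<exists>b. \<beta> = uv k b)"
proof
  assume *: "inU (Some k) \<beta>"
  have "\<beta> = uv k (\<beta>$1 / 2)" using * by (simp add: inU_def vec2_eq_iff)
  then show "\<exists>b. \<beta> = uv k b" by blast
qed (auto simp: inU_def)

lemma wv_uv_inj: "wv k a = wv k a' \<longleftrightarrow> a = a'" "uv k b = uv k b' \<longleftrightarrow> b = b'"
  by (auto simp: vec2_eq_iff)

lemma isomorphism_jp:
  assumes k: "k \<noteq> 0"
  shows "isomorphism qgeom (geom (H (Some k))) (jp k) (jl k)"
proof -
  let ?T = "geom (H (Some k))"
  have inj: "Lk k x = Lk k y \<longleftrightarrow> x = y" for x y using bij_Lk[OF k] by (simp add: bij_def inj_eq)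
  have surj: "\<exists>x. y = Lk k x" for y using bij_Lk[OF k] by (simp add: bij_def surj_def)
  have pT: "jp k p \<in> Points ?T" for p
    by (cases p) (auto simp: jp_def Symb_in_geom Coset_in_geom_H inW_wv inU_uv)
  have lT: "jl k l \<in> Lines ?T" for l
  proof (cases l)
    case (LA a)
    have "(wv k a, 0, 0) \<in> H (Some k)" "fst (linv None (wv k a, 0, 0)) = wv k a"
      using inW_wv zero_H by (auto simp: H_def)
    then have "Star_Coset (sfib None (wv k a)) \<in> Lines ?T" unfolding geom_sel by (metis (mono_tags, lifting) UnI2 insertI2 mem_Collect_eq)
    then show ?thesis by (simp add: jl_def LA)
  next
    case (LS t b)
    have "(0, 0, uv k b) \<in> H (Some k)" "fst (linv (Some t) (0, 0, uv k b)) = uv k b"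
      using inU_uv zero_H by (auto simp: H_def vec2_eq_iff)
    then have "Star_Coset (sfib (Some t) (uv k b)) \<in> Lines ?T" unfolding geom_sel by (metis (mono_tags, lifting) UnI2 insertI2 mem_Collect_eq)
    then show ?thesis by (simp add: jl_def LS)
  qed (auto simp: jl_def geom_sel H_def inW_wv inU_uv)
  have "bij_betw (jp k) (Points qgeom) (Points ?T)"
    unfolding bij_betw_def
  proof
    show "inj_on (jp k) (Points qgeom)"
      by (rule inj_onI) (auto simp: jp_def inj wv_uv_inj split: qpoint.splits)
    show "jp k ` Points qgeom = Points ?T"
    proof (intro equalityI subsetI)
      fix x assume x: "x \<in> Points ?T"
      then have "x \<in> Points S" using subgeometry_geom by (auto simp: subgeometry_def)
      then have "\<exists>p. x = jp k p"
      proof (cases rule: Points_S_cases)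
        case (Symb t)
        then have "x = jp k (case t of None \<Rightarrow> PInf | Some s \<Rightarrow> PS s)" by (simp add: jp_def split: option.split)
        then show ?thesis by blast
      next
        case (Coset t p)
        obtain u c where p: "p = (u, c)" by (cases p)
        obtain z where z: "c = Lk k z" using surj by blast
        show ?thesis
        proof (cases t)
          case None
          then have "inW (Some k) u" using x Coset p by (simp add: Coset_in_geom_H)
          then obtain a where "u = wv k a" by (auto simp: inW_wv)
          then have "x = jp k (PA a z)" using Coset None p z by (simp add: jp_def)
          then show ?thesis by blast
        next
          case (Some s)
          then have "inU (Some k) u" using x Coset p by (simp add: Coset_in_geom_H)
          then obtain b where "u = uv k b" by (auto simp: inU_uv)
          then have "x = jp k (PB s b z)" using Coset Some p z by (simp add: jp_def)
          then show ?thesis by blast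
        qed
      qed
      then show "x \<in> jp k ` Points qgeom" by (auto simp: qgeom_def)
    qed (use pT in auto)
  qed
  moreover have "bij_betw (jl k) (Lines qgeom) (Lines ?T)"
    unfolding bij_betw_def
  proof
    show "inj_on (jl k) (Lines qgeom)"
      by (rule inj_onI) (auto simp: jl_def inj wv_uv_inj split: qline.splits)
    show "jl k ` Lines qgeom = Lines ?T"
    proof (intro equalityI subsetI)
      fix L assume L: "L \<in> Lines ?T"
      have elem: "\<exists>a x b. g = (wv k a, Lk k x, uv k b)" if g: "g \<in> H (Some k)" for g
      proof -
        obtain \<alpha> c \<beta> where gg: "g = (\<alpha>, c, \<beta>)" by (cases g)
        then have "inW (Some k) \<alpha>" "inU (Some k) \<beta>" using g by (simp_all add: H_def)
        then show ?thesis using gg surj[of c] unfolding inW_wv inU_uv by blast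
      qed
      have "\<exists>l. L = jl k l"
      proof -
        consider "L = Infinity" | g where "g \<in> H (Some k)" "L = Elem g"
          | t g where "g \<in> H (Some k)" "L = Star_Coset (sfib t (fst (linv t g)))"
          using L unfolding geom_sel by blast
        then show ?thesis
        proof cases
          case 1
          then have "L = jl k LInf" by (simp add: jl_def)
          then show ?thesis by blast
        next
          case (2 g)
          then obtain a x b where "g = (wv k a, Lk k x, uv k b)" using elem by blast
          then have "L = jl k (LE a x b)" using 2 by (simp add: jl_def)
          then show ?thesis by blast
        next
          case (3 t g)
          then obtain a x b where g: "g = (wv k a, Lk k x, uv k b)" using elem by blast
          show ?thesis
          proof (cases t)
            case None
            then have "L = jl k (LA a)" using 3 g by (simp add: jl_def)
            then show ?thesis by blast
          next
            case (Some s)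
            have "uv k b - wv k a v* K s = uv k (b - s * a)"
              by (simp add: vec2_eq_iff algebra_simps)
            then have "L = jl k (LS s (b - s * a))" using 3 g Some by (simp add: jl_def)
            then show ?thesis by blast
          qed
        qed
      qed
      then show "L \<in> jl k ` Lines qgeom" by (auto simp: qgeom_def)
    qed (use lT in auto)
  qed
  moreover have "(jp k p, jl k l) \<in> Inc ?T \<longleftrightarrow> (p, l) \<in> Inc qgeom" for p l
  proof -
    have "(jp k p, jl k l) \<in> Inc ?T \<longleftrightarrow> (jp k p, jl k l) \<in> Inc S"
      using pT[of p] lT[of l] subgeometry_geom[of "H (Some k)"] by (auto simp: subgeometry_def)
    also have "\<dots> \<longleftrightarrow> qinc p l"
    proof (cases p)
      case (PA a z)
      show ?thesis
      proof (cases l)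
        case (LE a' x b)
        have "Lk k x - dotp (uv k b) (wv k a') = Lk k (x - 2 * b * a')"
          by (simp add: Lk_def dotp_2 power2_eq_square algebra_simps)
        then show ?thesis using PA LE by (auto simp: jp_def jl_def inj wv_uv_inj)
      qed (use PA in \<open>auto simp: jp_def jl_def inj wv_uv_inj\<close>)
    next
      case (PB t b x)
      show ?thesis
      proof (cases l)
        case (LE a x' b')
        have "Lk k x' - dotp (wv k a v* A t) (wv k a) = Lk k (x' - t * a^2)"
          by (simp add: Lk_def dotp_2 power2_eq_square algebra_simps)
        moreover have "uv k b' - wv k a v* K t = uv k (b' - t * a)"
          by (simp add: vec2_eq_iff algebra_simps)
        ultimately show ?thesis using PB LE by (auto simp: jp_def jl_def inj wv_uv_inj)
      qed (use PB in \<open>auto simp: jp_def jl_def inj wv_uv_inj\<close>)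
    qed (cases l; auto simp: jp_def jl_def)+
    finally show ?thesis by (simp add: qgeom_def)
  qed
  ultimately show ?thesis by (auto simp: isomorphism_def)
qed

text \<open>Since \<open>Lk k x\<close> is x - m k^2 \<sigma>(x), the condition for a point of the
  ovoid reads x = -m (e^2 \<sigma>(t) + 2ke \<sigma>(b) - k^2 \<sigma>(x)). For k = e \<sigma>(l)
  the bracket is e^2 \<sigma>(T) with T = t + 2lb - l^2 x, so the ovoid is standard with n = m e^2
  once T is a coordinate.\<close>

lemma KK_ovoid_subtended_base:
  assumes k: "k \<noteq> 0" and e: "e \<noteq> 0"
  shows "KK_ovoid TYPE('a) (geom (H (Some k)))
    (subtended_by S (geom (H (Some k))) (Coset (fib None (vector [0, e], 0))))"
proof -
  let ?T = "geom (H (Some k))"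
  let ?O = "subtended_by S ?T (Coset (fib None (vector [0, e], 0)))"
  define P where "P = insert PInf {PB t b x | t b x. Lk k x = - m * k * \<sigma> (2 * b) * e - m * \<sigma> t * e^2}"
  define n where "n = m * e^2"
  have n: "\<not> is_square n"
  proof
    assume "is_square n"
    then obtain y where "m * e^2 = y^2" by (auto simp: n_def elim: is_nth_powerE)
    then have "m = (y / e)^2" using e by (simp add: power_divide field_simps)
    then show False using nonsquare_m by simp
  qed
  have "\<not> inW (Some k) (vector [0, e])" using e by (simp add: inW_def)
  then have "?O = insert (Symb None) {Coset (fib (Some t) (u, 0 + dotp u (vector [0, e]) +
      dotp (vector [0, e] v* A t) (vector [0, e]))) | t u. inU (Some k) u}"
    by (rule subtended_None)
  also have "\<dots> = jp k ` P"
  proof -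
    have "{Coset (fib (Some t) (u, 0 + dotp u (vector [0, e]) +
      dotp (vector [0, e] v* A t) (vector [0, e]))) | t u. inU (Some k) u} =
      jp k ` {PB t b x | t b x. Lk k x = - m * k * \<sigma> (2 * b) * e - m * \<sigma> t * e^2}" (is "?l = ?r")
    proof (intro equalityI subsetI)
      fix y assume "y \<in> ?l"
      then obtain t b where y: "y = Coset (fib (Some t) (uv k b, 0 + dotp (uv k b) (vector [0, e]) +
          dotp (vector [0, e] v* A t) (vector [0, e])))" by (auto simp: inU_uv)
      obtain x where x: "Lk k x = - m * k * \<sigma> (2 * b) * e - m * \<sigma> t * e^2"
        using bij_Lk[OF k] by (metis bij_pointE)
      then have "y = jp k (PB t b x)" using y by (simp add: jp_def dotp_2 power2_eq_square mult_ac)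
      then show "y \<in> ?r" using x by blast
    next
      fix y assume "y \<in> ?r"
      then obtain t b x where y: "y = jp k (PB t b x)" "Lk k x = - m * k * \<sigma> (2 * b) * e - m * \<sigma> t * e^2" by blast
      have "y = Coset (fib (Some t) (uv k b, 0 + dotp (uv k b) (vector [0, e]) +
          dotp (vector [0, e] v* A t) (vector [0, e])))"
        using y by (simp add: jp_def dotp_2 power2_eq_square mult_ac)
      then show "y \<in> ?l" using inU_uv by blast
    qed
    then show ?thesis by (simp add: P_def jp_def)
  qed
  finally have O: "?O = jp k ` P" .
  \<comment> \<open>As \<sigma> is onto, the coefficient k/e can be drawn inside \<sigma>.\<close>
  obtain l where l: "k / e = \<sigma> l" by (rule surj_\<sigma>)
  then have k_eq: "k = e * \<sigma> l" using e by (simp add: field_simps)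
  \<comment> \<open>The unipotent isometry whose X_1-coordinate is the linear form T. The change of
    X_2 by -l X_3 compensates for it in the quadratic form, and (0,0,0,0,1) is fixed.\<close>
  define R where "R l v = vec5 (v$0) (v$1 + 2 * l * v$2 - l^2 * v$3) (v$2 - l * v$3) (v$3) (v$4)" for l :: 'a and v :: "'a^5"
  have RR: "R (- l) (R l v) = v" for l v
    by (simp add: R_def vec5_eq_iff power2_eq_square algebra_simps)
  have "bij (R l)" using RR[of l] RR[of "- l"] by (intro o_bij[of "R (- l)"]) auto
  then have R: "automorphism Q4 ((`) (R l)) ((`) (R l))"
    by (intro isometry_automorphism)
      (simp_all add: R_def qform_def vec5_eq_iff power2_eq_square algebra_simps)
  have Rspan: "R l ` vec.span {v} = vec.span {R l v}" for v
  proof -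
    have *: "R l (c *s v) = c *s R l v" for c by (simp add: R_def vec5_eq_iff algebra_simps)
    show ?thesis
    proof (intro equalityI subsetI)
      fix x assume "x \<in> vec.span {R l v}"
      then obtain c where "x = R l (c *s v)" by (auto simp: span_1_iff *)
      then show "x \<in> R l ` vec.span {v}" by (rule image_eqI) (auto simp: span_1_iff)
    qed (auto simp: span_1_iff *)
  qed
  have point: "R l (pvec (PB t b x)) = vec5 1 T Y x (- (T * x + Y^2))"
    if "T = t + 2 * l * b - l^2 * x" "Y = b - l * x" for t b x T Y
    unfolding that by (simp add: R_def vec5_eq_iff power2_eq_square algebra_simps)
  have cond: "Lk k x = - m * k * \<sigma> (2 * b) * e - m * \<sigma> t * e^2 \<longleftrightarrow> x = - n * \<sigma> T"
    if "T = t + 2 * l * b - l^2 * x" for t b x T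
  proof -
    have "Lk k x - (- m * k * \<sigma> (2 * b) * e - m * \<sigma> t * e^2) = x - (- n * \<sigma> T)"
      unfolding that by (simp add: Lk_def n_def k_eq power2_eq_square algebra_simps)
    then show ?thesis by (metis eq_iff_diff_eq_0)
  qed
  have "(\<lambda>p. vec.span {R l (pvec p)}) ` {PB t b x | t b x. Lk k x = - m * k * \<sigma> (2 * b) * e - m * \<sigma> t * e^2} =
      {homogeneous 1 T Y (- n * \<sigma> T) (n * (\<sigma> T * T) - Y^2) | T Y. True}" (is "?l = ?r")
  proof (intro equalityI subsetI)
    fix U assume "U \<in> ?l"
    then obtain t b x where U: "U = vec.span {R l (pvec (PB t b x))}"
      and x: "Lk k x = - m * k * \<sigma> (2 * b) * e - m * \<sigma> t * e^2" by blast
    define T Y where "T = t + 2 * l * b - l^2 * x" and "Y = b - l * x"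
    have xT: "x = - n * \<sigma> T" using cond[OF T_def] x by simp
    have "R l (pvec (PB t b x)) = vec5 1 T Y x (- (T * x + Y^2))" by (rule point[OF T_def Y_def])
    also have "\<dots> = vec5 1 T Y (- n * \<sigma> T) (n * (\<sigma> T * T) - Y^2)" by (simp only: xT) (simp add: algebra_simps)
    finally have "U = homogeneous 1 T Y (- n * \<sigma> T) (n * (\<sigma> T * T) - Y^2)" using U by (simp only: homogeneous_eq)
    then show "U \<in> ?r" by blast
  next
    fix U assume "U \<in> ?r"
    then obtain T Y where U: "U = homogeneous 1 T Y (- n * \<sigma> T) (n * (\<sigma> T * T) - Y^2)" by blast
    define x b t where "x = - n * \<sigma> T" and "b = Y + l * x" and "t = T - 2 * l * b + l^2 * x"
    have T: "T = t + 2 * l * b - l^2 * x" and Y: "Y = b - l * x" by (simp_all add: b_def t_def)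
    have "Lk k x = - m * k * \<sigma> (2 * b) * e - m * \<sigma> t * e^2" using cond[OF T] x_def by simp
    moreover have "U = vec.span {R l (pvec (PB t b x))}"
      unfolding point[OF T Y] U homogeneous_eq by (simp add: x_def algebra_simps)
    ultimately show "U \<in> ?l" by blast
  qed
  moreover have "R l (pvec PInf) = vec5 0 0 0 0 1" by (simp add: R_def vec5_eq_iff)
  ultimately have std: "(\<lambda>p. vec.span {R l (pvec p)}) ` P = standard_KK_ovoid n \<sigma>"
    unfolding P_def standard_KK_ovoid_def image_insert homogeneous_eq by simp
  note iso = isomorphism_jp[OF k]
  define f where "f = (`) (R l) \<circ> ((\<lambda>p. vec.span {pvec p}) \<circ> inv_into (Points qgeom) (jp k))"
  have "isomorphism ?T Q4 f ((`) (R l) \<circ> (lset \<circ> inv_into (Lines qgeom) (jl k)))"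
    unfolding f_def
    by (intro isomorphism_comp[OF isomorphism_comp[OF isomorphism_inv[OF iso] isomorphism_qgeom_Q4] R])
  moreover have "inj (jp k)" using iso by (simp add: isomorphism_def qgeom_def bij_betw_def)
  then have "f (jp k p) = vec.span {R l (pvec p)}" for p
    by (simp add: f_def qgeom_def Rspan inv_f_f)
  then have "f ` ?O = standard_KK_ovoid n \<sigma>"
    unfolding O image_image std[symmetric] by simp
  moreover have "?O \<subseteq> Points ?T" by (auto simp: subtended_by_def)
  ultimately show ?thesis
    unfolding KK_ovoid_def using KK_ovoid_Q4_standard[OF n] by metis
qed

lemma KK_ovoid_transfer:
  assumes c: "compat \<pi> \<phi>" and X: "\<phi> ` X = X'" and x: "x \<in> Points S"
    and KK: "KK_ovoid TYPE('a) (geom X') (subtended_by S (geom X') (point_map \<pi> \<phi> x))"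
  shows "KK_ovoid TYPE('a) (geom X) (subtended_by S (geom X) x)"
proof -
  note aut = automorphism_compat[OF c]
  have im: "image_geometry (point_map \<pi> \<phi>) (line_map \<phi>) (geom X) = geom X'"
    using image_geom[OF c] X by simp
  show ?thesis
  proof (rule KK_ovoid_iso)
    show "isomorphism (geom X) (geom X') (point_map \<pi> \<phi>) (line_map \<phi>)"
      using subgeometry_image(2)[OF aut subgeometry_geom] im by metis
    show "KK_ovoid TYPE('a) (geom X') (point_map \<pi> \<phi> ` subtended_by S (geom X) x)"
      using KK subtended_by_image[OF aut subgeometry_geom x] im by metis
  qed (auto simp: subtended_by_def)
qed

lemma point_map_out:
  assumes c: "compat \<pi> \<phi>" and X: "\<phi> ` X = X'" and x: "x \<in> Points S - Points (geom X)"
  shows "point_map \<pi> \<phi> x \<in> Points S - Points (geom X')"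
  using Points_diff_image[OF automorphism_compat[OF c] subgeometry_geom, of X] image_geom[OF c, of X] X x
  by (metis imageI)

text \<open>An automorphism brings t to \<infinity>, and a translation by an element of the set
  \<open>H\<close>, which preserves the subquadrangle, clears d and the first entry of \<alpha>.
  What remains of \<alpha> is e, nonzero because the point lies outside.\<close>

lemma KK_ovoid_subtended_H:
  assumes k: "k \<noteq> 0" and x: "x \<in> Points S - Points (geom (H (Some k)))"
  shows "KK_ovoid TYPE('a) (geom (H (Some k))) (subtended_by S (geom (H (Some k))) x)"
proof -
  have xS: "x \<in> Points S" using x by simp
  then obtain t p where tp: "x = Coset (fib t p)"
    using x by (cases rule: Points_S_cases) (auto simp: Symb_in_geom)
  obtain g where "p = linv t g" by (rule obtain_linv)
  then have tg: "x = Coset (fib t (linv t g))" using tp by simp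
  obtain \<pi> \<phi> k' where c: "compat \<pi> \<phi>" "\<pi> t = None" "\<phi> ` H (Some k) = H (Some k')" "k' \<noteq> 0"
    by (rule obtain_compat_None[OF k])
  obtain \<alpha> c0 \<beta> where \<phi>g: "\<phi> g = (\<alpha>, c0, \<beta>)" by (cases "\<phi> g")
  define d where "d = c0 - dotp \<beta> \<alpha>"
  have fx: "point_map \<pi> \<phi> x = Coset (fib None (\<alpha>, d))"
    using point_map_fib(1)[OF c(1), of t g] c(2) tg \<phi>g by (simp add: d_def)
  have out: "Coset (fib None (\<alpha>, d)) \<in> Points S - Points (geom (H (Some k')))"
    using point_map_out[OF c(1,3) x] fx by simp
  then have nW: "\<not> inW (Some k') \<alpha>" by (simp add: Coset_in_geom_H)
  define e where "e = \<alpha>$2 - k' * \<sigma> (\<alpha>$1)"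
  have e: "e \<noteq> 0" using nW by (simp add: e_def inW_def)
  define g0 where "g0 = (- wv k' (\<alpha>$1), - d, 0 :: 'a^2)"
  have gH: "transl g0 ` H (Some k') = H (Some k')"
    by (rule image_H_eq[OF compat_transl]) (auto simp: H_def g0_def inW_def inU_def algebra_simps)
  have pm: "point_map id (transl g0) (Coset (fib None (\<alpha>, d))) = Coset (fib None (vector [0, e], 0))"
  proof -
    have l: "linv None (\<alpha>, d, 0) = (\<alpha>, d)" by (simp add: dotp_2)
    have l': "linv None (transl g0 (\<alpha>, d, 0)) = (vector [0, e], 0)"
      by (simp add: g0_def dotp_2 vec2_eq_iff e_def)
    show ?thesis
      using point_map_fib(1)[OF compat_transl[of g0], of None "(\<alpha>, d, 0)"] unfolding l id_apply l' .
  qed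
  have "KK_ovoid TYPE('a) (geom (H (Some k'))) (subtended_by S (geom (H (Some k')))
      (point_map id (transl g0) (Coset (fib None (\<alpha>, d)))))"
    unfolding pm by (rule KK_ovoid_subtended_base[OF c(4) e])
  then have "KK_ovoid TYPE('a) (geom (H (Some k'))) (subtended_by S (geom (H (Some k'))) (point_map \<pi> \<phi> x))"
    unfolding fx by (rule KK_ovoid_transfer[OF compat_transl gH in_S(2)])
  then show ?thesis
    by (rule KK_ovoid_transfer[OF c(1,3) xS])
qed

section \<open>Orbits of subquadrangles\<close>

lemma mem_transl_H:
  "(\<alpha>, c, \<beta>) \<in> transl (\<alpha>0, c0, \<beta>0) ` H \<kappa> \<longleftrightarrow> inW \<kappa> (\<alpha> - \<alpha>0) \<and> inU \<kappa> (\<beta> - \<beta>0)"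
proof
  assume *: "inW \<kappa> (\<alpha> - \<alpha>0) \<and> inU \<kappa> (\<beta> - \<beta>0)"
  show "(\<alpha>, c, \<beta>) \<in> transl (\<alpha>0, c0, \<beta>0) ` H \<kappa>"
    by (rule image_eqI[of _ _ "(\<alpha> - \<alpha>0, c - c0 - dotp (\<beta> - \<beta>0) \<alpha>0, \<beta> - \<beta>0)"])
      (use * in \<open>simp_all add: H_def\<close>)
qed (auto simp: H_def)

lemma transl_H_cong:
  assumes "\<And>\<alpha>. inW \<kappa> (\<alpha> - \<alpha>0) \<longleftrightarrow> inW \<kappa> (\<alpha> - \<alpha>1)" "\<And>\<beta>. inU \<kappa> (\<beta> - \<beta>0) \<longleftrightarrow> inU \<kappa> (\<beta> - \<beta>1)"
  shows "transl (\<alpha>0, c0, \<beta>0) ` H \<kappa> = transl (\<alpha>1, c1, \<beta>1) ` H \<kappa>"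
proof -
  have "g \<in> transl (\<alpha>0, c0, \<beta>0) ` H \<kappa> \<longleftrightarrow> g \<in> transl (\<alpha>1, c1, \<beta>1) ` H \<kappa>" for g
    using assms by (cases g) (simp only: mem_transl_H)
  then show ?thesis by blast
qed

lemma geom_in_orbit: "compat \<pi> \<phi> \<Longrightarrow> geom (\<phi> ` X) \<in> aut_orbit S (geom X)"
  unfolding aut_orbit_def
  by (intro CollectI exI conjI) (rule image_geom[symmetric], assumption, rule automorphism_compat)

lemma aut_orbit_geom: "compat \<pi> \<phi> \<Longrightarrow> aut_orbit S (geom (\<phi> ` X)) = aut_orbit S (geom X)"
  by (rule aut_orbit_eq[OF subgeometry_geom geom_in_orbit])

lemma singly_subtended_transl: "singly_subtended S (geom (transl g0 ` X)) \<longleftrightarrow> singly_subtended S (geom X)"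
  using singly_subtended_image[OF automorphism_compat[OF compat_transl] subgeometry_geom, of g0 X]
  unfolding image_geom[OF compat_transl] .

text \<open>For \<sigma> = 1 the sets W are the q+1 one-dimensional GF(q)-subspaces of GF(q^2),
  which multiplication permutes transitively.\<close>

lemma rot_H:
  assumes \<sigma>: "\<sigma> = id"
  obtains u v where "u \<noteq> 0 \<or> v \<noteq> 0" "rot u v ` H \<kappa> = H (Some k')"
proof (cases \<kappa>)
  case None
  \<comment> \<open>The multiplier m k' + sqrt(m) takes sqrt(m) to m (1 + k' sqrt(m)).\<close>
  have nz: "m * k' \<noteq> 0 \<or> (1::'a) \<noteq> 0" by simp
  have id: "\<sigma> x = x" for x using \<sigma> by simp
  have "rot (m * k') 1 ` H None = H (Some k')"
    by (rule image_H_eq[OF compat_rot[OF \<sigma> nz]]) (auto simp: H_def inW_def inU_def rot_def id)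
  then show ?thesis using that[OF nz] None by simp
next
  case (Some k)
  \<comment> \<open>The multiplier is (1 + k' sqrt(m))(1 - k sqrt(m)), which takes 1 + k sqrt(m) to
    its norm times 1 + k' sqrt(m).\<close>
  define u v where "u = 1 - m * k * k'" and "v = k' - k"
  have id: "\<sigma> x = x" for x using \<sigma> by simp
  have nz: "u \<noteq> 0 \<or> v \<noteq> 0"
  proof (cases "v = 0")
    case True
    have "m * k^2 \<noteq> 1"
    proof
      assume *: "m * k^2 = 1"
      then have "k \<noteq> 0" by auto
      then have "m = (1 / k)^2" using * by (simp add: power_divide field_simps)
      then show False using nonsquare_m by simp
    qed
    then show ?thesis using True by (simp add: u_def v_def power2_eq_square mult.assoc)
  qed simp
  have "rot u v ` H (Some k) = H (Some k')"
    by (rule image_H_eq[OF compat_rot[OF \<sigma> nz]])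
      (auto simp: H_def inW_def inU_def rot_def id u_def v_def algebra_simps)
  then show ?thesis using that[OF nz] Some by simp
qed

lemma big_orbit_if_id:
  assumes \<sigma>: "\<sigma> = id" and fin: "finite (aut_orbit S (geom (H \<kappa>)))"
  shows "CARD('a) ^ 3 \<le> card (aut_orbit S (geom (H \<kappa>)))"
proof -
  \<comment> \<open>The vectors (0, a) and (0, b) represent each coset of the two graphs once, so k,
    a, b give q^3 different translates.\<close>
  define G where "G = (\<lambda>(k :: 'a, a :: 'a, b :: 'a). geom (transl (vector [0, a], 0, vector [0, b]) ` H (Some k)))"
  have "inj G"
  proof (rule injI)
    fix x y assume eq: "G x = G y"
    obtain k a b k' a' b' where xy: "x = (k, a, b)" "y = (k', a', b')" by (cases x, cases y)
    have *: "transl (vector [0, a], 0, vector [0, b]) ` H (Some k) = transl (vector [0, a'], 0, vector [0, b']) ` H (Some k')"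
      using eq by (simp add: G_def xy geom_eq_iff)
    have "(vector [0, a], 0, vector [0, b]) \<in> transl (vector [0, a], 0, vector [0, b]) ` H (Some k)"
      by (simp add: mem_transl_H zero_H)
    then have "a = a'" "b = b'" unfolding * mem_transl_H by (simp_all add: inW_def inU_def)
    \<comment> \<open>A test element for the slope: its \<alpha> differs from that of the base point
      by (1, k).\<close>
    have "(vector [1, k + a], 0, vector [0, b]) \<in> transl (vector [0, a], 0, vector [0, b]) ` H (Some k)"
      by (simp add: mem_transl_H inW_def inU_def)
    then have "k = k'" unfolding * mem_transl_H using \<open>a = a'\<close> by (simp add: inW_def inU_def)
    then show "x = y" using xy \<open>a = a'\<close> \<open>b = b'\<close> by simp
  qed
  have "range G \<subseteq> aut_orbit S (geom (H \<kappa>))"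
  proof
    fix T assume "T \<in> range G"
    then obtain x where "T = G x" by blast
    moreover obtain k a b where "x = (k, a, b)" by (cases x)
    ultimately have T: "T = geom (transl (vector [0, a], 0, vector [0, b]) ` H (Some k))" by (simp add: G_def)
    obtain u v where uv: "u \<noteq> 0 \<or> v \<noteq> 0" "rot u v ` H \<kappa> = H (Some k)" by (rule rot_H[OF \<sigma>])
    have "aut_orbit S (geom (H (Some k))) = aut_orbit S (geom (H \<kappa>))"
      using aut_orbit_geom[OF compat_rot[OF \<sigma> uv(1)]] uv(2) by metis
    then show "T \<in> aut_orbit S (geom (H \<kappa>))" using geom_in_orbit[OF compat_transl] T by metis
  qed
  then have "card (range G) \<le> card (aut_orbit S (geom (H \<kappa>)))" using fin by (intro card_mono)
  moreover have "card (range G) = CARD('a) ^ 3"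
    using \<open>inj G\<close> by (simp add: card_image card_cartesian_product[of UNIV UNIV, simplified] eval_nat_numeral)
  ultimately show ?thesis by simp
qed

text \<open>Disposes of the coincidence (q-1)q^2 = 2q^2: every element is 0, 1 or -1, and these are
  fixed by any automorphism.\<close>

lemma id_if_card_3:
  assumes "CARD('a) = 3"
  shows "\<sigma> = id"
proof
  fix x :: 'a
  have "(1::'a) \<noteq> - 1"
  proof
    assume "(1::'a) = - 1"
    then have "(1::'a) + 1 = 0" by (simp add: eq_neg_iff_add_eq_0)
    then show False using two_neq_0 by (simp del: two_neq_0)
  qed
  then have "card {0, 1, - 1 :: 'a} = 3" by simp
  then have U: "{0, 1, - 1 :: 'a} = UNIV" using assms by (intro card_subset_eq) auto
  have "x \<in> {0, 1, -1}" unfolding U by (rule UNIV_I)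
  then show "\<sigma> x = id x" by auto
qed

lemma subquadrangle_in_orbit_form:
  assumes S': "S' \<in> subquadrangles CARD('a) CARD('a) S"
    and card: "card (aut_orbit S S') = (CARD('a) - 1) * CARD('a)^2"
  obtains \<kappa> g0 where "S' = geom (transl g0 ` H \<kappa>)"
proof -
  have "0 < card (aut_orbit S S')" using card CARD_ge_3 by simp
  then have "finite (aut_orbit S S')" by (rule card_ge_0_finite)
  then have "Infinity \<in> Lines S'" using large_orbit_if_not_Infinity[OF S'] card by (metis less_irrefl)
  then show ?thesis using classification[OF S'] that by blast
qed

lemma subquadrangle_in_orbit:
  assumes S': "S' \<in> subquadrangles CARD('a) CARD('a) S"
    and card: "card (aut_orbit S S') = (CARD('a) - 1) * CARD('a)^2"
  obtains k g0 where "k \<noteq> 0" "\<sigma> \<noteq> id" "S' = geom (transl g0 ` H (Some k))"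
proof -
  obtain \<kappa> g0 where S'_eq: "S' = geom (transl g0 ` H \<kappa>)"
    by (rule subquadrangle_in_orbit_form[OF S' card])
  have "0 < card (aut_orbit S S')" using card CARD_ge_3 by simp
  then have fin: "finite (aut_orbit S S')" by (rule card_ge_0_finite)
  obtain n where n: "CARD('a) = Suc n" using CARD_ge_3 by (cases "CARD('a)") auto
  have \<sigma>: "\<sigma> \<noteq> id"
  proof
    assume \<sigma>: "\<sigma> = id"
    have "aut_orbit S S' = aut_orbit S (geom (H \<kappa>))"
      unfolding S'_eq by (rule aut_orbit_geom[OF compat_transl])
    then have "CARD('a) ^ 3 \<le> (CARD('a) - 1) * CARD('a)^2"
      using big_orbit_if_id[OF \<sigma>, of \<kappa>] fin card by simp
    then show False unfolding n by (simp add: eval_nat_numeral)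
  qed
  have "\<not> (\<kappa> = None \<or> \<kappa> = Some 0)"
  proof
    assume \<kappa>: "\<kappa> = None \<or> \<kappa> = Some 0"
    have ns: "\<not> singly_subtended S S'"
      unfolding S'_eq singly_subtended_transl by (rule not_singly_subtended_H[OF \<kappa>])
    \<comment> \<open>For k = 0 or \<infinity> both W and U are coordinate axes, so one entry of
      \<alpha> and one of \<beta> determine a translate. This leaves q^2 translates for either
      k.\<close>
    define G0 where "G0 = (\<lambda>(a :: 'a, b :: 'a). geom (transl (vector [0, a], 0, vector [0, b]) ` H (Some 0)))"
    define G1 where "G1 = (\<lambda>(a :: 'a, b :: 'a). geom (transl (vector [a, 0], 0, vector [b, 0]) ` H None))"
    have "aut_orbit S S' \<subseteq> range G0 \<union> range G1"
    proof
      fix T assume T: "T \<in> aut_orbit S S'"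
      then obtain f g where fg: "automorphism S f g" "T = image_geometry f g S'"
        by (auto simp: aut_orbit_def)
      have sub: "T \<in> subquadrangles CARD('a) CARD('a) S"
        unfolding fg(2) by (rule subquadrangle_image[OF fg(1) S'])
      have "aut_orbit S T = aut_orbit S S'"
        by (rule aut_orbit_eq[OF sub_S'[OF S'] T])
      then obtain \<kappa>1 g1 where T_eq: "T = geom (transl g1 ` H \<kappa>1)"
        using subquadrangle_in_orbit_form[OF sub] card by metis
      \<comment> \<open>Failure of injectivity passes to every member of the orbit, and for \<sigma>
        \<noteq> 1 it excludes all k other than 0 and \<infinity>.\<close>
      have "\<not> singly_subtended S T"
        using ns singly_subtended_image[OF fg(1) sub_S'[OF S']] fg(2) by simp
      then have "\<not> singly_subtended S (geom (H \<kappa>1))"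
        unfolding T_eq singly_subtended_transl .
      then have "\<kappa>1 = None \<or> \<kappa>1 = Some 0"
        using singly_subtended_H[OF _ \<sigma>] by (cases \<kappa>1) auto
      moreover obtain \<alpha> c \<beta> where g1: "g1 = (\<alpha>, c, \<beta>)" by (cases g1)
      moreover have "transl (\<alpha>, c, \<beta>) ` H None = transl (vector [\<alpha>$1, 0], 0, vector [\<beta>$1, 0]) ` H None"
        by (rule transl_H_cong) (simp_all add: inW_def inU_def)
      moreover have "transl (\<alpha>, c, \<beta>) ` H (Some 0) = transl (vector [0, \<alpha>$2], 0, vector [0, \<beta>$2]) ` H (Some 0)"
        by (rule transl_H_cong) (simp_all add: inW_def inU_def)
      ultimately have "T = G1 (\<alpha>$1, \<beta>$1) \<or> T = G0 (\<alpha>$2, \<beta>$2)"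
        unfolding T_eq by (auto simp: G0_def G1_def)
      then show "T \<in> range G0 \<union> range G1" by blast
    qed
    then have "card (aut_orbit S S') \<le> card (range G0 \<union> range G1)" by (intro card_mono) auto
    also have "\<dots> \<le> card (range G0) + card (range G1)" by (rule card_Un_le)
    also have "\<dots> \<le> CARD('a \<times> 'a) + CARD('a \<times> 'a)" by (intro add_mono card_image_le) auto
    also have "\<dots> = 2 * CARD('a)^2" by (simp add: power2_eq_square)
    finally have "(CARD('a) - 1) * CARD('a)^2 \<le> 2 * CARD('a)^2" unfolding card .
    moreover have "0 < CARD('a)^2" using CARD_ge_3 by simp
    ultimately have "CARD('a) - 1 \<le> 2" unfolding mult_le_cancel2 by blast
    then have "CARD('a) = 3" using CARD_ge_3 by simp
    then show False using id_if_card_3 \<sigma> by simp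
  qed
  then obtain k where "\<kappa> = Some k" "k \<noteq> 0" by (cases \<kappa>) auto
  then show ?thesis using that \<sigma> S'_eq by blast
qed

lemma KK_ovoid_subtended:
  assumes k: "k \<noteq> 0" and x: "x \<in> Points S - Points (geom (transl g0 ` H (Some k)))"
  shows "KK_ovoid TYPE('a) (geom (transl g0 ` H (Some k))) (subtended_by S (geom (transl g0 ` H (Some k))) x)"
proof -
  obtain \<alpha>0 c0 \<beta>0 where g0: "g0 = (\<alpha>0, c0, \<beta>0)" by (cases g0)
  \<comment> \<open>The inverse of g0 in G.\<close>
  define g1 where "g1 = (- \<alpha>0, dotp \<beta>0 \<alpha>0 - c0, - \<beta>0)"
  have back1: "transl g1 (transl g0 g) = g" for g
    by (cases g) (simp add: g0 g1_def dotp_2 algebra_simps)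
  then have X: "transl g1 ` transl g0 ` H (Some k) = H (Some k)"
    by (simp add: image_image)
  have "point_map id (transl g1) x \<in> Points S - Points (geom (H (Some k)))"
    by (rule point_map_out[OF compat_transl X x])
  then have "KK_ovoid TYPE('a) (geom (H (Some k))) (subtended_by S (geom (H (Some k))) (point_map id (transl g1) x))"
    by (rule KK_ovoid_subtended_H[OF k])
  moreover have "x \<in> Points S" using x by blast
  ultimately show ?thesis by (intro KK_ovoid_transfer[OF compat_transl X])
qed

end

theorem theorem11p1:
  fixes m :: "'a::{field, finite}" and \<sigma> :: "'a \<Rightarrow> 'a" and q :: nat
    and S :: "('a egq_line, 'a egq_point) geometry"
    and \<Omega>\<^sub>2 :: "('a egq_line, 'a egq_point) geometry set"
  assumes "q = CARD('a)" and "odd q"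
    and "\<not> is_square m" and "field_automorphism \<sigma>"
    and "S = kantor_knuth m \<sigma>"
    and "\<not> classical TYPE('a) S"
    and "\<Omega>\<^sub>2 \<in> aut_orbit S ` subquadrangles q q S"
    and "card \<Omega>\<^sub>2 = (q - 1) * q^2"
  shows "(\<forall>S'\<in>\<Omega>\<^sub>2. \<not> doubly_subtended S S') \<and>
         (\<forall>S'\<in>\<Omega>\<^sub>2. card {\<O>. KK_ovoid TYPE('a) S' \<O> \<and> theta_subtended S S' 1 \<O>}
                     = (q + 1) * q^2 * (q - 1))"
proof -
  interpret kk_data m \<sigma>
    using assms by unfold_locales auto
  obtain S1 where S1: "S1 \<in> subquadrangles q q S" "\<Omega>\<^sub>2 = aut_orbit S S1" using assms(7) by auto
  have "\<not> doubly_subtended S S' \<and>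
      card {\<O>. KK_ovoid TYPE('a) S' \<O> \<and> theta_subtended S S' 1 \<O>} = (q + 1) * q^2 * (q - 1)"
    if S': "S' \<in> \<Omega>\<^sub>2" for S'
  proof -
    obtain f g where "automorphism S f g" "S' = image_geometry f g S1"
      using S' S1(2) by (auto simp: aut_orbit_def)
    then have sub: "S' \<in> subquadrangles q q S" using subquadrangle_image S1(1) by metis
    have "aut_orbit S S' = \<Omega>\<^sub>2"
      using aut_orbit_eq[of S1 S S'] S' S1 by (simp add: subquadrangles_iff)
    then have orb: "card (aut_orbit S S') = (q - 1) * q^2" using assms(8) by simp
    obtain k g0 where k: "k \<noteq> 0" "\<sigma> \<noteq> id" and S'_eq: "S' = geom (transl g0 ` H (Some k))"
      using subquadrangle_in_orbit[of S'] sub orb unfolding assms(1,5) by metis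
    have singly: "singly_subtended S S'"
      unfolding S'_eq assms(5) singly_subtended_transl by (rule singly_subtended_H[OF k])
    have KK: "KK_ovoid TYPE('a) S' \<O>" if \<O>: "\<O> \<in> subtended_ovoids S S'" for \<O>
      using KK_ovoid_subtended[OF k(1), of _ g0] \<O> unfolding subtended_ovoids_def S'_eq assms(5) by blast
    \<comment> \<open>A 1-subtended ovoid is subtended by definition; conversely every subtended
      ovoid here is both Kantor-Knuth and 1-subtended.\<close>
    have "{\<O>. KK_ovoid TYPE('a) S' \<O> \<and> theta_subtended S S' 1 \<O>} = subtended_ovoids S S'"
      using KK theta_subtended_1_iff[OF singly] by blast
    moreover have "card (subtended_ovoids S S') = card (Points S - Points S')"
      unfolding subtended_ovoids_def using singly by (intro card_image) (simp add: singly_subtended_def)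
    moreover have cd: "card (Points S - Points S') = (q + 1) * q^2 * (q - 1)"
      using card_Points_diff[of S'] sub unfolding assms(1,5) by simp
    moreover have "\<not> doubly_subtended S S'"
    proof
      assume d: "doubly_subtended S S'"
      \<comment> \<open>Being doubly subtended would hold vacuously without outside points, so their
        existence is needed before 1 = 2 can be derived.\<close>
      have "Points S - Points S' \<noteq> {}" using cd CARD_ge_3 assms(1) by (intro notI) simp
      then obtain \<O> where \<O>: "\<O> \<in> subtended_ovoids S S'" unfolding subtended_ovoids_def by blast
      then have "theta_subtended S S' 1 \<O>" "theta_subtended S S' 2 \<O>"
        using d theta_subtended_1_iff[OF singly] by (auto simp: doubly_subtended_def)
      then show False by (simp add: theta_subtended_def)
    qed
    ultimately show ?thesis by simp
  qed
  then show ?thesis by blast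
qed

end
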